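(* Let $K:\mathbb{B}\rightarrow\mathbb{A}$ be a functor from a small category $\mathbb{B}$ into a category $\mathbb{A}$ with small hom-sets. There is an adjunction $Set^K\dashv Ran_K$, with $Set^K:Set^\mathbb{A}\rightarrow Set^\mathbb{B}$ given by precomposition with $K$ and $Ran_K$ given by right Kan extensions calculated as pointwise limits. Factorizing its unit morphisms $\theta_S:S\rightarrow Ran_K(SK)$ componentwise as surjections followed by injections gives rise to a full reflection with stable units $I:Set^\mathbb{A}\rightarrow Mono(Set^K)$ (left adjoint to the full inclusion $H$). If $K(ob\mathbb{B})$ is a cogenerating set for $\mathbb{A}$, then $(\mathcal{E}'_I,\mathcal{M}^*_I)$ is a monotone-light factorization system on $Set^\mathbb{A}$, where $K(ob\mathbb{B})$ is the set of images under $K$ of the objects of $\mathbb{B}$.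
   Context: A set $S$ of objects of $\mathbb{A}$ is a cogenerating set for $\mathbb{A}$ if, for every two distinct parallel morphisms $f,g:A'\rightarrow A$ in $\mathbb{A}$, there exist an object $N\in S$ and a morphism $h:A\rightarrow N$ with $h\circ f\neq h\circ g$. $Mono(Set^K)$ is the full subcategory of $Set^\mathbb{A}$ determined by the objects $S$ for which the unit morphism $\theta_S:S\rightarrow Ran_K(SK)$ is a monomorphism (componentwise injective). The reflection $I$ has unit $\eta$, where $\theta_S=\mu_S\circ\eta_S$ with $\eta_S$ componentwise surjective and $\mu_S$ componentwise injective. For a full reflection $I\dashv H:\mathbb{M}\rightarrow\mathbb{C}$ of a category $\mathbb{C}$ with pullbacks: $\mathcal{E}_I$ is the class of morphisms $f$ of $\mathbb{C}$ with $If$ an isomorphism; $\mathcal{M}_I$ is the class of morphisms $m$ right orthogonal to every $e\in\mathcal{E}_I$ (for every commutative square $v\circ e=m\circ u$ there is a unique $w$ with $w\circ e=u$, $m\circ w=v$); $\mathcal{E}'_I$ is the class of morphisms all of whose pullbacks lie in $\mathcal{E}_I$; $\mathcal{M}^*_I$ is the class of morphisms $f:A\rightarrow B$ for which there is an effective descent morphism $p:E\rightarrow B$ (i.e. $p^*:\mathbb{C}/B\rightarrow\mathbb{C}/E$ is monadic) such that the pullback $p^*(f)$ of $f$ along $p$ lies in $\mathcal{M}_I$. The reflection has stable units if every unit morphism $\eta_C$ belongs to $\mathcal{E}'_I$. A monotone-light factorization system exists when $(\mathcal{E}'_I,\mathcal{M}^*_I)$ is an (orthogonal) factorization system on $\m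athbb{C}$.
   Formalization: The monotone-light claim is proved assuming also that A is equivalent to a small category and that every object of A has a morphism to some K(b); without these it is false (e.g. B empty and A terminal, or a suitable large poset A). *)

theory Defs
  imports Main "HOL-Library.FuncSet" "HOL-Library.Equipollence"
begin

section \<open>Categories, functors, natural transformations\<close>

record ('o, 'm) cat =
  Ob :: "'o set"
  Mor :: "'m set"
  Src :: "'m \<Rightarrow> 'o"
  Tgt :: "'m \<Rightarrow> 'o"
  Idn :: "'o \<Rightarrow> 'm"
  Cmp :: "'m \<Rightarrow> 'm \<Rightarrow> 'm"  (infixr "\<odot>\<index>" 70)

definition hom :: "('o, 'm) cat \<Rightarrow> 'o \<Rightarrow> 'o \<Rightarrow> 'm set" where
  "hom C a b = {f \<in> Mor C. Src C f = a \<and> Tgt C f = b}"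

definition category :: "('o, 'm) cat \<Rightarrow> bool" where
  "category C \<longleftrightarrow>
     (\<forall>f\<in>Mor C. Src C f \<in> Ob C \<and> Tgt C f \<in> Ob C) \<and>
     (\<forall>a\<in>Ob C. Idn C a \<in> hom C a a) \<and>
     (\<forall>f\<in>Mor C. \<forall>g\<in>Mor C. Tgt C f = Src C g \<longrightarrow> g \<odot>\<^bsub>C\<^esub> f \<in> hom C (Src C f) (Tgt C g)) \<and>
     (\<forall>f\<in>Mor C. f \<odot>\<^bsub>C\<^esub> Idn C (Src C f) = f \<and> Idn C (Tgt C f) \<odot>\<^bsub>C\<^esub> f = f) \<and>
     (\<forall>f\<in>Mor C. \<forall>g\<in>Mor C. \<forall>h\<in>Mor C. Tgt C f = Src C g \<longrightarrow> Tgt C g = Src C h \<longrightarrow>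
        h \<odot>\<^bsub>C\<^esub> (g \<odot>\<^bsub>C\<^esub> f) = (h \<odot>\<^bsub>C\<^esub> g) \<odot>\<^bsub>C\<^esub> f)"

definition is_iso :: "('o, 'm) cat \<Rightarrow> 'm \<Rightarrow> bool" where
  "is_iso C f \<longleftrightarrow> f \<in> Mor C \<and>
     (\<exists>g \<in> hom C (Tgt C f) (Src C f).
        g \<odot>\<^bsub>C\<^esub> f = Idn C (Src C f) \<and> f \<odot>\<^bsub>C\<^esub> g = Idn C (Tgt C f))"

text \<open>
  The categories built below have morphisms (source, target, datum). The last argument of
  triple_cat composes data; its first parameter is the source of the composite.
\<close>

definition triple_cat ::
    "'o set \<Rightarrow> ('o \<Rightarrow> 'o \<Rightarrow> 'd set) \<Rightarrow> ('o \<Rightarrow> 'd) \<Rightarrow> ('o \<Rightarrow> 'd \<Rightarrow> 'd \<Rightarrow> 'd) \<Rightarrow> ('o, 'o \<times> 'o \<times> 'd) cat" where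
  "triple_cat O\<^sub>0 H i c =
     \<lparr>Ob = O\<^sub>0,
      Mor = {(x, y, d). x \<in> O\<^sub>0 \<and> y \<in> O\<^sub>0 \<and> d \<in> H x y},
      Src = (\<lambda>(x, y, d). x),
      Tgt = (\<lambda>(x, y, d). y),
      Idn = (\<lambda>x. (x, x, i x)),
      Cmp = (\<lambda>(y', z, e) (x, y, d). (x, z, c x e d))\<rparr>"

abbreviation datum :: "'o \<times> 'o \<times> 'd \<Rightarrow> 'd" where
  "datum f \<equiv> snd (snd f)"

record ('o, 'm, 'p, 'n) func =
  omap :: "'o \<Rightarrow> 'p"
  amap :: "'m \<Rightarrow> 'n"

definition is_functor :: "('o, 'm) cat \<Rightarrow> ('p, 'n) cat \<Rightarrow> ('o, 'm, 'p, 'n) func \<Rightarrow> bool" where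
  "is_functor C D F \<longleftrightarrow> category C \<and> category D \<and>
     (\<forall>a\<in>Ob C. omap F a \<in> Ob D) \<and>
     (\<forall>f\<in>Mor C. amap F f \<in> hom D (omap F (Src C f)) (omap F (Tgt C f))) \<and>
     (\<forall>a\<in>Ob C. amap F (Idn C a) = Idn D (omap F a)) \<and>
     (\<forall>f\<in>Mor C. \<forall>g\<in>Mor C. Tgt C f = Src C g \<longrightarrow>
        amap F (g \<odot>\<^bsub>C\<^esub> f) = amap F g \<odot>\<^bsub>D\<^esub> amap F f)"

definition id_func :: "('o, 'm, 'o, 'm) func" where
  "id_func = \<lparr>omap = (\<lambda>a. a), amap = (\<lambda>f. f)\<rparr>"

definition comp_func ::
    "('p, 'n, 'q, 'k) func \<Rightarrow> ('o, 'm, 'p, 'n) func \<Rightarrow> ('o, 'm, 'q, 'k) func"  (infixr "\<circ>\<^sub>F" 75) where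
  "G \<circ>\<^sub>F F = \<lparr>omap = omap G \<circ> omap F, amap = amap G \<circ> amap F\<rparr>"

definition nat_trans ::
    "('o, 'm) cat \<Rightarrow> ('p, 'n) cat \<Rightarrow> ('o, 'm, 'p, 'n) func \<Rightarrow> ('o, 'm, 'p, 'n) func \<Rightarrow> ('o \<Rightarrow> 'n) \<Rightarrow> bool" where
  "nat_trans C D F G \<tau> \<longleftrightarrow> is_functor C D F \<and> is_functor C D G \<and>
     (\<forall>a\<in>Ob C. \<tau> a \<in> hom D (omap F a) (omap G a)) \<and>
     (\<forall>f\<in>Mor C. amap G f \<odot>\<^bsub>D\<^esub> \<tau> (Src C f) = \<tau> (Tgt C f) \<odot>\<^bsub>D\<^esub> amap F f)"

definition nat_iso ::
    "('o, 'm) cat \<Rightarrow> ('p, 'n) cat \<Rightarrow> ('o, 'm, 'p, 'n) func \<Rightarrow> ('o, 'm, 'p, 'n) func \<Rightarrow> ('o \<Rightarrow> 'n) \<Rightarrow> bool" where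
  "nat_iso C D F G \<tau> \<longleftrightarrow> nat_trans C D F G \<tau> \<and> (\<forall>a\<in>Ob C. is_iso D (\<tau> a))"

definition equivalence_functor ::
    "('o, 'm) cat \<Rightarrow> ('p, 'n) cat \<Rightarrow> ('o, 'm, 'p, 'n) func \<Rightarrow> bool" where
  "equivalence_functor C D F \<longleftrightarrow> is_functor C D F \<and>
     (\<exists>G \<alpha> \<beta>. is_functor D C G \<and> nat_iso C C id_func (G \<circ>\<^sub>F F) \<alpha> \<and> nat_iso D D (F \<circ>\<^sub>F G) id_func \<beta>)"

text \<open>F : C \<rightarrow> D is left adjoint to G : D \<rightarrow> C, with unit \<eta> and counit \<epsilon>.\<close>

definition adjunction ::
    "('o, 'm) cat \<Rightarrow> ('p, 'n) cat \<Rightarrow> ('o, 'm, 'p, 'n) func \<Rightarrow> ('p, 'n, 'o, 'm) func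
       \<Rightarrow> ('o \<Rightarrow> 'm) \<Rightarrow> ('p \<Rightarrow> 'n) \<Rightarrow> bool" where
  "adjunction C D F G \<eta> \<epsilon> \<longleftrightarrow> is_functor C D F \<and> is_functor D C G \<and>
     nat_trans C C id_func (G \<circ>\<^sub>F F) \<eta> \<and> nat_trans D D (F \<circ>\<^sub>F G) id_func \<epsilon> \<and>
     (\<forall>a\<in>Ob C. \<epsilon> (omap F a) \<odot>\<^bsub>D\<^esub> amap F (\<eta> a) = Idn D (omap F a)) \<and>
     (\<forall>d\<in>Ob D. amap G (\<epsilon> d) \<odot>\<^bsub>C\<^esub> \<eta> (omap G d) = Idn C (omap G d))"

definition full_subcat :: "('o, 'm) cat \<Rightarrow> ('o \<Rightarrow> bool) \<Rightarrow> ('o, 'm) cat" where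
  "full_subcat C P = C\<lparr>Ob := {a \<in> Ob C. P a}, Mor := {f \<in> Mor C. P (Src C f) \<and> P (Tgt C f)}\<rparr>"

section \<open>Limits and pullbacks\<close>

definition is_cone ::
    "('o, 'm) cat \<Rightarrow> ('p, 'n) cat \<Rightarrow> ('o, 'm, 'p, 'n) func \<Rightarrow> 'p \<Rightarrow> ('o \<Rightarrow> 'n) \<Rightarrow> bool" where
  "is_cone J D F X \<kappa> \<longleftrightarrow> is_functor J D F \<and> X \<in> Ob D \<and>
     (\<forall>j\<in>Ob J. \<kappa> j \<in> hom D X (omap F j)) \<and>
     (\<forall>u\<in>Mor J. amap F u \<odot>\<^bsub>D\<^esub> \<kappa> (Src J u) = \<kappa> (Tgt J u))"

definition is_limit ::
    "('o, 'm) cat \<Rightarrow> ('p, 'n) cat \<Rightarrow> ('o, 'm, 'p, 'n) func \<Rightarrow> 'p \<Rightarrow> ('o \<Rightarrow> 'n) \<Rightarrow> bool" where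
  "is_limit J D F L \<pi> \<longleftrightarrow> is_cone J D F L \<pi> \<and>
     (\<forall>X \<kappa>. is_cone J D F X \<kappa> \<longrightarrow> (\<exists>!f. f \<in> hom D X L \<and> (\<forall>j\<in>Ob J. \<pi> j \<odot>\<^bsub>D\<^esub> f = \<kappa> j)))"

text \<open>f' is the pullback of f along p, and p' the other projection: f \<odot> p' = p \<odot> f'.\<close>

definition is_pullback :: "('o, 'm) cat \<Rightarrow> 'm \<Rightarrow> 'm \<Rightarrow> 'm \<Rightarrow> 'm \<Rightarrow> bool" where
  "is_pullback C f p f' p' \<longleftrightarrow>
     f \<in> Mor C \<and> p \<in> Mor C \<and> Tgt C f = Tgt C p \<and>
     f' \<in> hom C (Src C f') (Src C p) \<and> p' \<in> hom C (Src C f') (Src C f) \<and>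
     f \<odot>\<^bsub>C\<^esub> p' = p \<odot>\<^bsub>C\<^esub> f' \<and>
     (\<forall>X. \<forall>x \<in> hom C X (Src C f). \<forall>y \<in> hom C X (Src C p). f \<odot>\<^bsub>C\<^esub> x = p \<odot>\<^bsub>C\<^esub> y \<longrightarrow>
        (\<exists>!w. w \<in> hom C X (Src C f') \<and> p' \<odot>\<^bsub>C\<^esub> w = x \<and> f' \<odot>\<^bsub>C\<^esub> w = y))"

definition has_pullbacks :: "('o, 'm) cat \<Rightarrow> bool" where
  "has_pullbacks C \<longleftrightarrow>
     (\<forall>f\<in>Mor C. \<forall>p\<in>Mor C. Tgt C f = Tgt C p \<longrightarrow> (\<exists>f' p'. is_pullback C f p f' p'))"

section \<open>Monadic functors and effective descent morphisms\<close>

text \<open>Eilenberg-Moore category of the monad (T, \<eta>, \<mu>) on C.\<close>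

definition EM ::
    "('o, 'm) cat \<Rightarrow> ('o, 'm, 'o, 'm) func \<Rightarrow> ('o \<Rightarrow> 'm) \<Rightarrow> ('o \<Rightarrow> 'm)
       \<Rightarrow> ('o \<times> 'm, ('o \<times> 'm) \<times> ('o \<times> 'm) \<times> 'm) cat" where
  "EM C T \<eta> \<mu> = triple_cat
     {(x, a). x \<in> Ob C \<and> a \<in> hom C (omap T x) x \<and>
        a \<odot>\<^bsub>C\<^esub> \<eta> x = Idn C x \<and> a \<odot>\<^bsub>C\<^esub> \<mu> x = a \<odot>\<^bsub>C\<^esub> amap T a}
     (\<lambda>(x, a) (y, b). {f \<in> hom C x y. f \<odot>\<^bsub>C\<^esub> a = b \<odot>\<^bsub>C\<^esub> amap T f})
     (\<lambda>(x, a). Idn C x)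
     (\<lambda>_ g f. g \<odot>\<^bsub>C\<^esub> f)"

definition EM_comparison ::
    "('p, 'n) cat \<Rightarrow> ('p, 'n, 'o, 'm) func \<Rightarrow> ('p \<Rightarrow> 'n)
       \<Rightarrow> ('p, 'n, 'o \<times> 'm, ('o \<times> 'm) \<times> ('o \<times> 'm) \<times> 'm) func" where
  "EM_comparison D G \<epsilon> =
     \<lparr>omap = (\<lambda>d. (omap G d, amap G (\<epsilon> d))),
      amap = (\<lambda>k. ((omap G (Src D k), amap G (\<epsilon> (Src D k))),
                   (omap G (Tgt D k), amap G (\<epsilon> (Tgt D k))),
                   amap G k))\<rparr>"

definition monadic :: "('p, 'n) cat \<Rightarrow> ('o, 'm) cat \<Rightarrow> ('p, 'n, 'o, 'm) func \<Rightarrow> bool" where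
  "monadic D C G \<longleftrightarrow>
     (\<exists>F \<eta> \<epsilon>. adjunction C D F G \<eta> \<epsilon> \<and>
        equivalence_functor D (EM C (G \<circ>\<^sub>F F) \<eta> (\<lambda>x. amap G (\<epsilon> (omap F x)))) (EM_comparison D G \<epsilon>))"

definition slice :: "('o, 'm) cat \<Rightarrow> 'o \<Rightarrow> ('m, 'm \<times> 'm \<times> 'm) cat" where
  "slice C b = triple_cat
     {f \<in> Mor C. Tgt C f = b}
     (\<lambda>f g. {u \<in> hom C (Src C f) (Src C g). g \<odot>\<^bsub>C\<^esub> u = f})
     (\<lambda>f. Idn C (Src C f))
     (\<lambda>_ v u. v \<odot>\<^bsub>C\<^esub> u)"

text \<open>
  G is the functor of pulling back along p, for some choice \<pi> of pullback squares. Any two such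
  functors are isomorphic, so the existential quantifier in effective_descent is harmless.
\<close>

definition is_pullback_functor ::
    "('o, 'm) cat \<Rightarrow> 'm \<Rightarrow> ('m, 'm \<times> 'm \<times> 'm, 'm, 'm \<times> 'm \<times> 'm) func \<Rightarrow> bool" where
  "is_pullback_functor C p G \<longleftrightarrow>
     is_functor (slice C (Tgt C p)) (slice C (Src C p)) G \<and>
     (\<exists>\<pi>. (\<forall>f\<in>Ob (slice C (Tgt C p)). is_pullback C f p (omap G f) (\<pi> f)) \<and>
          (\<forall>(f, g, u)\<in>Mor (slice C (Tgt C p)). \<pi> g \<odot>\<^bsub>C\<^esub> datum (amap G (f, g, u)) = u \<odot>\<^bsub>C\<^esub> \<pi> f))"

definition effective_descent :: "('o, 'm) cat \<Rightarrow> 'm \<Rightarrow> bool" where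
  "effective_descent C p \<longleftrightarrow> p \<in> Mor C \<and>
     (\<exists>G. is_pullback_functor C p G \<and> monadic (slice C (Tgt C p)) (slice C (Src C p)) G)"

section \<open>Reflections and factorization systems\<close>

definition full_reflection ::
    "('o, 'm) cat \<Rightarrow> ('o \<Rightarrow> bool) \<Rightarrow> ('o, 'm, 'o, 'm) func \<Rightarrow> ('o \<Rightarrow> 'm) \<Rightarrow> ('o \<Rightarrow> 'm) \<Rightarrow> bool" where
  "full_reflection C P I \<eta> \<delta> \<longleftrightarrow> category C \<and> has_pullbacks C \<and>
     adjunction C (full_subcat C P) I id_func \<eta> \<delta>"

definition orthogonal :: "('o, 'm) cat \<Rightarrow> 'm \<Rightarrow> 'm \<Rightarrow> bool" where
  "orthogonal C e m \<longleftrightarrow>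
     (\<forall>u \<in> hom C (Src C e) (Src C m). \<forall>v \<in> hom C (Tgt C e) (Tgt C m).
        v \<odot>\<^bsub>C\<^esub> e = m \<odot>\<^bsub>C\<^esub> u \<longrightarrow>
        (\<exists>!w. w \<in> hom C (Tgt C e) (Src C m) \<and> w \<odot>\<^bsub>C\<^esub> e = u \<and> m \<odot>\<^bsub>C\<^esub> w = v))"

definition factorization_system :: "('o, 'm) cat \<Rightarrow> 'm set \<Rightarrow> 'm set \<Rightarrow> bool" where
  "factorization_system C \<E> \<M> \<longleftrightarrow>
     \<E> = {e \<in> Mor C. \<forall>m\<in>\<M>. orthogonal C e m} \<and>
     \<M> = {m \<in> Mor C. \<forall>e\<in>\<E>. orthogonal C e m} \<and>
     (\<forall>f\<in>Mor C. \<exists>e\<in>\<E>. \<exists>m\<in>\<M>. Tgt C e = Src C m \<and> f = m \<odot>\<^bsub>C\<^esub> e)"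

context
  fixes C :: "('o, 'm) cat" and P :: "'o \<Rightarrow> bool" and I :: "('o, 'm, 'o, 'm) func"
begin

definition E_cls :: "'m set" where
  "E_cls = {f \<in> Mor C. is_iso (full_subcat C P) (amap I f)}"

definition M_cls :: "'m set" where
  "M_cls = {m \<in> Mor C. \<forall>e\<in>E_cls. orthogonal C e m}"

definition E'_cls :: "'m set" where
  "E'_cls = {f \<in> Mor C. \<forall>p f' p'. is_pullback C f p f' p' \<longrightarrow> f' \<in> E_cls}"

definition Mstar_cls :: "'m set" where
  "Mstar_cls = {f \<in> Mor C. \<exists>p f' p'. effective_descent C p \<and> is_pullback C f p f' p' \<and> f' \<in> M_cls}"

definition stable_units :: "('o \<Rightarrow> 'm) \<Rightarrow> bool" where
  "stable_units \<eta> \<longleftrightarrow> (\<forall>a\<in>Ob C. \<eta> a \<in> E'_cls)"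

definition monotone_light :: bool where
  "monotone_light \<longleftrightarrow> factorization_system C E'_cls Mstar_cls"

end

section \<open>Smallness and the category of sets\<close>

text \<open>
  The type 'u plays the role of a universe: its cardinality is assumed to be infinite, regular and
  strong limit, and a set (over any type) is small if it is of smaller cardinality. Up to
  equivalence, the category of sets is then that of the small subsets of 'u. Uncountability is not
  needed; a countable 'u gives the category of finite sets.
\<close>

definition small :: "'u itself \<Rightarrow> 'x set \<Rightarrow> bool" where
  "small _ X \<longleftrightarrow> X \<prec> (UNIV :: 'u set)"

definition universe :: "'u itself \<Rightarrow> bool" where
  "universe U \<longleftrightarrow> infinite (UNIV :: 'u set) \<and>
     (\<forall>X :: 'u set. small U X \<longrightarrow> small U (Pow X)) \<and>
     (\<forall>(J :: 'u set) (X :: 'u \<Rightarrow> 'u set).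
        small U J \<longrightarrow> (\<forall>j\<in>J. small U (X j)) \<longrightarrow> small U (\<Union>j\<in>J. X j))"

definition small_category :: "'u itself \<Rightarrow> ('o, 'm) cat \<Rightarrow> bool" where
  "small_category U C \<longleftrightarrow> category C \<and> small U (Ob C) \<and> small U (Mor C)"

definition small_homs :: "'u itself \<Rightarrow> ('o, 'm) cat \<Rightarrow> bool" where
  "small_homs U C \<longleftrightarrow> category C \<and> (\<forall>a\<in>Ob C. \<forall>b\<in>Ob C. small U (hom C a b))"

text \<open>
  For a locally small C: C is equivalent to a small category. Over such a C every set-valued functor
  is a quotient of a small coproduct of representables; this fails for large C.
\<close>

definition essentially_small :: "'u itself \<Rightarrow> ('o, 'm) cat \<Rightarrow> bool" where
  "essentially_small U C \<longleftrightarrow>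
     (\<exists>G \<subseteq> Ob C. small U G \<and> (\<forall>a\<in>Ob C. \<exists>g\<in>G. \<exists>f\<in>hom C a g. is_iso C f))"

type_synonym 'u smap = "'u set \<times> 'u set \<times> ('u \<Rightarrow> 'u)"

definition SetCat :: "('u set, 'u smap) cat" where
  "SetCat = triple_cat
     {X. small TYPE('u) X}
     (\<lambda>X Y. X \<rightarrow>\<^sub>E Y)
     (\<lambda>X. \<lambda>x\<in>X. x)
     (\<lambda>X g f. compose X g f)"

section \<open>Functor categories and right Kan extensions\<close>

text \<open>
  Functors and families that are objects or morphisms of a functor category are extensional, so
  that equality in HOL is equality of functors and of natural transformations.
\<close>

type_synonym ('o, 'm, 'p, 'n) ntrans =
  "('o, 'm, 'p, 'n) func \<times> ('o, 'm, 'p, 'n) func \<times> ('o \<Rightarrow> 'n)"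

definition Fun :: "('o, 'm) cat \<Rightarrow> ('p, 'n) cat \<Rightarrow> (('o, 'm, 'p, 'n) func, ('o, 'm, 'p, 'n) ntrans) cat" where
  "Fun C D = triple_cat
     {F. is_functor C D F \<and> omap F \<in> extensional (Ob C) \<and> amap F \<in> extensional (Mor C)}
     (\<lambda>F G. {\<tau>. nat_trans C D F G \<tau> \<and> \<tau> \<in> extensional (Ob C)})
     (\<lambda>F. \<lambda>a\<in>Ob C. Idn D (omap F a))
     (\<lambda>_ \<sigma> \<tau>. \<lambda>a\<in>Ob C. \<sigma> a \<odot>\<^bsub>D\<^esub> \<tau> a)"

definition precomp_ob ::
    "('b, 'g) cat \<Rightarrow> ('b, 'g, 'a, 'f) func \<Rightarrow> ('a, 'f, 'p, 'n) func \<Rightarrow> ('b, 'g, 'p, 'n) func" where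
  "precomp_ob B K S = \<lparr>omap = restrict (omap (S \<circ>\<^sub>F K)) (Ob B), amap = restrict (amap (S \<circ>\<^sub>F K)) (Mor B)\<rparr>"

definition precomp ::
    "('b, 'g) cat \<Rightarrow> ('b, 'g, 'a, 'f) func
       \<Rightarrow> (('a, 'f, 'p, 'n) func, ('a, 'f, 'p, 'n) ntrans, ('b, 'g, 'p, 'n) func, ('b, 'g, 'p, 'n) ntrans) func" where
  "precomp B K =
     \<lparr>omap = precomp_ob B K,
      amap = (\<lambda>(S, T, \<tau>). (precomp_ob B K S, precomp_ob B K T, \<lambda>b\<in>Ob B. \<tau> (omap K b)))\<rparr>"

text \<open>The comma category (a \<down> K), with objects (b, h : a \<rightarrow> K b), and its projection to B.\<close>

definition comma ::
    "('b, 'g) cat \<Rightarrow> ('a, 'f) cat \<Rightarrow> 'a \<Rightarrow> ('b, 'g, 'a, 'f) func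
       \<Rightarrow> ('b \<times> 'f, ('b \<times> 'f) \<times> ('b \<times> 'f) \<times> 'g) cat" where
  "comma B A a K = triple_cat
     {(b, h). b \<in> Ob B \<and> h \<in> hom A a (omap K b)}
     (\<lambda>(b, h) (b', h'). {g \<in> hom B b b'. amap K g \<odot>\<^bsub>A\<^esub> h = h'})
     (\<lambda>(b, h). Idn B b)
     (\<lambda>_ g' g. g' \<odot>\<^bsub>B\<^esub> g)"

definition comma_proj :: "('b \<times> 'f, ('b \<times> 'f) \<times> ('b \<times> 'f) \<times> 'g, 'b, 'g) func" where
  "comma_proj = \<lparr>omap = fst, amap = datum\<rparr>"

text \<open>
  Precomposition with K is left adjoint to R, and R T a is the limit of T over (a \<down> K), the
  component of the limiting cone at h : a \<rightarrow> K b being R T h followed by the counit at T and b.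
\<close>

definition pointwise_ran_adjunction where
  "pointwise_ran_adjunction A B D K R \<theta> \<epsilon> \<longleftrightarrow>
     adjunction (Fun A D) (Fun B D) (precomp B K) R \<theta> \<epsilon> \<and>
     (\<forall>T\<in>Ob (Fun B D). \<forall>a\<in>Ob A.
        is_limit (comma B A a K) D (T \<circ>\<^sub>F comma_proj) (omap (omap R T) a)
          (\<lambda>(b, h). datum (\<epsilon> T) b \<odot>\<^bsub>D\<^esub> amap (omap R T) h))"

section \<open>The category Mono(Set^K) and the factorization of the unit\<close>

definition cw_inj :: "('a, 'f) cat \<Rightarrow> ('a, 'f, 'u set, 'u smap) ntrans \<Rightarrow> bool" where
  "cw_inj A \<tau> \<longleftrightarrow> (\<forall>a\<in>Ob A. inj_on (datum (datum \<tau> a)) (Src SetCat (datum \<tau> a)))"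

definition cw_surj :: "('a, 'f) cat \<Rightarrow> ('a, 'f, 'u set, 'u smap) ntrans \<Rightarrow> bool" where
  "cw_surj A \<tau> \<longleftrightarrow>
     (\<forall>a\<in>Ob A. datum (datum \<tau> a) ` Src SetCat (datum \<tau> a) = Tgt SetCat (datum \<tau> a))"

text \<open>The defining property of the objects S of the full subcategory Mono(Set^K).\<close>

definition in_Mono where
  "in_Mono A \<theta> S \<longleftrightarrow> cw_inj A (\<theta> S)"

definition unit_factorization where
  "unit_factorization A \<theta> \<eta> \<mu> \<longleftrightarrow>
     (\<forall>S\<in>Ob (Fun A SetCat).
        \<eta> S \<in> Mor (Fun A SetCat) \<and> \<mu> S \<in> Mor (Fun A SetCat) \<and>
        Src (Fun A SetCat) (\<eta> S) = S \<and>
        Tgt (Fun A SetCat) (\<eta> S) = Src (Fun A SetCat) (\<mu> S) \<and>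
        \<theta> S = \<mu> S \<odot>\<^bsub>Fun A SetCat\<^esub> \<eta> S \<and>
        cw_surj A (\<eta> S) \<and> cw_inj A (\<mu> S))"

definition cogenerating :: "('o, 'm) cat \<Rightarrow> 'o set \<Rightarrow> bool" where
  "cogenerating C G \<longleftrightarrow> G \<subseteq> Ob C \<and>
     (\<forall>f\<in>Mor C. \<forall>g\<in>Mor C. Src C f = Src C g \<longrightarrow> Tgt C f = Tgt C g \<longrightarrow> f \<noteq> g \<longrightarrow>
        (\<exists>N\<in>G. \<exists>h\<in>hom C (Tgt C f) N. h \<odot>\<^bsub>C\<^esub> f \<noteq> h \<odot>\<^bsub>C\<^esub> g))"

text \<open>
  Being cogenerating says nothing about an object a all of whose incoming hom-sets have at most one
  element; in particular it does not provide a morphism from a to some object of G. The existence of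
  such morphisms into G = K(ob B) is indispensable for the monotone-light factorization: for B empty
  and A terminal the reflection is that of sets into {0, 1}, E' consists of the surjections, M^* of
  the isomorphisms and the maps with empty domain, and 1 \<rightarrow> 2 does not factorize.
\<close>

definition all_map_into :: "('o, 'm) cat \<Rightarrow> 'o set \<Rightarrow> bool" where
  "all_map_into C G \<longleftrightarrow> (\<forall>a\<in>Ob C. \<exists>N\<in>G. hom C a N \<noteq> {})"

end

theory Submission
  imports Defs
begin

text \<open>
  Call two elements \<open>x, y\<close> of \<open>S a\<close> indistinguishable if \<open>S h x = S h y\<close> for all \<open>h : a \<rightarrow> K b\<close>. The
  projection of \<open>\<theta> x\<close> at \<open>h\<close> in the pointwise limit \<open>Ran\<^sub>K (S K) a\<close> is \<open>S h x\<close>, so indistinguishability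
  is the kernel of \<open>\<theta>\<close> (\<open>theta_kernel\<close>). Hence the objects of \<open>Mono(Set\<^sup>K)\<close> are the functors in which
  indistinguishable elements are equal, called separated below, and the reflection divides every
  functor by indistinguishability. On the image of \<open>K\<close> this divides by nothing, since \<open>h\<close> may be an
  identity.

  This describes the class \<open>E\<close> of the reflection: it consists of the \<open>e\<close> that are bijective on the image
  of \<open>K\<close> and surjective up to indistinguishability (\<open>E_cls_iff_dense\<close>). The morphisms that are bijective
  on the image of \<open>K\<close> and surjective, called collapsing, are in \<open>E\<close> and stable under pullback; among
  them are the units, so the units are stable. Conversely let \<open>f : S \<rightarrow> T\<close> be stably in \<open>E\<close>. Pull \<open>f\<close> back
  along the morphism \<open>A(a, -) \<rightarrow> T\<close> of an element \<open>t\<close> of \<open>T a\<close>. The identity of \<open>a\<close> is then, up to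
  indistinguishability, in the image, and in a representable functor indistinguishable elements are
  equal when \<open>K\<close> is cogenerating. So \<open>t\<close> is in the image of \<open>f\<close>, and \<open>E'\<close> consists of the collapsing
  morphisms (\<open>E'_cls_eq_collapsing\<close>).

  Dividing the domain of \<open>f : S \<rightarrow> T\<close> by the congruence that relates indistinguishable elements with
  equal image under \<open>f\<close> factorizes \<open>f\<close> into a collapsing morphism and a separating one, where \<open>m\<close> is
  separating if indistinguishable elements with equal image under \<open>m\<close> are equal. The two classes
  are orthogonal, so they form a factorization system. It remains to see that the separating morphisms
  form \<open>M\<^sup>*\<close> (\<open>Mstar_cls_eq_separating\<close>).

  A morphism between separated functors is in \<open>M\<close>. If \<open>f : S \<rightarrow> T\<close> is separating and \<open>p : D \<rightarrow> T\<close> is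
  surjective with \<open>D\<close> separated, then the pullback of \<open>S\<close> along \<open>p\<close> is separated as well. Such a \<open>p\<close>
  exists: cover \<open>T\<close> by a coproduct of representables. This coproduct is small as \<open>A\<close> is essentially
  small, and separated as \<open>K\<close> is cogenerating and every object has a morphism into the image of \<open>K\<close>,
  which tells the summands apart. As surjections are effective descent morphisms, \<open>f\<close> is in \<open>M\<^sup>*\<close>.
  Conversely, morphisms in \<open>M\<close> are separating because they are orthogonal to their own collapsing part;
  effective descent morphisms are surjective; and being separating descends along surjections.

  That surjections are the effective descent morphisms has an elementary proof. An algebra for the
  monad of \<open>p : D \<rightarrow> T\<close> is a morphism \<open>q : X \<rightarrow> D\<close> with a rule that transports \<open>x\<close> to any \<open>e\<close> with
  \<open>p e = p (q x)\<close>; it descends to the quotient of \<open>X\<close> that identifies every element with its transports.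
  In the other direction, a surjection onto a proper subfunctor followed by the inclusion is not of
  effective descent, because the inclusion becomes invertible when it is pulled back.
\<close>

section \<open>Calculating in a category\<close>

lemma homI: "f \<in> Mor C \<Longrightarrow> Src C f = a \<Longrightarrow> Tgt C f = b \<Longrightarrow> f \<in> hom C a b"
  by (simp add: hom_def)

lemma homD:
  assumes "f \<in> hom C a b"
  shows "f \<in> Mor C" "Src C f = a" "Tgt C f = b"
  using assms by (auto simp: hom_def)

lemma hom_Src_Tgt: "f \<in> Mor C \<Longrightarrow> f \<in> hom C (Src C f) (Tgt C f)"
  by (simp add: hom_def)

lemma cat_obj:
  assumes "category C" "f \<in> Mor C"
  shows "Src C f \<in> Ob C" "Tgt C f \<in> Ob C"
  using assms by (auto simp: category_def)

lemma hom_obj: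
  assumes "category C" "f \<in> hom C a b"
  shows "a \<in> Ob C" "b \<in> Ob C"
  using assms cat_obj homD by metis+

lemma cat_id: "category C \<Longrightarrow> a \<in> Ob C \<Longrightarrow> Idn C a \<in> hom C a a"
  by (auto simp: category_def)

lemma cat_comp: "category C \<Longrightarrow> f \<in> hom C a b \<Longrightarrow> g \<in> hom C b c \<Longrightarrow> g \<odot>\<^bsub>C\<^esub> f \<in> hom C a c"
  unfolding category_def using homD by metis

lemma cat_idr: "category C \<Longrightarrow> f \<in> hom C a b \<Longrightarrow> f \<odot>\<^bsub>C\<^esub> Idn C a = f"
  unfolding category_def using homD by metis

lemma cat_idl: "category C \<Longrightarrow> f \<in> hom C a b \<Longrightarrow> Idn C b \<odot>\<^bsub>C\<^esub> f = f"
  unfolding category_def using homD by metis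

lemma cat_assoc:
  "category C \<Longrightarrow> f \<in> hom C a b \<Longrightarrow> g \<in> hom C b c \<Longrightarrow> h \<in> hom C c d \<Longrightarrow>
   (h \<odot>\<^bsub>C\<^esub> g) \<odot>\<^bsub>C\<^esub> f = h \<odot>\<^bsub>C\<^esub> (g \<odot>\<^bsub>C\<^esub> f)"
  unfolding category_def hom_def by auto

lemma cat_comp_Mor:
  assumes "category C" "f \<in> Mor C" "g \<in> Mor C" "Tgt C f = Src C g"
  shows "g \<odot>\<^bsub>C\<^esub> f \<in> Mor C" "Src C (g \<odot>\<^bsub>C\<^esub> f) = Src C f" "Tgt C (g \<odot>\<^bsub>C\<^esub> f) = Tgt C g"
  using assms cat_comp[of C f "Src C f" "Tgt C f" g "Tgt C g"] by (auto simp: hom_def)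

lemma is_iso_hom:
  assumes "f \<in> hom C a b"
  shows "is_iso C f \<longleftrightarrow> (\<exists>g\<in>hom C b a. g \<odot>\<^bsub>C\<^esub> f = Idn C a \<and> f \<odot>\<^bsub>C\<^esub> g = Idn C b)"
  using homD[OF assms] by (simp add: is_iso_def)

lemma iso_comp:
  assumes C: "category C" and f: "f \<in> hom C a b" "is_iso C f" and g: "g \<in> hom C b c" "is_iso C g"
  shows "is_iso C (g \<odot>\<^bsub>C\<^esub> f)"
proof -
  obtain f' where f': "f' \<in> hom C b a" "f' \<odot>\<^bsub>C\<^esub> f = Idn C a" "f \<odot>\<^bsub>C\<^esub> f' = Idn C b"
    using f is_iso_hom by metis
  obtain g' where g': "g' \<in> hom C c b" "g' \<odot>\<^bsub>C\<^esub> g = Idn C b" "g \<odot>\<^bsub>C\<^esub> g' = Idn C c"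
    using g is_iso_hom by metis
  have "(f' \<odot>\<^bsub>C\<^esub> g') \<odot>\<^bsub>C\<^esub> (g \<odot>\<^bsub>C\<^esub> f) = f' \<odot>\<^bsub>C\<^esub> ((g' \<odot>\<^bsub>C\<^esub> g) \<odot>\<^bsub>C\<^esub> f)"
    using cat_assoc[OF C cat_comp[OF C f(1) g(1)] g'(1) f'(1)] cat_assoc[OF C f(1) g(1) g'(1)] by simp
  moreover have "(g \<odot>\<^bsub>C\<^esub> f) \<odot>\<^bsub>C\<^esub> (f' \<odot>\<^bsub>C\<^esub> g') = g \<odot>\<^bsub>C\<^esub> ((f \<odot>\<^bsub>C\<^esub> f') \<odot>\<^bsub>C\<^esub> g')"
    using cat_assoc[OF C cat_comp[OF C g'(1) f'(1)] f(1) g(1)] cat_assoc[OF C g'(1) f'(1) f(1)] by simp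
  ultimately show ?thesis
    using C f(1) g(1) f' g' by (subst is_iso_hom[of _ _ a c]) (auto simp: cat_idl[OF C] cat_comp[OF C]
      intro!: bexI[of _ "f' \<odot>\<^bsub>C\<^esub> g'"])
qed

lemma functor_cat:
  assumes "is_functor C D F"
  shows "category C" "category D"
  using assms by (auto simp: is_functor_def)

lemma functor_obj: "is_functor C D F \<Longrightarrow> a \<in> Ob C \<Longrightarrow> omap F a \<in> Ob D"
  by (auto simp: is_functor_def)

lemma functor_hom: "is_functor C D F \<Longrightarrow> f \<in> hom C a b \<Longrightarrow> amap F f \<in> hom D (omap F a) (omap F b)"
  unfolding is_functor_def using homD by metis

lemma functor_id: "is_functor C D F \<Longrightarrow> a \<in> Ob C \<Longrightarrow> amap F (Idn C a) = Idn D (omap F a)"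
  by (auto simp: is_functor_def)

lemma functor_comp:
  "is_functor C D F \<Longrightarrow> f \<in> hom C a b \<Longrightarrow> g \<in> hom C b c \<Longrightarrow>
   amap F (g \<odot>\<^bsub>C\<^esub> f) = amap F g \<odot>\<^bsub>D\<^esub> amap F f"
  unfolding is_functor_def using homD by metis

lemma is_functorI:
  assumes "category C" "category D"
    "\<And>a. a \<in> Ob C \<Longrightarrow> omap F a \<in> Ob D"
    "\<And>a b f. a \<in> Ob C \<Longrightarrow> b \<in> Ob C \<Longrightarrow> f \<in> hom C a b \<Longrightarrow> amap F f \<in> hom D (omap F a) (omap F b)"
    "\<And>a. a \<in> Ob C \<Longrightarrow> amap F (Idn C a) = Idn D (omap F a)"
    "\<And>a b c f g. f \<in> hom C a b \<Longrightarrow> g \<in> hom C b c \<Longrightarrow> amap F (g \<odot>\<^bsub>C\<^esub> f) = amap F g \<odot>\<^bsub>D\<^esub> amap F f"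
  shows "is_functor C D F"
  unfolding is_functor_def
proof (intro conjI ballI impI)
  fix f assume f: "f \<in> Mor C"
  show "amap F f \<in> hom D (omap F (Src C f)) (omap F (Tgt C f))"
    using assms(4)[OF cat_obj[OF assms(1) f] hom_Src_Tgt[OF f]] .
  fix g assume g: "g \<in> Mor C" "Tgt C f = Src C g"
  show "amap F (g \<odot>\<^bsub>C\<^esub> f) = amap F g \<odot>\<^bsub>D\<^esub> amap F f"
    using assms(6)[OF hom_Src_Tgt[OF f]] hom_Src_Tgt[OF g(1)] g(2) by simp
qed (use assms in auto)

lemma functor_iso:
  assumes F: "is_functor C D F" and f: "f \<in> hom C a b" "is_iso C f"
  shows "is_iso D (amap F f)"
proof -
  obtain g where g: "g \<in> hom C b a" "g \<odot>\<^bsub>C\<^esub> f = Idn C a" "f \<odot>\<^bsub>C\<^esub> g = Idn C b"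
    using f is_iso_hom by metis
  have "amap F g \<odot>\<^bsub>D\<^esub> amap F f = Idn D (omap F a)" "amap F f \<odot>\<^bsub>D\<^esub> amap F g = Idn D (omap F b)"
    using functor_comp[OF F f(1) g(1)] functor_comp[OF F g(1) f(1)] g functor_id[OF F]
      hom_obj[OF functor_cat(1)[OF F] f(1)] by auto
  then show ?thesis
    using is_iso_hom[OF functor_hom[OF F f(1)]] functor_hom[OF F g(1)] by blast
qed

lemma id_functor: "category C \<Longrightarrow> is_functor C C id_func"
  by (rule is_functorI) (auto simp: id_func_def)

lemma omap_comp_func [simp]: "omap (G \<circ>\<^sub>F F) a = omap G (omap F a)"
  by (simp add: comp_func_def)

lemma amap_comp_func [simp]: "amap (G \<circ>\<^sub>F F) f = amap G (amap F f)"
  by (simp add: comp_func_def)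

lemma omap_id_func [simp]: "omap id_func a = a"
  by (simp add: id_func_def)

lemma amap_id_func [simp]: "amap id_func f = f"
  by (simp add: id_func_def)

lemma comp_functor:
  assumes F: "is_functor C D F" and G: "is_functor D X G"
  shows "is_functor C X (G \<circ>\<^sub>F F)"
proof (rule is_functorI[OF functor_cat(1)[OF F] functor_cat(2)[OF G]])
  fix a b c f g assume f: "f \<in> hom C a b" and g: "g \<in> hom C b c"
  show "amap (G \<circ>\<^sub>F F) (g \<odot>\<^bsub>C\<^esub> f) = amap (G \<circ>\<^sub>F F) g \<odot>\<^bsub>X\<^esub> amap (G \<circ>\<^sub>F F) f"
    using functor_comp[OF F f g] functor_comp[OF G functor_hom[OF F f] functor_hom[OF F g]] by simp
next
  fix a b f assume f: "f \<in> hom C a b"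
  show "amap (G \<circ>\<^sub>F F) f \<in> hom X (omap (G \<circ>\<^sub>F F) a) (omap (G \<circ>\<^sub>F F) b)"
    using functor_hom[OF G functor_hom[OF F f]] by simp
qed (simp_all add: functor_obj[OF F] functor_obj[OF G] functor_id[OF F] functor_id[OF G])

lemma nat_transI:
  assumes "is_functor C D F" "is_functor C D G"
    "\<And>a. a \<in> Ob C \<Longrightarrow> \<tau> a \<in> hom D (omap F a) (omap G a)"
    "\<And>a b f. a \<in> Ob C \<Longrightarrow> b \<in> Ob C \<Longrightarrow> f \<in> hom C a b \<Longrightarrow> amap G f \<odot>\<^bsub>D\<^esub> \<tau> a = \<tau> b \<odot>\<^bsub>D\<^esub> amap F f"
  shows "nat_trans C D F G \<tau>"
  unfolding nat_trans_def
proof (intro conjI ballI)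
  fix f assume f: "f \<in> Mor C"
  show "amap G f \<odot>\<^bsub>D\<^esub> \<tau> (Src C f) = \<tau> (Tgt C f) \<odot>\<^bsub>D\<^esub> amap F f"
    using assms(4)[OF cat_obj[OF functor_cat(1)[OF assms(1)] f] hom_Src_Tgt[OF f]] .
qed (use assms in auto)

lemma nat_trans_hom: "nat_trans C D F G \<tau> \<Longrightarrow> a \<in> Ob C \<Longrightarrow> \<tau> a \<in> hom D (omap F a) (omap G a)"
  by (auto simp: nat_trans_def)

lemma nat_trans_eq:
  "nat_trans C D F G \<tau> \<Longrightarrow> f \<in> hom C a b \<Longrightarrow> amap G f \<odot>\<^bsub>D\<^esub> \<tau> a = \<tau> b \<odot>\<^bsub>D\<^esub> amap F f"
  unfolding nat_trans_def using homD by metis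

text \<open>
  Each of the concrete categories is an instance of the triple construction, so its category axioms
  reduce to those of the data.
\<close>

lemma triple_cat_simps [simp]:
  "Ob (triple_cat O\<^sub>0 H i c) = O\<^sub>0"
  "Src (triple_cat O\<^sub>0 H i c) (x, y, d) = x"
  "Tgt (triple_cat O\<^sub>0 H i c) (x, y, d) = y"
  "Idn (triple_cat O\<^sub>0 H i c) x = (x, x, i x)"
  "(y', z, e) \<odot>\<^bsub>triple_cat O\<^sub>0 H i c\<^esub> (x, y, d) = (x, z, c x e d)"
  by (simp_all add: triple_cat_def)

lemma triple_cat_Mor: "(x, y, d) \<in> Mor (triple_cat O\<^sub>0 H i c) \<longleftrightarrow> x \<in> O\<^sub>0 \<and> y \<in> O\<^sub>0 \<and> d \<in> H x y"
  by (simp add: triple_cat_def)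

lemma triple_cat_hom: "hom (triple_cat O\<^sub>0 H i c) x y = {(x, y, d) |d. x \<in> O\<^sub>0 \<and> y \<in> O\<^sub>0 \<and> d \<in> H x y}"
  by (auto simp: triple_cat_def hom_def)

lemma triple_cat_category:
  assumes "\<And>x. x \<in> O\<^sub>0 \<Longrightarrow> i x \<in> H x x"
    and "\<And>x y z d e. \<lbrakk>x \<in> O\<^sub>0; y \<in> O\<^sub>0; z \<in> O\<^sub>0; d \<in> H x y; e \<in> H y z\<rbrakk> \<Longrightarrow> c x e d \<in> H x z"
    and "\<And>x y d. \<lbrakk>x \<in> O\<^sub>0; y \<in> O\<^sub>0; d \<in> H x y\<rbrakk> \<Longrightarrow> c x d (i x) = d \<and> c x (i y) d = d"
    and "\<And>x y z w d e f. \<lbrakk>x \<in> O\<^sub>0; y \<in> O\<^sub>0; z \<in> O\<^sub>0; w \<in> O\<^sub>0; d \<in> H x y; e \<in> H y z; f \<in> H z w\<rbrakk> \<Longrightarrow>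
       c x f (c x e d) = c x (c y f e) d"
  shows "category (triple_cat O\<^sub>0 H i c)"
  unfolding category_def triple_cat_hom
  by (auto simp: triple_cat_Mor assms)

section \<open>Adjoints from universal arrows\<close>

text \<open>
  An object-wise choice of universal arrows is all that an adjunction needs; naturality and the
  triangle identities follow from uniqueness. The right adjoint is required to have the prescribed
  object map because the two uses, Kan extensions and pullback functors, care which objects it
  takes as values.
\<close>

lemma right_adjoint_of_universal_arrows:
  assumes F: "is_functor C D F" and DC: "category D"
    and r: "\<And>d. d \<in> Ob D \<Longrightarrow> r d \<in> Ob C"
    and e: "\<And>d. d \<in> Ob D \<Longrightarrow> e d \<in> hom D (omap F (r d)) d"
    and uni: "\<And>d c k. d \<in> Ob D \<Longrightarrow> c \<in> Ob C \<Longrightarrow> k \<in> hom D (omap F c) d \<Longrightarrow>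
       \<exists>!u. u \<in> hom C c (r d) \<and> e d \<odot>\<^bsub>D\<^esub> amap F u = k"
  shows "\<exists>G \<eta>. adjunction C D F G \<eta> e \<and> omap G = r"
proof -
  note C = functor_cat(1)[OF F]
  define t where "t d c k = (THE u. u \<in> hom C c (r d) \<and> e d \<odot>\<^bsub>D\<^esub> amap F u = k)" for d c k
  have t: "t d c k \<in> hom C c (r d)" "e d \<odot>\<^bsub>D\<^esub> amap F (t d c k) = k"
    if "d \<in> Ob D" "c \<in> Ob C" "k \<in> hom D (omap F c) d" for d c k
    using theI'[OF uni[OF that]] by (auto simp: t_def)
  have eq: "u = v" if "d \<in> Ob D" "u \<in> hom C c (r d)" "v \<in> hom C c (r d)"
    "e d \<odot>\<^bsub>D\<^esub> amap F u = e d \<odot>\<^bsub>D\<^esub> amap F v" for d c u v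
    using uni[OF that(1) hom_obj(1)[OF C that(2)] cat_comp[OF DC functor_hom[OF F that(2)] e[OF that(1)]]]
      that by metis
  define G where "G = \<lparr>omap = r, amap = (\<lambda>g. t (Tgt D g) (r (Src D g)) (g \<odot>\<^bsub>D\<^esub> e (Src D g)))\<rparr>"
  define \<eta> where "\<eta> c = t (omap F c) c (Idn D (omap F c))" for c
  have G: "amap G g \<in> hom C (r a) (r b)" "e b \<odot>\<^bsub>D\<^esub> amap F (amap G g) = g \<odot>\<^bsub>D\<^esub> e a"
    if "g \<in> hom D a b" for g a b
    using t[of b "r a" "g \<odot>\<^bsub>D\<^esub> e a"] hom_obj[OF DC that] r e cat_comp[OF DC _ that] that
    by (auto simp: G_def homD(2,3)[OF that])
  have \<eta>: "\<eta> c \<in> hom C c (r (omap F c))" "e (omap F c) \<odot>\<^bsub>D\<^esub> amap F (\<eta> c) = Idn D (omap F c)"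
    if "c \<in> Ob C" for c
    using t[OF functor_obj[OF F that] that cat_id[OF DC functor_obj[OF F that]]] by (auto simp: \<eta>_def)
  have Gf: "is_functor D C G"
  proof (rule is_functorI[OF DC C])
    fix a assume a: "a \<in> Ob D"
    show "omap G a \<in> Ob C" using r a by (simp add: G_def)
    have "amap G (Idn D a) = Idn C (r a)"
    proof (rule eq[OF a G(1)[OF cat_id[OF DC a]] cat_id[OF C r[OF a]]])
      show "e a \<odot>\<^bsub>D\<^esub> amap F (amap G (Idn D a)) = e a \<odot>\<^bsub>D\<^esub> amap F (Idn C (r a))"
        using G(2)[OF cat_id[OF DC a]] functor_id[OF F r[OF a]] cat_idl[OF DC e[OF a]] cat_idr[OF DC e[OF
          a]]
        by simp
    qed
    then show "amap G (Idn D a) = Idn C (omap G a)" by (simp add: G_def)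
  next
    fix a b f assume f: "f \<in> hom D a b"
    show "amap G f \<in> hom C (omap G a) (omap G b)" using G(1)[OF f] by (simp add: G_def)
  next
    fix a b c f g assume f: "f \<in> hom D a b" and g: "g \<in> hom D b c"
    note ob = hom_obj[OF DC f] hom_obj[OF DC g]
    show "amap G (g \<odot>\<^bsub>D\<^esub> f) = amap G g \<odot>\<^bsub>C\<^esub> amap G f"
    proof (rule eq[OF ob(4) G(1)[OF cat_comp[OF DC f g]] cat_comp[OF C G(1)[OF f] G(1)[OF g]]])
      have FF: "amap F (amap G f) \<in> hom D (omap F (r a)) (omap F (r b))"
        "amap F (amap G g) \<in> hom D (omap F (r b)) (omap F (r c))"
        using functor_hom[OF F] G(1) f g by auto
      have "e c \<odot>\<^bsub>D\<^esub> amap F (amap G g \<odot>\<^bsub>C\<^esub> amap G f) = (e c \<odot>\<^bsub>D\<^esub> amap F (amap G g)) \<odot>\<^bsub>D\<^esub> amap F (amap G f)"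
        by (simp add: functor_comp[OF F G(1)[OF f] G(1)[OF g]] cat_assoc[OF DC FF e[OF ob(4)]])
      also have "\<dots> = g \<odot>\<^bsub>D\<^esub> (e b \<odot>\<^bsub>D\<^esub> amap F (amap G f))"
        by (simp add: G(2)[OF g] cat_assoc[OF DC FF(1) e[OF ob(2)] g])
      also have "\<dots> = (g \<odot>\<^bsub>D\<^esub> f) \<odot>\<^bsub>D\<^esub> e a"
        by (simp add: G(2)[OF f] cat_assoc[OF DC e[OF ob(1)] f g])
      finally show "e c \<odot>\<^bsub>D\<^esub> amap F (amap G (g \<odot>\<^bsub>D\<^esub> f)) = e c \<odot>\<^bsub>D\<^esub> amap F (amap G g \<odot>\<^bsub>C\<^esub> amap G f)"
        using G(2)[OF cat_comp[OF DC f g]] by simp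
    qed
  qed
  have "nat_trans C C id_func (G \<circ>\<^sub>F F) \<eta>"
  proof (rule nat_transI[OF id_functor[OF C] comp_functor[OF F Gf]])
    fix a b f assume f: "f \<in> hom C a b"
    note ob = hom_obj[OF C f] and Ff = functor_hom[OF F f]
    have GFf: "amap G (amap F f) \<in> hom C (r (omap F a)) (r (omap F b))" using G(1)[OF Ff] .
    have "amap G (amap F f) \<odot>\<^bsub>C\<^esub> \<eta> a = \<eta> b \<odot>\<^bsub>C\<^esub> f"
    proof (rule eq[OF functor_obj[OF F ob(2)] cat_comp[OF C \<eta>(1)[OF ob(1)] GFf] cat_comp[OF C f \<eta>(1)[OF
      ob(2)]]])
      note E = e[OF functor_obj[OF F ob(2)]]
      have "e (omap F b) \<odot>\<^bsub>D\<^esub> amap F (amap G (amap F f) \<odot>\<^bsub>C\<^esub> \<eta> a)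
          = (e (omap F b) \<odot>\<^bsub>D\<^esub> amap F (amap G (amap F f))) \<odot>\<^bsub>D\<^esub> amap F (\<eta> a)"
        by (simp add: functor_comp[OF F \<eta>(1)[OF ob(1)] GFf]
          cat_assoc[OF DC functor_hom[OF F \<eta>(1)[OF ob(1)]] functor_hom[OF F GFf] E])
      also have "\<dots> = amap F f \<odot>\<^bsub>D\<^esub> (e (omap F a) \<odot>\<^bsub>D\<^esub> amap F (\<eta> a))"
        by (simp add: G(2)[OF Ff]
          cat_assoc[OF DC functor_hom[OF F \<eta>(1)[OF ob(1)]] e[OF functor_obj[OF F ob(1)]] Ff])
      also have "\<dots> = (e (omap F b) \<odot>\<^bsub>D\<^esub> amap F (\<eta> b)) \<odot>\<^bsub>D\<^esub> amap F f"
        by (simp add: \<eta>(2) ob cat_idl[OF DC Ff] cat_idr[OF DC Ff])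
      also have "\<dots> = e (omap F b) \<odot>\<^bsub>D\<^esub> amap F (\<eta> b \<odot>\<^bsub>C\<^esub> f)"
        by (simp add: functor_comp[OF F f \<eta>(1)[OF ob(2)]]
          cat_assoc[OF DC Ff functor_hom[OF F \<eta>(1)[OF ob(2)]] E])
      finally show "e (omap F b) \<odot>\<^bsub>D\<^esub> amap F (amap G (amap F f) \<odot>\<^bsub>C\<^esub> \<eta> a)
          = e (omap F b) \<odot>\<^bsub>D\<^esub> amap F (\<eta> b \<odot>\<^bsub>C\<^esub> f)" .
    qed
    then show "amap (G \<circ>\<^sub>F F) f \<odot>\<^bsub>C\<^esub> \<eta> a = \<eta> b \<odot>\<^bsub>C\<^esub> amap id_func f" by simp
  qed (use \<eta>(1) in \<open>auto simp: G_def\<close>)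
  moreover have "nat_trans D D (F \<circ>\<^sub>F G) id_func e"
    by (rule nat_transI[OF comp_functor[OF Gf F] id_functor[OF DC]]) (use e G(2) in \<open>auto simp: G_def\<close>)
  moreover have "amap G (e d) \<odot>\<^bsub>C\<^esub> \<eta> (r d) = Idn C (r d)" if d: "d \<in> Ob D" for d
  proof (rule eq[OF d])
    note E = e[OF d] and N = \<eta>[OF r[OF d]]
    show "amap G (e d) \<odot>\<^bsub>C\<^esub> \<eta> (r d) \<in> hom C (r d) (r d)" using cat_comp[OF C N(1) G(1)[OF E]] .
    show "Idn C (r d) \<in> hom C (r d) (r d)" using cat_id[OF C r[OF d]] .
    have "e d \<odot>\<^bsub>D\<^esub> amap F (amap G (e d) \<odot>\<^bsub>C\<^esub> \<eta> (r d))
        = (e d \<odot>\<^bsub>D\<^esub> amap F (amap G (e d))) \<odot>\<^bsub>D\<^esub> amap F (\<eta> (r d))"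
      by (simp add: functor_comp[OF F N(1) G(1)[OF E]]
        cat_assoc[OF DC functor_hom[OF F N(1)] functor_hom[OF F G(1)[OF E]] E])
    also have "\<dots> = e d \<odot>\<^bsub>D\<^esub> (e (omap F (r d)) \<odot>\<^bsub>D\<^esub> amap F (\<eta> (r d)))"
      by (simp add: G(2)[OF E]
        cat_assoc[OF DC functor_hom[OF F N(1)] e[OF functor_obj[OF F r[OF d]]] E])
    also have "\<dots> = e d \<odot>\<^bsub>D\<^esub> amap F (Idn C (r d))"
      by (simp add: N(2) functor_id[OF F r[OF d]])
    finally show "e d \<odot>\<^bsub>D\<^esub> amap F (amap G (e d) \<odot>\<^bsub>C\<^esub> \<eta> (r d)) = e d \<odot>\<^bsub>D\<^esub> amap F (Idn C (r d))" .
  qed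
  ultimately have "adjunction C D F G \<eta> e"
    unfolding adjunction_def using F Gf \<eta>(2) by (simp add: G_def)
  then show ?thesis by (auto simp: G_def)
qed

text \<open>
  Passing to opposite categories exchanges the two adjoints and the two kinds of universal arrows.
\<close>

definition op_cat :: "('o, 'm) cat \<Rightarrow> ('o, 'm) cat" where
  "op_cat C = \<lparr>Ob = Ob C, Mor = Mor C, Src = Tgt C, Tgt = Src C, Idn = Idn C, Cmp = (\<lambda>g f. f \<odot>\<^bsub>C\<^esub> g)\<rparr>"

lemma op_cat_simps [simp]:
  "Ob (op_cat C) = Ob C" "Mor (op_cat C) = Mor C" "Src (op_cat C) = Tgt C" "Tgt (op_cat C) = Src C"
  "Idn (op_cat C) = Idn C" "g \<odot>\<^bsub>op_cat C\<^esub> f = f \<odot>\<^bsub>C\<^esub> g" "hom (op_cat C) a b = hom C b a"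
  by (auto simp: op_cat_def hom_def)

lemma op_op_cat: "op_cat (op_cat C) = (C :: ('o, 'm) cat)"
  by (simp add: op_cat_def)

lemma op_category: "category C \<Longrightarrow> category (op_cat C)"
  by (simp add: category_def)

lemma op_functor:
  assumes F: "is_functor C D F"
  shows "is_functor (op_cat C) (op_cat D) F"
proof (rule is_functorI)
  show "category (op_cat C)" "category (op_cat D)" using functor_cat[OF F] op_category by auto
next
  fix a b c f g assume f: "f \<in> hom (op_cat C) a b" and g: "g \<in> hom (op_cat C) b c"
  then show "amap F (g \<odot>\<^bsub>op_cat C\<^esub> f) = amap F g \<odot>\<^bsub>op_cat D\<^esub> amap F f"
    using functor_comp[OF F, of g c b f a] by simp
qed (use functor_obj[OF F] functor_id[OF F] functor_hom[OF F] in simp_all)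

lemma op_nat_trans:
  assumes \<tau>: "nat_trans C D F G \<tau>"
  shows "nat_trans (op_cat C) (op_cat D) G F \<tau>"
proof (rule nat_transI)
  show "is_functor (op_cat C) (op_cat D) G" "is_functor (op_cat C) (op_cat D) F"
    using \<tau> op_functor by (auto simp: nat_trans_def)
next
  fix a b f assume "f \<in> hom (op_cat C) a b"
  then show "amap F f \<odot>\<^bsub>op_cat D\<^esub> \<tau> a = \<tau> b \<odot>\<^bsub>op_cat D\<^esub> amap G f"
    using nat_trans_eq[OF \<tau>, of f b a] by simp
qed (use nat_trans_hom[OF \<tau>] in simp)

lemma op_adjunction:
  assumes adj: "adjunction C D F G \<eta> \<epsilon>"
  shows "adjunction (op_cat D) (op_cat C) G F \<epsilon> \<eta>"
  using adj op_functor op_nat_trans unfolding adjunction_def by (metis op_cat_simps(1,5,6))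

lemma left_adjoint_of_universal_arrows:
  fixes C :: "('o, 'm) cat" and D :: "('p, 'n) cat"
  assumes G: "is_functor D C G" and C: "category C"
    and r: "\<And>c. c \<in> Ob C \<Longrightarrow> r c \<in> Ob D"
    and n: "\<And>c. c \<in> Ob C \<Longrightarrow> n c \<in> hom C c (omap G (r c))"
    and uni: "\<And>c d k. c \<in> Ob C \<Longrightarrow> d \<in> Ob D \<Longrightarrow> k \<in> hom C c (omap G d) \<Longrightarrow>
       \<exists>!u. u \<in> hom D (r c) d \<and> amap G u \<odot>\<^bsub>C\<^esub> n c = k"
  shows "\<exists>F \<epsilon>. adjunction C D F G n \<epsilon>"
proof -
  have "\<exists>F \<epsilon>. adjunction (op_cat D) (op_cat C) G F \<epsilon> n \<and> omap F = r"
    by (rule right_adjoint_of_universal_arrows[OF op_functor[OF G] op_category[OF C]])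
      (use r n uni in simp_all)
  then obtain F \<epsilon> where "adjunction (op_cat D) (op_cat C) G F \<epsilon> n" by blast
  from op_adjunction[OF this] show ?thesis unfolding op_op_cat by blast
qed

section \<open>Equivalences\<close>

lemma iso_inverse:
  assumes "f \<in> hom C a b" "is_iso C f"
  obtains g where "g \<in> hom C b a" "is_iso C g" "g \<odot>\<^bsub>C\<^esub> f = Idn C a" "f \<odot>\<^bsub>C\<^esub> g = Idn C b"
  using assms is_iso_hom by metis

text \<open>
  The inverse isomorphisms \<open>F a \<cong> d\<close> given by essential surjectivity are universal arrows when \<open>F\<close> is
  fully faithful, so the quasi-inverse is a right adjoint.
\<close>

lemma equivalence_of_fully_faithful:
  assumes F: "is_functor C D F"
    and ff: "\<And>a b k. a \<in> Ob C \<Longrightarrow> b \<in> Ob C \<Longrightarrow> k \<in> hom D (omap F a) (omap F b) \<Longrightarrow>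
       \<exists>!u. u \<in> hom C a b \<and> amap F u = k"
    and es: "\<And>d. d \<in> Ob D \<Longrightarrow> \<exists>a\<in>Ob C. \<exists>i\<in>hom D (omap F a) d. is_iso D i"
  shows "equivalence_functor C D F"
proof -
  note C = functor_cat(1)[OF F] and D = functor_cat(2)[OF F]
  obtain r e where r: "\<And>d. d \<in> Ob D \<Longrightarrow> r d \<in> Ob C"
    and e: "\<And>d. d \<in> Ob D \<Longrightarrow> e d \<in> hom D (omap F (r d)) d" "\<And>d. d \<in> Ob D \<Longrightarrow> is_iso D (e d)"
    using es by metis
  have uni: "\<exists>!u. u \<in> hom C c (r d) \<and> e d \<odot>\<^bsub>D\<^esub> amap F u = k"
    if d: "d \<in> Ob D" and c: "c \<in> Ob C" and k: "k \<in> hom D (omap F c) d" for d c k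
  proof -
    obtain e' where e': "e' \<in> hom D d (omap F (r d))" "e' \<odot>\<^bsub>D\<^esub> e d = Idn D (omap F (r d))"
      "e d \<odot>\<^bsub>D\<^esub> e' = Idn D d"
      using iso_inverse e[OF d] by metis
    have "e d \<odot>\<^bsub>D\<^esub> j = k \<longleftrightarrow> j = e' \<odot>\<^bsub>D\<^esub> k" if j: "j \<in> hom D (omap F c) (omap F (r d))" for j
      using cat_assoc[OF D j e(1)[OF d] e'(1)] cat_assoc[OF D k e'(1) e(1)[OF d]] e'
        cat_idl[OF D j] cat_idl[OF D k] by auto
    then show ?thesis
      using ff[OF c r[OF d] cat_comp[OF D k e'(1)]] functor_hom[OF F] by (metis (no_types, lifting))
  qed
  obtain G \<eta> where adj: "adjunction C D F G \<eta> e" and G: "omap G = r"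
    using right_adjoint_of_universal_arrows[of C D F r e] F D r e(1) uni by blast
  have Gf: "is_functor D C G" and \<eta>: "nat_trans C C id_func (G \<circ>\<^sub>F F) \<eta>"
    and en: "nat_trans D D (F \<circ>\<^sub>F G) id_func e"
    and tri: "\<And>a. a \<in> Ob C \<Longrightarrow> e (omap F a) \<odot>\<^bsub>D\<^esub> amap F (\<eta> a) = Idn D (omap F a)"
    using adj by (auto simp: adjunction_def)
  have "is_iso C (\<eta> a)" if a: "a \<in> Ob C" for a
  proof -
    let ?b = "r (omap F a)"
    have Fa: "omap F a \<in> Ob D" and b: "?b \<in> Ob C" using functor_obj[OF F a] r by auto
    have n: "\<eta> a \<in> hom C a ?b" using nat_trans_hom[OF \<eta> a] by (simp add: G)
    have Fn: "amap F (\<eta> a) \<in> hom D (omap F a) (omap F ?b)" using functor_hom[OF F n] .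
    obtain v where v: "v \<in> hom C ?b a" "amap F v = e (omap F a)"
      using ff[OF b a e(1)[OF Fa]] by auto
    obtain e' where e': "e' \<in> hom D (omap F a) (omap F ?b)" "e' \<odot>\<^bsub>D\<^esub> e (omap F a) = Idn D (omap F ?b)"
      using iso_inverse[OF e[OF Fa]] by metis
    have "e' = amap F (\<eta> a)"
      using cat_assoc[OF D Fn e(1)[OF Fa] e'(1)] tri[OF a] e'(2) cat_idl[OF D Fn] cat_idr[OF D e'(1)]
        by simp
    then have 1: "amap F (\<eta> a \<odot>\<^bsub>C\<^esub> v) = amap F (Idn C ?b)"
      using functor_comp[OF F v(1) n] v(2) e'(2) functor_id[OF F b] by simp
    have 2: "amap F (v \<odot>\<^bsub>C\<^esub> \<eta> a) = amap F (Idn C a)"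
      using functor_comp[OF F n v(1)] v(2) tri[OF a] functor_id[OF F a] by simp
    have inj: "u = w" if "u \<in> hom C c d" "w \<in> hom C c d" "amap F u = amap F w" for c d u w
      using ff[of c d "amap F u"] hom_obj[OF C that(1)] functor_hom[OF F that(1)] that by metis
    show ?thesis
      using is_iso_hom[OF n] v(1) inj[OF cat_comp[OF C v(1) n] cat_id[OF C b] 1]
        inj[OF cat_comp[OF C n v(1)] cat_id[OF C a] 2] by auto
  qed
  then have "nat_iso C C id_func (G \<circ>\<^sub>F F) \<eta>" "nat_iso D D (F \<circ>\<^sub>F G) id_func e"
    using \<eta> en e(2) by (auto simp: nat_iso_def)
  then show ?thesis using F Gf by (auto simp: equivalence_functor_def)
qed

lemma equivalence_reflects_iso:
  assumes eq: "equivalence_functor C D F" and u: "u \<in> hom C a b" and iso: "is_iso D (amap F u)"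
  shows "is_iso C u"
proof -
  obtain G \<alpha> where F: "is_functor C D F" and G: "is_functor D C G"
    and \<alpha>: "nat_trans C C id_func (G \<circ>\<^sub>F F) \<alpha>" "\<And>a. a \<in> Ob C \<Longrightarrow> is_iso C (\<alpha> a)"
    using eq by (auto simp: equivalence_functor_def nat_iso_def)
  note C = functor_cat(1)[OF F] and ob = hom_obj[OF functor_cat(1)[OF F] u]
  have h: "\<alpha> a \<in> hom C a (omap (G \<circ>\<^sub>F F) a)" "\<alpha> b \<in> hom C b (omap (G \<circ>\<^sub>F F) b)"
    using nat_trans_hom[OF \<alpha>(1)] ob by auto
  have v: "amap (G \<circ>\<^sub>F F) u \<in> hom C (omap (G \<circ>\<^sub>F F) a) (omap (G \<circ>\<^sub>F F) b)"
    using functor_hom[OF comp_functor[OF F G] u] .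
  have isov: "is_iso C (amap (G \<circ>\<^sub>F F) u)" using functor_iso[OF G functor_hom[OF F u] iso] by simp
  obtain \<beta> where \<beta>: "\<beta> \<in> hom C (omap (G \<circ>\<^sub>F F) b) b" "is_iso C \<beta>" "\<beta> \<odot>\<^bsub>C\<^esub> \<alpha> b = Idn C b"
    using iso_inverse[OF h(2) \<alpha>(2)[OF ob(2)]] by metis
  have "u = \<beta> \<odot>\<^bsub>C\<^esub> (amap (G \<circ>\<^sub>F F) u \<odot>\<^bsub>C\<^esub> \<alpha> a)"
    using nat_trans_eq[OF \<alpha>(1) u] cat_assoc[OF C u h(2) \<beta>(1)] \<beta>(3) cat_idl[OF C u] by simp
  then show ?thesis
    using iso_comp[OF C cat_comp[OF C h(1) v] iso_comp[OF C h(1) \<alpha>(2)[OF ob(1)] v isov] \<beta>(1,2)] by simp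
qed

section \<open>Full subcategories\<close>

lemma full_subcat_simps [simp]:
  "Ob (full_subcat C P) = {a \<in> Ob C. P a}"
  "Mor (full_subcat C P) = {f \<in> Mor C. P (Src C f) \<and> P (Tgt C f)}"
  "Src (full_subcat C P) = Src C" "Tgt (full_subcat C P) = Tgt C"
  "Idn (full_subcat C P) = Idn C" "Cmp (full_subcat C P) = Cmp C"
  by (simp_all add: full_subcat_def)

lemma full_subcat_hom: "hom (full_subcat C P) a b = {f \<in> hom C a b. P a \<and> P b}"
  by (auto simp: hom_def)

lemma full_subcat_category: "category C \<Longrightarrow> category (full_subcat C P)"
  unfolding category_def full_subcat_hom by (auto simp: hom_def)

lemma full_subcat_inclusion: "category C \<Longrightarrow> is_functor (full_subcat C P) C id_func"
  by (rule is_functorI) (auto simp: full_subcat_category full_subcat_hom)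

lemma full_subcat_iso:
  assumes "f \<in> hom (full_subcat C P) a b"
  shows "is_iso (full_subcat C P) f \<longleftrightarrow> is_iso C f"
  using assms by (auto simp: is_iso_def full_subcat_hom hom_def)

section \<open>Orthogonal factorization systems\<close>

text \<open>
  The lifting of a factorization \<open>e = m e\<^sub>1\<close> against itself shows that \<open>m\<close> is invertible as soon as \<open>e\<close>
  is orthogonal to \<open>m\<close>; so each class is the full orthogonal complement of the other once both are
  closed under isomorphisms.
\<close>

lemma factorization_systemI:
  assumes C: "category C" and EM: "E \<subseteq> Mor C" "M \<subseteq> Mor C"
    and orth: "\<And>e m. e \<in> E \<Longrightarrow> m \<in> M \<Longrightarrow> orthogonal C e m"
    and fact: "\<And>f. f \<in> Mor C \<Longrightarrow> \<exists>e\<in>E. \<exists>m\<in>M. Tgt C e = Src C m \<and> f = m \<odot>\<^bsub>C\<^esub> e"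
    and E_iso: "\<And>e i. e \<in> E \<Longrightarrow> is_iso C i \<Longrightarrow> Tgt C e = Src C i \<Longrightarrow> i \<odot>\<^bsub>C\<^esub> e \<in> E"
    and M_iso: "\<And>m i. m \<in> M \<Longrightarrow> is_iso C i \<Longrightarrow> Tgt C i = Src C m \<Longrightarrow> m \<odot>\<^bsub>C\<^esub> i \<in> M"
  shows "factorization_system C E M"
proof -
  have E: "f \<in> E" if f: "f \<in> Mor C" and of: "\<And>m. m \<in> M \<Longrightarrow> orthogonal C f m" for f
  proof -
    obtain e m where e: "e \<in> E" and m: "m \<in> M" and me: "Tgt C e = Src C m" "f = m \<odot>\<^bsub>C\<^esub> e"
      using fact[OF f] by blast
    have eM: "e \<in> hom C (Src C f) (Src C m)" and mM: "m \<in> hom C (Src C m) (Tgt C f)"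
      using subsetD[OF EM(1) e] subsetD[OF EM(2) m] me cat_comp_Mor[OF C, of e m] by (auto simp: hom_def)
    note ob = hom_obj[OF C eM] hom_obj[OF C mM]
    have "\<exists>!w. w \<in> hom C (Tgt C f) (Src C m) \<and> w \<odot>\<^bsub>C\<^esub> f = e \<and> m \<odot>\<^bsub>C\<^esub> w = Idn C (Tgt C f)"
      using of[OF m] eM cat_id[OF C ob(4)] cat_idl[OF C hom_Src_Tgt[OF f]] me homD(3)[OF mM]
      by (auto simp: orthogonal_def)
    then obtain w where w: "w \<in> hom C (Tgt C f) (Src C m)" "w \<odot>\<^bsub>C\<^esub> f = e" "m \<odot>\<^bsub>C\<^esub> w = Idn C (Tgt C f)"
      by blast
    have "\<exists>!w. w \<in> hom C (Src C m) (Src C m) \<and> w \<odot>\<^bsub>C\<^esub> e = e \<and> m \<odot>\<^bsub>C\<^esub> w = m"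
      using orth[OF e m] eM mM me homD(2)[OF eM] homD(3)[OF mM] by (auto simp: orthogonal_def)
    moreover have "w \<odot>\<^bsub>C\<^esub> m \<in> hom C (Src C m) (Src C m)" "(w \<odot>\<^bsub>C\<^esub> m) \<odot>\<^bsub>C\<^esub> e = e" "m \<odot>\<^bsub>C\<^esub> (w \<odot>\<^bsub>C\<^esub> m) = m"
      using cat_comp[OF C mM w(1)] cat_assoc[OF C eM mM w(1)] cat_assoc[OF C mM w(1) mM] w me
        cat_idl[OF C mM] by auto
    moreover have "Idn C (Src C m) \<in> hom C (Src C m) (Src C m)" "Idn C (Src C m) \<odot>\<^bsub>C\<^esub> e = e"
      "m \<odot>\<^bsub>C\<^esub> Idn C (Src C m) = m"
      using cat_id[OF C ob(2)] cat_idl[OF C eM] cat_idr[OF C mM] by auto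
    ultimately have "w \<odot>\<^bsub>C\<^esub> m = Idn C (Src C m)" by blast
    then have "is_iso C m" using is_iso_hom[OF mM] w by blast
    then show ?thesis using E_iso[OF e] me by simp
  qed
  have M: "f \<in> M" if f: "f \<in> Mor C" and of: "\<And>e. e \<in> E \<Longrightarrow> orthogonal C e f" for f
  proof -
    obtain e m where e: "e \<in> E" and m: "m \<in> M" and me: "Tgt C e = Src C m" "f = m \<odot>\<^bsub>C\<^esub> e"
      using fact[OF f] by blast
    have eM: "e \<in> hom C (Src C f) (Src C m)" and mM: "m \<in> hom C (Src C m) (Tgt C f)"
      using subsetD[OF EM(1) e] subsetD[OF EM(2) m] me cat_comp_Mor[OF C, of e m] by (auto simp: hom_def)
    note ob = hom_obj[OF C eM] hom_obj[OF C mM]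
    have "\<exists>!w. w \<in> hom C (Src C m) (Src C f) \<and> w \<odot>\<^bsub>C\<^esub> e = Idn C (Src C f) \<and> f \<odot>\<^bsub>C\<^esub> w = m"
      using of[OF e] mM cat_id[OF C ob(1)] cat_idr[OF C hom_Src_Tgt[OF f]] me homD(2)[OF eM]
      by (auto simp: orthogonal_def)
    then obtain w where w: "w \<in> hom C (Src C m) (Src C f)" "w \<odot>\<^bsub>C\<^esub> e = Idn C (Src C f)" "f \<odot>\<^bsub>C\<^esub> w = m"
      by blast
    have "\<exists>!w. w \<in> hom C (Src C m) (Src C m) \<and> w \<odot>\<^bsub>C\<^esub> e = e \<and> m \<odot>\<^bsub>C\<^esub> w = m"
      using orth[OF e m] eM mM me homD(2)[OF eM] homD(3)[OF mM] by (auto simp: orthogonal_def)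
    moreover have "e \<odot>\<^bsub>C\<^esub> w \<in> hom C (Src C m) (Src C m)" "(e \<odot>\<^bsub>C\<^esub> w) \<odot>\<^bsub>C\<^esub> e = e" "m \<odot>\<^bsub>C\<^esub> (e \<odot>\<^bsub>C\<^esub> w) = m"
      using cat_comp[OF C w(1) eM] cat_assoc[OF C eM w(1) eM] cat_assoc[OF C w(1) eM mM] w me
        cat_idr[OF C eM] by auto
    moreover have "Idn C (Src C m) \<in> hom C (Src C m) (Src C m)" "Idn C (Src C m) \<odot>\<^bsub>C\<^esub> e = e"
      "m \<odot>\<^bsub>C\<^esub> Idn C (Src C m) = m"
      using cat_id[OF C ob(2)] cat_idl[OF C eM] cat_idr[OF C mM] by auto
    ultimately have "e \<odot>\<^bsub>C\<^esub> w = Idn C (Src C m)" by blast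
    then have "is_iso C e" using is_iso_hom[OF eM] w by blast
    then show ?thesis using M_iso[OF m] me by simp
  qed
  show ?thesis
    unfolding factorization_system_def using E M EM orth fact by blast
qed

section \<open>Eilenberg-Moore categories\<close>

lemma adjunctionD:
  assumes "adjunction C D F G \<eta> \<epsilon>"
  shows "is_functor C D F" "is_functor D C G" "nat_trans C C id_func (G \<circ>\<^sub>F F) \<eta>"
    "nat_trans D D (F \<circ>\<^sub>F G) id_func \<epsilon>"
    "\<And>a. a \<in> Ob C \<Longrightarrow> \<epsilon> (omap F a) \<odot>\<^bsub>D\<^esub> amap F (\<eta> a) = Idn D (omap F a)"
    "\<And>d. d \<in> Ob D \<Longrightarrow> amap G (\<epsilon> d) \<odot>\<^bsub>C\<^esub> \<eta> (omap G d) = Idn C (omap G d)"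
  using assms by (auto simp: adjunction_def)

lemma EM_Ob: "(x, a) \<in> Ob (EM C T \<eta> \<mu>) \<longleftrightarrow> x \<in> Ob C \<and> a \<in> hom C (omap T x) x \<and>
    a \<odot>\<^bsub>C\<^esub> \<eta> x = Idn C x \<and> a \<odot>\<^bsub>C\<^esub> \<mu> x = a \<odot>\<^bsub>C\<^esub> amap T a"
  by (simp add: EM_def)

lemma EM_hom: "hom (EM C T \<eta> \<mu>) (x, a) (y, b) =
   {((x, a), (y, b), f) |f. (x, a) \<in> Ob (EM C T \<eta> \<mu>) \<and> (y, b) \<in> Ob (EM C T \<eta> \<mu>) \<and>
      f \<in> hom C x y \<and> f \<odot>\<^bsub>C\<^esub> a = b \<odot>\<^bsub>C\<^esub> amap T f}"
  by (auto simp: EM_def triple_cat_hom)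

lemma EM_homI:
  assumes "(x, a) \<in> Ob (EM C T \<eta> \<mu>)" "(y, b) \<in> Ob (EM C T \<eta> \<mu>)" "f \<in> hom C x y"
    "f \<odot>\<^bsub>C\<^esub> a = b \<odot>\<^bsub>C\<^esub> amap T f"
  shows "((x, a), (y, b), f) \<in> hom (EM C T \<eta> \<mu>) (x, a) (y, b)"
  unfolding EM_hom using assms by blast

lemma EM_Idn: "Idn (EM C T \<eta> \<mu>) (x, a) = ((x, a), (x, a), Idn C x)"
  by (simp add: EM_def)

lemma EM_Cmp: "(Y', Z, g) \<odot>\<^bsub>EM C T \<eta> \<mu>\<^esub> (X, Y, f) = (X, Z, g \<odot>\<^bsub>C\<^esub> f)"
  by (simp add: EM_def)

lemma EM_category:
  assumes T: "is_functor C C T"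
  shows "category (EM C T \<eta> \<mu>)"
proof -
  note C = functor_cat(1)[OF T]
  show ?thesis
    unfolding EM_def
  proof (rule triple_cat_category, goal_cases)
    case (1 X)
    then show ?case
      by (auto simp: cat_id[OF C] functor_id[OF T] cat_idl[OF C] cat_idr[OF C])
  next
    case (2 X Y Z f g)
    obtain x a y b z c where [simp]: "X = (x, a)" "Y = (y, b)" "Z = (z, c)" by (metis surj_pair)
    have a: "a \<in> hom C (omap T x) x" and b: "b \<in> hom C (omap T y) y" and c: "c \<in> hom C (omap T z) z"
      and f: "f \<in> hom C x y" "f \<odot>\<^bsub>C\<^esub> a = b \<odot>\<^bsub>C\<^esub> amap T f"
      and g: "g \<in> hom C y z" "g \<odot>\<^bsub>C\<^esub> b = c \<odot>\<^bsub>C\<^esub> amap T g" using 2 by auto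
    have "(g \<odot>\<^bsub>C\<^esub> f) \<odot>\<^bsub>C\<^esub> a = (g \<odot>\<^bsub>C\<^esub> b) \<odot>\<^bsub>C\<^esub> amap T f"
      using cat_assoc[OF C a f(1) g(1)] cat_assoc[OF C functor_hom[OF T f(1)] b g(1)] f(2) by simp
    also have "\<dots> = c \<odot>\<^bsub>C\<^esub> amap T (g \<odot>\<^bsub>C\<^esub> f)"
      using cat_assoc[OF C functor_hom[OF T f(1)] functor_hom[OF T g(1)] c] g(2) functor_comp[OF T f(1)
        g(1)]
      by simp
    finally show ?case using cat_comp[OF C f(1) g(1)] by simp
  qed (auto simp: cat_idl[OF C] cat_idr[OF C] cat_assoc[OF C])
qed

lemma EM_comparison_functor:
  assumes adj: "adjunction C D F G \<eta> \<epsilon>"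
  shows "is_functor D (EM C (G \<circ>\<^sub>F F) \<eta> (\<lambda>x. amap G (\<epsilon> (omap F x)))) (EM_comparison D G \<epsilon>)"
    (is "is_functor D ?M ?K")
proof -
  note F = adjunctionD(1)[OF adj] and G = adjunctionD(2)[OF adj] and \<epsilon> = adjunctionD(4)[OF adj]
  note C = functor_cat(1)[OF F] and D = functor_cat(2)[OF F]
  have e: "\<epsilon> d \<in> hom D (omap F (omap G d)) d" if "d \<in> Ob D" for d
    using nat_trans_hom[OF \<epsilon> that] by simp
  have en: "g \<odot>\<^bsub>D\<^esub> \<epsilon> a = \<epsilon> b \<odot>\<^bsub>D\<^esub> amap F (amap G g)" if "g \<in> hom D a b" for a b g
    using nat_trans_eq[OF \<epsilon> that] by simp
  have ob: "(omap G d, amap G (\<epsilon> d)) \<in> Ob ?M" if d: "d \<in> Ob D" for d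
    unfolding EM_Ob
  proof (intro conjI)
    note E = e[OF d]
    have "amap G (\<epsilon> d \<odot>\<^bsub>D\<^esub> \<epsilon> (omap F (omap G d))) = amap G (\<epsilon> d \<odot>\<^bsub>D\<^esub> amap F (amap G (\<epsilon> d)))"
      using en[OF E] by simp
    then show "amap G (\<epsilon> d) \<odot>\<^bsub>C\<^esub> amap G (\<epsilon> (omap F (omap G d))) =
      amap G (\<epsilon> d) \<odot>\<^bsub>C\<^esub> amap (G \<circ>\<^sub>F F) (amap G (\<epsilon> d))"
      using functor_comp[OF G e[OF functor_obj[OF F functor_obj[OF G d]]] E]
        functor_comp[OF G functor_hom[OF F functor_hom[OF G E]] E] by simp
  qed (use functor_obj[OF G d] functor_hom[OF G e[OF d]] adjunctionD(6)[OF adj d] in auto)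
  show ?thesis
  proof (rule is_functorI[OF D EM_category[OF comp_functor[OF F G]]])
    fix a b f assume f: "f \<in> hom D a b"
    note o = hom_obj[OF D f]
    have "amap G f \<odot>\<^bsub>C\<^esub> amap G (\<epsilon> a) = amap G (\<epsilon> b) \<odot>\<^bsub>C\<^esub> amap G (amap F (amap G f))"
      using functor_comp[OF G e[OF o(1)] f] functor_comp[OF G functor_hom[OF F functor_hom[OF G f]] e[OF
        o(2)]]
        en[OF f] by simp
    then show "amap ?K f \<in> hom ?M (omap ?K a) (omap ?K b)"
      using ob[OF o(1)] ob[OF o(2)] functor_hom[OF G f] homD[OF f]
      by (simp add: EM_comparison_def EM_hom)
  next
    fix a assume a: "a \<in> Ob D"
    show "omap ?K a \<in> Ob ?M" using ob[OF a] by (simp add: EM_comparison_def)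
    show "amap ?K (Idn D a) = Idn ?M (omap ?K a)"
      using homD(2,3)[OF cat_id[OF D a]] functor_id[OF G a] by (simp add: EM_comparison_def EM_Idn)
  next
    fix a b c f g assume f: "f \<in> hom D a b" and g: "g \<in> hom D b c"
    show "amap ?K (g \<odot>\<^bsub>D\<^esub> f) = amap ?K g \<odot>\<^bsub>?M\<^esub> amap ?K f"
      using homD(2,3)[OF f] homD(2,3)[OF g] homD(2,3)[OF cat_comp[OF D f g]] functor_comp[OF G f g]
      by (simp add: EM_comparison_def EM_Cmp)
  qed
qed

text \<open>Composing \<open>f a = b (T f)\<close> with the inverse \<open>g\<close> on the left and \<open>T g\<close> on the right gives \<open>g b =
  a (T g)\<close>.\<close>

lemma EM_iso:
  assumes T: "is_functor C C T" and k: "((x, a), (y, b), f) \<in> hom (EM C T \<eta> \<mu>) (x, a) (y, b)"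
    and iso: "is_iso C f"
  shows "is_iso (EM C T \<eta> \<mu>) ((x, a), (y, b), f)"
proof -
  note C = functor_cat(1)[OF T]
  have ob: "(x, a) \<in> Ob (EM C T \<eta> \<mu>)" "(y, b) \<in> Ob (EM C T \<eta> \<mu>)"
    and f: "f \<in> hom C x y" "f \<odot>\<^bsub>C\<^esub> a = b \<odot>\<^bsub>C\<^esub> amap T f"
    using k by (auto simp: EM_hom)
  have a: "a \<in> hom C (omap T x) x" and b: "b \<in> hom C (omap T y) y" using ob by (auto simp: EM_Ob)
  obtain g where g: "g \<in> hom C y x" "g \<odot>\<^bsub>C\<^esub> f = Idn C x" "f \<odot>\<^bsub>C\<^esub> g = Idn C y"
    using iso_inverse[OF f(1) iso] by metis
  note Tf = functor_hom[OF T f(1)] and Tg = functor_hom[OF T g(1)]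
  have "b = (b \<odot>\<^bsub>C\<^esub> amap T f) \<odot>\<^bsub>C\<^esub> amap T g"
    using cat_assoc[OF C Tg Tf b] functor_comp[OF T g(1) f(1)] g(3) functor_id[OF T hom_obj(1)[OF C g(1)]]
      cat_idr[OF C b] by simp
  also have "\<dots> = f \<odot>\<^bsub>C\<^esub> (a \<odot>\<^bsub>C\<^esub> amap T g)"
    using cat_assoc[OF C Tg a f(1)] f(2) by simp
  finally have "g \<odot>\<^bsub>C\<^esub> b = a \<odot>\<^bsub>C\<^esub> amap T g"
    using cat_assoc[OF C cat_comp[OF C Tg a] f(1) g(1)] g(2) cat_idl[OF C cat_comp[OF C Tg a]] by simp
  then have "((y, b), (x, a), g) \<in> hom (EM C T \<eta> \<mu>) (y, b) (x, a)"
    using ob g(1) by (simp add: EM_hom)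
  then show ?thesis
    unfolding is_iso_hom[OF k] using g(2,3) by (force simp: EM_Cmp EM_Idn)
qed

section \<open>Slices and pullback functors\<close>

lemma slice_Ob: "f \<in> Ob (slice C b) \<longleftrightarrow> f \<in> Mor C \<and> Tgt C f = b"
  by (simp add: slice_def)

lemma slice_hom: "hom (slice C b) f g =
   {(f, g, u) |u. f \<in> hom C (Src C f) b \<and> g \<in> hom C (Src C g) b \<and>
      u \<in> hom C (Src C f) (Src C g) \<and> g \<odot>\<^bsub>C\<^esub> u = f}"
  unfolding slice_def triple_cat_hom by (auto simp: hom_def)

lemma slice_homE:
  assumes "k \<in> hom (slice C b) f g"
  obtains u where "k = (f, g, u)" "f \<in> hom C (Src C f) b" "g \<in> hom C (Src C g) b"
    "u \<in> hom C (Src C f) (Src C g)" "g \<odot>\<^bsub>C\<^esub> u = f"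
  using assms unfolding slice_hom by blast

lemma slice_homI:
  assumes "f \<in> hom C X b" "g \<in> hom C Y b" "u \<in> hom C X Y" "g \<odot>\<^bsub>C\<^esub> u = f"
  shows "(f, g, u) \<in> hom (slice C b) f g"
  unfolding slice_hom using assms homD(2)[OF assms(1)] homD(2)[OF assms(2)] by simp

lemma slice_Idn: "Idn (slice C b) f = (f, f, Idn C (Src C f))"
  by (simp add: slice_def)

lemma slice_Cmp: "(g', h, v) \<odot>\<^bsub>slice C b\<^esub> (f, g, u) = (f, h, v \<odot>\<^bsub>C\<^esub> u)"
  by (simp add: slice_def)

lemma slice_category:
  assumes C: "category C"
  shows "category (slice C b)"
  unfolding slice_def
proof (rule triple_cat_category, goal_cases)
  case (2 f g h u v)
  then show ?case
    using cat_comp[OF C] cat_assoc[OF C, of u "Src C f" "Src C g" v "Src C h" h b] by (auto simp: homI)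
qed (auto simp: cat_idl[OF C] cat_idr[OF C] cat_id[OF C] cat_obj[OF C] cat_assoc[OF C] hom_Src_Tgt
  cat_idr[OF C hom_Src_Tgt])

lemma slice_iso:
  assumes C: "category C" and k: "(f, g, u) \<in> hom (slice C b) f g"
  shows "is_iso (slice C b) (f, g, u) \<longleftrightarrow> is_iso C u"
proof -
  have f: "f \<in> hom C (Src C f) b" and g: "g \<in> hom C (Src C g) b"
    and u: "u \<in> hom C (Src C f) (Src C g)" "g \<odot>\<^bsub>C\<^esub> u = f"
    using k by (auto simp: slice_hom)
  have "(g, f, v) \<in> hom (slice C b) g f"
    if v: "v \<in> hom C (Src C g) (Src C f)" "u \<odot>\<^bsub>C\<^esub> v = Idn C (Src C g)" for v
    using f g v cat_assoc[OF C v(1) u(1) g] u(2) cat_idr[OF C g] by (auto simp: slice_hom)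
  then have "is_iso (slice C b) (f, g, u)" if "v \<in> hom C (Src C g) (Src C f)" "u \<odot>\<^bsub>C\<^esub> v = Idn C (Src C g)"
    "v \<odot>\<^bsub>C\<^esub> u = Idn C (Src C f)" for v
    unfolding is_iso_hom[OF k] using that by (intro bexI[of _ "(g, f, v)"]) (auto simp: slice_Cmp slice_Idn)
  moreover have "is_iso C u" if "is_iso (slice C b) (f, g, u)"
    using that unfolding is_iso_hom[OF k] is_iso_hom[OF u(1)]
    by (auto simp: slice_Cmp slice_Idn elim!: slice_homE)
  ultimately show ?thesis using is_iso_hom[OF u(1)] by blast
qed

definition postcomp :: "('o, 'm) cat \<Rightarrow> 'm \<Rightarrow> ('m, 'm \<times> 'm \<times> 'm, 'm, 'm \<times> 'm \<times> 'm) func" where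
  "postcomp C p = \<lparr>omap = (\<lambda>q. p \<odot>\<^bsub>C\<^esub> q), amap = (\<lambda>(q, q', u). (p \<odot>\<^bsub>C\<^esub> q, p \<odot>\<^bsub>C\<^esub> q', u))\<rparr>"

lemma postcomp_functor:
  assumes C: "category C" and p: "p \<in> Mor C"
  shows "is_functor (slice C (Src C p)) (slice C (Tgt C p)) (postcomp C p)"
proof (rule is_functorI[OF slice_category[OF C] slice_category[OF C]])
  fix q assume "q \<in> Ob (slice C (Src C p))"
  then have q: "q \<in> Mor C" "Tgt C q = Src C p" by (auto simp: slice_Ob)
  note pq = cat_comp_Mor[OF C q(1) p q(2)]
  show "omap (postcomp C p) q \<in> Ob (slice C (Tgt C p))" using pq by (simp add: postcomp_def slice_Ob)
  show "amap (postcomp C p) (Idn (slice C (Src C p)) q) = Idn (slice C (Tgt C p)) (omap (postcomp C p) q)"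
    using pq by (simp add: postcomp_def slice_Idn)
next
  fix q q' k assume "k \<in> hom (slice C (Src C p)) q q'"
  then obtain u where k: "k = (q, q', u)" and h: "q \<in> hom C (Src C q) (Src C p)"
    "q' \<in> hom C (Src C q') (Src C p)" "u \<in> hom C (Src C q) (Src C q')" "q' \<odot>\<^bsub>C\<^esub> u = q"
    by (elim slice_homE)
  note P = hom_Src_Tgt[OF p]
  show "amap (postcomp C p) k \<in> hom (slice C (Tgt C p)) (omap (postcomp C p) q) (omap (postcomp C p) q')"
    using cat_comp[OF C h(1) P] cat_comp[OF C h(2) P] h cat_assoc[OF C h(3) h(2) P]
      homD(2)[OF cat_comp[OF C h(1) P]] homD(2)[OF cat_comp[OF C h(2) P]]
    by (simp add: k postcomp_def slice_hom)
next
  fix a b c f g assume "f \<in> hom (slice C (Src C p)) a b" "g \<in> hom (slice C (Src C p)) b c"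
  then show "amap (postcomp C p) (g \<odot>\<^bsub>slice C (Src C p)\<^esub> f) =
      amap (postcomp C p) g \<odot>\<^bsub>slice C (Tgt C p)\<^esub> amap (postcomp C p) f"
    by (auto elim!: slice_homE simp: slice_Cmp postcomp_def)
qed

lemma is_pullbackD:
  assumes "is_pullback C f p f' p'"
  shows "f \<in> hom C (Src C f) (Tgt C p)" "p \<in> hom C (Src C p) (Tgt C p)"
    "f' \<in> hom C (Src C f') (Src C p)" "p' \<in> hom C (Src C f') (Src C f)"
    "f \<odot>\<^bsub>C\<^esub> p' = p \<odot>\<^bsub>C\<^esub> f'"
    "\<And>X x y. x \<in> hom C X (Src C f) \<Longrightarrow> y \<in> hom C X (Src C p) \<Longrightarrow> f \<odot>\<^bsub>C\<^esub> x = p \<odot>\<^bsub>C\<^esub> y \<Longrightarrow>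
        \<exists>!w. w \<in> hom C X (Src C f') \<and> p' \<odot>\<^bsub>C\<^esub> w = x \<and> f' \<odot>\<^bsub>C\<^esub> w = y"
  using assms unfolding is_pullback_def by (auto intro: homI)

text \<open>A pullback square over \<open>p\<close> is a universal arrow from postcomposition with \<open>p\<close>.\<close>

lemma pullback_functor_exists:
  assumes C: "category C" and pb: "has_pullbacks C" and p: "p \<in> Mor C"
  obtains G \<eta> \<pi> where
    "adjunction (slice C (Src C p)) (slice C (Tgt C p)) (postcomp C p) G \<eta>
       (\<lambda>f. (p \<odot>\<^bsub>C\<^esub> omap G f, f, \<pi> f))"
    "is_pullback_functor C p G"
    "\<And>f. f \<in> Ob (slice C (Tgt C p)) \<Longrightarrow> is_pullback C f p (omap G f) (\<pi> f)"
    "\<And>f g u. (f, g, u) \<in> hom (slice C (Tgt C p)) f g \<Longrightarrow>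
       \<pi> g \<odot>\<^bsub>C\<^esub> datum (amap G (f, g, u)) = u \<odot>\<^bsub>C\<^esub> \<pi> f"
proof -
  let ?S = "slice C (Src C p)" and ?T = "slice C (Tgt C p)"
  have "\<forall>f\<in>Ob ?T. \<exists>f' p'. is_pullback C f p f' p'"
    using pb p by (auto simp: has_pullbacks_def slice_Ob)
  then obtain r \<pi> where r\<pi>: "\<And>f. f \<in> Ob ?T \<Longrightarrow> is_pullback C f p (r f) (\<pi> f)" by metis
  define e where "e f = (p \<odot>\<^bsub>C\<^esub> r f, f, \<pi> f)" for f
  have e: "e f \<in> hom ?T (omap (postcomp C p) (r f)) f" if "f \<in> Ob ?T" for f
    using is_pullbackD(1-5)[OF r\<pi>[OF that]] cat_comp[OF C is_pullbackD(3,2)[OF r\<pi>[OF that]]]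
      homD(2)[OF cat_comp[OF C is_pullbackD(3,2)[OF r\<pi>[OF that]]]]
    by (auto simp: e_def slice_hom postcomp_def)
  have r: "r f \<in> Ob ?S" if "f \<in> Ob ?T" for f
    using is_pullbackD(3)[OF r\<pi>[OF that]] by (auto simp: slice_Ob hom_def)
  have "\<exists>!u. u \<in> hom ?S q (r f) \<and> e f \<odot>\<^bsub>?T\<^esub> amap (postcomp C p) u = k"
    if f: "f \<in> Ob ?T" and q: "q \<in> Ob ?S" and k: "k \<in> hom ?T (omap (postcomp C p) q) f" for f q k
  proof -
    note P = is_pullbackD[OF r\<pi>[OF f]]
    have qh: "q \<in> hom C (Src C q) (Src C p)" using q by (auto simp: slice_Ob intro: homI)
    obtain v where k: "k = (p \<odot>\<^bsub>C\<^esub> q, f, v)" and v: "v \<in> hom C (Src C q) (Src C f)" "f \<odot>\<^bsub>C\<^esub> v = p \<odot>\<^bsub>C\<^esub> q"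
      using k homD(2)[OF cat_comp[OF C qh P(2)]] by (auto elim!: slice_homE simp: postcomp_def)
    have eq: "u \<in> hom ?S q (r f) \<and> e f \<odot>\<^bsub>?T\<^esub> amap (postcomp C p) u = k \<longleftrightarrow>
       (\<exists>w. u = (q, r f, w) \<and> w \<in> hom C (Src C q) (Src C (r f)) \<and> \<pi> f \<odot>\<^bsub>C\<^esub> w = v \<and> r f \<odot>\<^bsub>C\<^esub> w = q)" for u
      using qh P(3) by (auto simp: slice_hom e_def postcomp_def slice_Cmp k)
    show ?thesis unfolding eq using P(6)[OF v(1) qh v(2)] by blast
  qed
  then obtain G \<eta> where G: "adjunction ?S ?T (postcomp C p) G \<eta> e" and Gr: "omap G = r"
    using right_adjoint_of_universal_arrows[OF postcomp_functor[OF C p] slice_category[OF C], of r e] r e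
    by blast
  have nat: "\<pi> g \<odot>\<^bsub>C\<^esub> datum (amap G (f, g, u)) = u \<odot>\<^bsub>C\<^esub> \<pi> f" if k: "(f, g, u) \<in> hom ?T f g" for f g u
  proof -
    obtain w where "amap G (f, g, u) = (r f, r g, w)"
      using functor_hom[OF adjunctionD(2)[OF G] k] by (auto elim!: slice_homE simp: Gr)
    then show ?thesis
      using nat_trans_eq[OF adjunctionD(4)[OF G] k] by (simp add: e_def slice_Cmp postcomp_def)
  qed
  have "is_pullback_functor C p G"
    unfolding is_pullback_functor_def
  proof (intro conjI exI[of _ \<pi>])
    show "is_functor ?T ?S G" using adjunctionD(2)[OF G] .
    show "\<forall>(f, g, u)\<in>Mor ?T. \<pi> g \<odot>\<^bsub>C\<^esub> datum (amap G (f, g, u)) = u \<odot>\<^bsub>C\<^esub> \<pi> f"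
      using nat by (auto simp: slice_def triple_cat_Mor triple_cat_hom)
  qed (use r\<pi> in \<open>auto simp: Gr\<close>)
  then show thesis
    using that[of G \<eta> \<pi>] G r\<pi> nat by (simp add: Gr e_def[abs_def])
qed

lemma slice_morphism_to_identity:
  assumes C: "category C" and i: "i \<in> Mor C"
  shows "(i, Idn C (Tgt C i), i) \<in> hom (slice C (Tgt C i)) i (Idn C (Tgt C i))"
  using cat_id[OF C cat_obj(2)[OF C i]] cat_idl[OF C hom_Src_Tgt[OF i]] hom_Src_Tgt[OF i]
    homD(2)[OF cat_id[OF C cat_obj(2)[OF C i]]]
  by (auto simp: slice_hom)

text \<open>
  Monadic functors reflect isomorphisms, because the forgetful functor from algebras does. Applied
  to \<open>i\<close> as a morphism into the terminal object of the slice, this says that effective descent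
  morphisms \<open>p\<close> are strong epimorphisms: they do not factor through a proper subobject.
\<close>

lemma effective_descent_reflects_iso:
  assumes C: "category C" and ed: "effective_descent C p" and i: "i \<in> Mor C" "Tgt C i = Tgt C p"
    and pb: "\<And>f' p'. is_pullback C i p f' p' \<Longrightarrow> is_iso C f'"
  shows "is_iso C i"
proof -
  obtain G F \<eta> \<epsilon> where p: "p \<in> Mor C" and G: "is_pullback_functor C p G"
    and adj: "adjunction (slice C (Src C p)) (slice C (Tgt C p)) F G \<eta> \<epsilon>"
    and eq: "equivalence_functor (slice C (Tgt C p))
      (EM (slice C (Src C p)) (G \<circ>\<^sub>F F) \<eta> (\<lambda>x. amap G (\<epsilon> (omap F x)))) (EM_comparison (slice C (Tgt C p)) G
        \<epsilon>)"
    using ed unfolding effective_descent_def monadic_def by blast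
  let ?T = "slice C (Tgt C p)" and ?S = "slice C (Src C p)" and ?t = "Idn C (Tgt C p)"
  have k: "(i, ?t, i) \<in> hom ?T i ?t" using slice_morphism_to_identity[OF C i(1)] i(2) by simp
  note ob = hom_obj[OF slice_category[OF C] k]
  obtain \<pi> where Gf: "is_functor ?T ?S G" and \<pi>: "\<And>f. f \<in> Ob ?T \<Longrightarrow> is_pullback C f p (omap G f) (\<pi> f)"
    using G by (auto simp: is_pullback_functor_def)
  have iso1: "is_iso C (omap G i)" using pb \<pi>[OF ob(1)] by blast
  note P1 = is_pullbackD[OF \<pi>[OF ob(1)]] and P2 = is_pullbackD[OF \<pi>[OF ob(2)]]
  have st: "Src C ?t = Tgt C p" using homD(2)[OF cat_id[OF C cat_obj(2)[OF C p]]] .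
  \<comment> \<open>The inverse of the pullback of the identity is the morphism induced by \<open>p\<close> itself.\<close>
  have iso2: "is_iso C (omap G ?t)"
  proof -
    have P: "p \<in> hom C (Src C p) (Tgt C p)" using hom_Src_Tgt[OF p] .
    have "\<exists>!w. w \<in> hom C (Src C p) (Src C (omap G ?t)) \<and> \<pi> ?t \<odot>\<^bsub>C\<^esub> w = p \<and> omap G ?t \<odot>\<^bsub>C\<^esub> w =
      Idn C (Src C p)"
      by (rule P2(6)) (use P in \<open>auto simp: st cat_idl[OF C P] cat_idr[OF C P] cat_id[OF C] cat_obj[OF C p]\<close>)
    then obtain w where w: "w \<in> hom C (Src C p) (Src C (omap G ?t))" "\<pi> ?t \<odot>\<^bsub>C\<^esub> w = p"
      "omap G ?t \<odot>\<^bsub>C\<^esub> w = Idn C (Src C p)" by blast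
    note g = P2(3) and pit = P2(4)[unfolded st]
    have \<pi>t: "\<pi> ?t = p \<odot>\<^bsub>C\<^esub> omap G ?t" using P2(5) cat_idl[OF C pit] by simp
    have ex1: "\<exists>!w. w \<in> hom C (Src C (omap G ?t)) (Src C (omap G ?t)) \<and> \<pi> ?t \<odot>\<^bsub>C\<^esub> w = \<pi> ?t \<and>
      omap G ?t \<odot>\<^bsub>C\<^esub> w = omap G ?t"
      using P2(6)[OF P2(4) P2(3) P2(5)] .
    have wg: "w \<odot>\<^bsub>C\<^esub> omap G ?t \<in> hom C (Src C (omap G ?t)) (Src C (omap G ?t))"
      using cat_comp[OF C g w(1)] .
    have "\<pi> ?t \<odot>\<^bsub>C\<^esub> (w \<odot>\<^bsub>C\<^esub> omap G ?t) = \<pi> ?t" "omap G ?t \<odot>\<^bsub>C\<^esub> (w \<odot>\<^bsub>C\<^esub> omap G ?t) = omap G ?t"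
      using cat_assoc[OF C g w(1) pit] cat_assoc[OF C g w(1) g] w \<pi>t cat_idl[OF C g] by auto
    moreover have "Idn C (Src C (omap G ?t)) \<in> hom C (Src C (omap G ?t)) (Src C (omap G ?t))"
      "\<pi> ?t \<odot>\<^bsub>C\<^esub> Idn C (Src C (omap G ?t)) = \<pi> ?t" "omap G ?t \<odot>\<^bsub>C\<^esub> Idn C (Src C (omap G ?t)) = omap G ?t"
      using cat_id[OF C hom_obj(1)[OF C g]] cat_idr[OF C g] cat_idr[OF C pit] by auto
    ultimately have "w \<odot>\<^bsub>C\<^esub> omap G ?t = Idn C (Src C (omap G ?t))" using ex1 wg by blast
    then show ?thesis using is_iso_hom[OF g] w by blast
  qed
  obtain v where v: "amap G (i, ?t, i) = (omap G i, omap G ?t, v)"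
    "v \<in> hom C (Src C (omap G i)) (Src C (omap G ?t))"
    "omap G ?t \<odot>\<^bsub>C\<^esub> v = omap G i"
    using functor_hom[OF Gf k] by (auto elim!: slice_homE)
  obtain w where w: "w \<in> hom C (Src C p) (Src C (omap G ?t))" "is_iso C w"
    "w \<odot>\<^bsub>C\<^esub> omap G ?t = Idn C (Src C (omap G ?t))"
    using iso_inverse[OF P2(3) iso2] by metis
  have "v = w \<odot>\<^bsub>C\<^esub> omap G i"
    using cat_assoc[OF C v(2) P2(3) w(1)] v(3) w(3) cat_idl[OF C v(2)] by simp
  then have "is_iso C v" using iso_comp[OF C P1(3) iso1 w(1,2)] by simp
  then have isoG: "is_iso ?S (amap G (i, ?t, i))"
    using slice_iso[OF C, of "omap G i" "omap G ?t" v] functor_hom[OF Gf k] v(1) by simp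
  let ?K = "EM_comparison ?T G \<epsilon>"
  have "is_iso (EM ?S (G \<circ>\<^sub>F F) \<eta> (\<lambda>x. amap G (\<epsilon> (omap F x)))) (amap ?K (i, ?t, i))"
    using EM_iso[OF comp_functor[OF adjunctionD(1,2)[OF adj]] _ isoG]
      functor_hom[OF EM_comparison_functor[OF adj] k] homD(2,3)[OF k]
    by (simp add: EM_comparison_def)
  then have "is_iso ?T (i, ?t, i)" using equivalence_reflects_iso[OF eq k] by blast
  then show ?thesis using slice_iso[OF C k] by blast
qed

section \<open>Small sets\<close>

lemma small_lepoll: "small U Y \<Longrightarrow> X \<lesssim> Y \<Longrightarrow> small U X"
  unfolding small_def by (rule lesspoll_trans1)

lemma small_subset: "small U Y \<Longrightarrow> X \<subseteq> Y \<Longrightarrow> small U X"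
  using small_lepoll subset_imp_lepoll by blast

lemma small_image: "small U X \<Longrightarrow> small U (f ` X)"
  using small_lepoll image_lepoll by blast

lemma small_inj_on: "small U Y \<Longrightarrow> inj_on f X \<Longrightarrow> f ` X \<subseteq> Y \<Longrightarrow> small U X"
  by (erule small_lepoll) (auto simp: lepoll_def)

lemma small_finite: "universe U \<Longrightarrow> finite X \<Longrightarrow> small U X"
  unfolding small_def universe_def by (simp add: finite_lesspoll_infinite)

text \<open>An arbitrary coding of the elements of a small set by elements of the universe.\<close>

definition enc :: "'x set \<Rightarrow> 'x \<Rightarrow> 'u" where
  "enc X = (SOME e. inj_on e X)"

lemma enc_inj:
  assumes "small TYPE('u) X"
  shows "inj_on (enc X :: 'x \<Rightarrow> 'u) X"
proof -
  have "X \<lesssim> (UNIV :: 'u set)" using assms by (auto simp: small_def intro: lesspoll_imp_lepoll)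
  then show ?thesis unfolding enc_def lepoll_def by (metis someI)
qed

text \<open>
  A universe is closed under small unions of sets of its own elements. A small set over any other
  type can be moved there, and pairs can be coded because an infinite set is as large as its square.
\<close>

lemma small_Sigma:
  fixes J :: "'x set" and X :: "'x \<Rightarrow> 'y set"
  assumes U: "universe TYPE('u)" and J: "small TYPE('u) J" and X: "\<And>j. j \<in> J \<Longrightarrow> small TYPE('u) (X j)"
  shows "small TYPE('u) (Sigma J X)"
proof -
  have "infinite (UNIV :: 'u set)" using U by (simp add: universe_def)
  then have "(UNIV :: 'u set) \<times> (UNIV :: 'u set) \<lesssim> (UNIV :: 'u set)"
    using card_of_Times_same_infinite eqpoll_iff_card_of_ordIso eqpoll_imp_lepoll by blast
  then obtain pr :: "'u \<times> 'u \<Rightarrow> 'u" where pr: "inj pr" by (auto simp: lepoll_def)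
  let ?e = "enc J :: 'x \<Rightarrow> 'u" and ?d = "inv_into J (enc J :: 'x \<Rightarrow> 'u)"
  define Y where "Y i = (\<lambda>x. pr (i, enc (X (?d i)) x)) ` X (?d i)" for i
  have d: "?d (?e j) = j" if "j \<in> J" for j using that enc_inj[OF J] by simp
  have "small TYPE('u) (\<Union>i\<in>?e ` J. Y i)"
  proof -
    have "small TYPE('u) (Y i)" if "i \<in> ?e ` J" for i
      using that d X by (auto simp: Y_def intro: small_image)
    then show ?thesis
      by (intro U[unfolded universe_def, THEN conjunct2, THEN conjunct2, rule_format] small_image[OF J])
  qed
  moreover have "inj_on (\<lambda>(j, x). pr (?e j, enc (X j) x)) (Sigma J X)"
  proof (rule inj_onI)
    fix s t assume s: "s \<in> Sigma J X" and t: "t \<in> Sigma J X"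
      and st: "(\<lambda>(j, x). pr (?e j, enc (X j) x)) s = (\<lambda>(j, x). pr (?e j, enc (X j) x)) t"
    obtain j x i y where [simp]: "s = (j, x)" "t = (i, y)" by (cases s, cases t)
    have "(?e j, enc (X j) x :: 'u) = (?e i, enc (X i) y)" by (rule injD[OF pr]) (use st in simp)
    then have eq: "?e j = ?e i" "(enc (X j) x :: 'u) = enc (X i) y" by auto
    have "j = i" using inj_onD[OF enc_inj[OF J] eq(1)] s t by simp
    moreover have "x = y" using inj_onD[OF enc_inj[OF X, of i]] eq(2) s t \<open>j = i\<close> by simp
    ultimately show "s = t" by simp
  qed
  moreover have "(\<lambda>(j, x). pr (?e j, enc (X j) x)) ` Sigma J X \<subseteq> (\<Union>i\<in>?e ` J. Y i)"
    using d by (auto simp: Y_def)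
  ultimately show ?thesis by (rule small_inj_on)
qed

lemma small_Pow:
  fixes X :: "'x set"
  assumes U: "universe TYPE('u)" and X: "small TYPE('u) X"
  shows "small TYPE('u) (Pow X)"
proof -
  have "small TYPE('u) (Pow ((enc X :: 'x \<Rightarrow> 'u) ` X))"
    using U small_image[OF X] by (auto simp: universe_def)
  moreover have "inj_on (image (enc X :: 'x \<Rightarrow> 'u)) (Pow X)"
    using enc_inj[OF X] by (simp add: inj_on_image_Pow)
  ultimately show ?thesis by (elim small_inj_on) auto
qed

text \<open>A function is determined by its graph, which is a subset of a small set of pairs.\<close>

lemma small_PiE:
  assumes U: "universe TYPE('u)" and J: "small TYPE('u) J" and X: "\<And>j. j \<in> J \<Longrightarrow> small TYPE('u) (X j)"
  shows "small TYPE('u) (PiE J X)"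
proof (rule small_inj_on[OF small_Pow[OF U small_Sigma[OF assms]]])
  show "inj_on (\<lambda>f. (\<lambda>j. (j, f j)) ` J) (PiE J X)"
  proof (rule inj_onI)
    fix f g assume f: "f \<in> PiE J X" and g: "g \<in> PiE J X" and eq: "(\<lambda>j. (j, f j)) ` J = (\<lambda>j. (j, g j)) ` J"
    have "f j = g j" if j: "j \<in> J" for j
    proof -
      have "(j, f j) \<in> (\<lambda>j. (j, g j)) ` J" unfolding eq[symmetric] using j by (rule imageI)
      then show ?thesis by auto
    qed
    then show "f = g" by (rule PiE_ext[OF f g])
  qed
qed auto

section \<open>Set-valued functors and their elements\<close>

lemma SetCat_Ob: "X \<in> Ob (SetCat :: ('u set, 'u smap) cat) \<longleftrightarrow> small TYPE('u) X"
  by (simp add: SetCat_def)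

lemma SetCat_hom: "hom (SetCat :: ('u set, 'u smap) cat) X Y =
   {(X, Y, f) |f. small TYPE('u) X \<and> small TYPE('u) Y \<and> f \<in> X \<rightarrow>\<^sub>E Y}"
  by (auto simp: SetCat_def triple_cat_hom)

lemma SetCat_Idn: "Idn SetCat X = (X, X, \<lambda>x\<in>X. x)"
  by (simp add: SetCat_def)

lemma SetCat_Cmp: "(Y', Z, g) \<odot>\<^bsub>SetCat\<^esub> (X, Y, f) = (X, Z, compose X g f)"
  by (simp add: SetCat_def)

lemma SetCat_Src [simp]: "Src SetCat (X, Y, f) = X" and SetCat_Tgt [simp]: "Tgt SetCat (X, Y, f) = Y"
  by (simp_all add: SetCat_def)

lemma SetCat_category: "category SetCat"
  unfolding SetCat_def
  by (rule triple_cat_category) (auto simp: compose_def fun_eq_iff PiE_def extensional_def Pi_iff)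

lemma Fun_Ob: "F \<in> Ob (Fun C D) \<longleftrightarrow>
    is_functor C D F \<and> omap F \<in> extensional (Ob C) \<and> amap F \<in> extensional (Mor C)"
  by (simp add: Fun_def)

lemma Fun_hom: "hom (Fun C D) F G = {(F, G, \<tau>) |\<tau>. F \<in> Ob (Fun C D) \<and> G \<in> Ob (Fun C D) \<and>
    nat_trans C D F G \<tau> \<and> \<tau> \<in> extensional (Ob C)}"
  by (auto simp: Fun_def triple_cat_hom)

lemma Fun_Idn: "Idn (Fun C D) F = (F, F, \<lambda>a\<in>Ob C. Idn D (omap F a))"
  by (simp add: Fun_def)

lemma Fun_Cmp: "(G', H, \<sigma>) \<odot>\<^bsub>Fun C D\<^esub> (F, G, \<tau>) = (F, H, \<lambda>a\<in>Ob C. \<sigma> a \<odot>\<^bsub>D\<^esub> \<tau> a)"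
  by (simp add: Fun_def)

lemma Fun_Src [simp]: "Src (Fun C D) (F, G, \<tau>) = F" and Fun_Tgt [simp]: "Tgt (Fun C D) (F, G, \<tau>) = G"
  by (simp_all add: Fun_def)

lemma nat_trans_comp:
  assumes \<tau>: "nat_trans C D F G \<tau>" and \<sigma>: "nat_trans C D G H \<sigma>"
  shows "nat_trans C D F H (\<lambda>a\<in>Ob C. \<sigma> a \<odot>\<^bsub>D\<^esub> \<tau> a)"
proof (rule nat_transI)
  show F: "is_functor C D F" and H: "is_functor C D H" using \<tau> \<sigma> by (auto simp: nat_trans_def)
  note D = functor_cat(2)[OF F]
  fix a b f assume a: "a \<in> Ob C" and b: "b \<in> Ob C" and f: "f \<in> hom C a b"
  have G: "is_functor C D G" using \<tau> by (auto simp: nat_trans_def)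
  note t = nat_trans_hom[OF \<tau>] and s = nat_trans_hom[OF \<sigma>]
  have "amap H f \<odot>\<^bsub>D\<^esub> (\<sigma> a \<odot>\<^bsub>D\<^esub> \<tau> a) = (\<sigma> b \<odot>\<^bsub>D\<^esub> amap G f) \<odot>\<^bsub>D\<^esub> \<tau> a"
    using cat_assoc[OF D t[OF a] s[OF a] functor_hom[OF H f]] nat_trans_eq[OF \<sigma> f] by simp
  also have "\<dots> = (\<sigma> b \<odot>\<^bsub>D\<^esub> \<tau> b) \<odot>\<^bsub>D\<^esub> amap F f"
    using cat_assoc[OF D t[OF a] functor_hom[OF G f] s[OF b]] nat_trans_eq[OF \<tau> f]
      cat_assoc[OF D functor_hom[OF F f] t[OF b] s[OF b]] by simp
  finally show "amap H f \<odot>\<^bsub>D\<^esub> (\<lambda>a\<in>Ob C. \<sigma> a \<odot>\<^bsub>D\<^esub> \<tau> a) a = (\<lambda>a\<in>Ob C. \<sigma> a \<odot>\<^bsub>D\<^esub> \<tau> a) b \<odot>\<^bsub>D\<^esub> amap F f"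
    using a b by simp
next
  fix a assume a: "a \<in> Ob C"
  have "category D" using \<tau> functor_cat(2) by (auto simp: nat_trans_def)
  then show "(\<lambda>a\<in>Ob C. \<sigma> a \<odot>\<^bsub>D\<^esub> \<tau> a) a \<in> hom D (omap F a) (omap H a)"
    using a cat_comp[OF _ nat_trans_hom[OF \<tau> a] nat_trans_hom[OF \<sigma> a]] by simp
qed

lemma nat_trans_id: "is_functor C D F \<Longrightarrow> nat_trans C D F F (\<lambda>a\<in>Ob C. Idn D (omap F a))"
proof (rule nat_transI)
  fix a b f assume F: "is_functor C D F" and a: "a \<in> Ob C" and b: "b \<in> Ob C" and f: "f \<in> hom C a b"
  show "amap F f \<odot>\<^bsub>D\<^esub> (\<lambda>a\<in>Ob C. Idn D (omap F a)) a = (\<lambda>a\<in>Ob C. Idn D (omap F a)) b \<odot>\<^bsub>D\<^esub> amap F f"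
    using a b cat_idl[OF functor_cat(2)[OF F] functor_hom[OF F f]]
      cat_idr[OF functor_cat(2)[OF F] functor_hom[OF F f]] by simp
qed (auto simp: cat_id functor_obj functor_cat(2))

lemma Fun_category:
  shows "category (Fun C D)"
  unfolding Fun_def
proof (rule triple_cat_category, goal_cases)
  case (1 F)
  then show ?case using nat_trans_id by auto
next
  case (2 F G H \<tau> \<sigma>)
  then show ?case using nat_trans_comp by auto
next
  case (3 F G \<tau>)
  then have F: "is_functor C D F" and \<tau>: "nat_trans C D F G \<tau>" "\<tau> \<in> extensional (Ob C)" by auto
  note D = functor_cat(2)[OF F]
  show ?case
    using \<tau>(2) cat_idl[OF D nat_trans_hom[OF \<tau>(1)]] cat_idr[OF D nat_trans_hom[OF \<tau>(1)]]
    by (auto simp: extensional_def)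
next
  case (4 F G H L \<tau> \<sigma> \<rho>)
  then have F: "is_functor C D F" and \<tau>: "nat_trans C D F G \<tau>" and \<sigma>: "nat_trans C D G H \<sigma>"
    and \<rho>: "nat_trans C D H L \<rho>" by auto
  note D = functor_cat(2)[OF F]
  show ?case
    using cat_assoc[OF D nat_trans_hom[OF \<tau>] nat_trans_hom[OF \<sigma>] nat_trans_hom[OF \<rho>]]
    by (auto simp: restrict_def)
qed

text \<open>
  Everything below is calculated with elements: \<open>act S f x\<close> is the action of a morphism of \<open>A\<close> on an
  element, \<open>app \<tau> a x\<close> the image of an element under a component, and \<open>tr\<close> builds a natural
  transformation from the images of the elements.
\<close>

definition act :: "('a, 'f, 'u set, 'u smap) func \<Rightarrow> 'f \<Rightarrow> 'u \<Rightarrow> 'u" where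
  "act S f x = datum (amap S f) x"

definition app :: "('a, 'f, 'u set, 'u smap) ntrans \<Rightarrow> 'a \<Rightarrow> 'u \<Rightarrow> 'u" where
  "app \<tau> a x = datum (datum \<tau> a) x"

definition tr :: "('a, 'f) cat \<Rightarrow> ('a, 'f, 'u set, 'u smap) func \<Rightarrow> ('a, 'f, 'u set, 'u smap) func \<Rightarrow>
    ('a \<Rightarrow> 'u \<Rightarrow> 'u) \<Rightarrow> ('a, 'f, 'u set, 'u smap) ntrans" where
  "tr A S T \<phi> = (S, T, \<lambda>a\<in>Ob A. (omap S a, omap T a, \<lambda>x\<in>omap S a. \<phi> a x))"

text \<open>\<open>U\<close> only names the type of the universe, which does not occur in the type of \<open>A\<close>.\<close>

locale set_valued_functors =
  fixes A :: "('a, 'f) cat" and U :: "'u itself"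
  assumes cat_A: "category A" and univ: "universe TYPE('u)"
begin

abbreviation PSh where "PSh \<equiv> Fun A (SetCat :: ('u set, 'u smap) cat)"

lemmas cat_PSh = Fun_category[of A "SetCat :: ('u set, 'u smap) cat"]

lemma set_functor: "S \<in> Ob PSh \<Longrightarrow> is_functor A SetCat S"
  by (simp add: Fun_Ob)

lemma small_omap: "S \<in> Ob PSh \<Longrightarrow> a \<in> Ob A \<Longrightarrow> small TYPE('u) (omap S a)"
  using functor_obj[OF set_functor] by (auto simp: SetCat_Ob)

lemma amap_eq:
  assumes S: "S \<in> Ob PSh" and f: "f \<in> hom A a b"
  shows "amap S f = (omap S a, omap S b, act S f)" "act S f \<in> omap S a \<rightarrow>\<^sub>E omap S b"
  using functor_hom[OF set_functor[OF S] f] by (auto simp: SetCat_hom act_def[abs_def])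

lemma act_in: "S \<in> Ob PSh \<Longrightarrow> f \<in> hom A a b \<Longrightarrow> x \<in> omap S a \<Longrightarrow> act S f x \<in> omap S b"
  using amap_eq(2) by fast

lemma act_id: "S \<in> Ob PSh \<Longrightarrow> a \<in> Ob A \<Longrightarrow> x \<in> omap S a \<Longrightarrow> act S (Idn A a) x = x"
  using functor_id[OF set_functor] by (simp add: act_def SetCat_Idn)

lemma act_comp:
  assumes S: "S \<in> Ob PSh" and f: "f \<in> hom A a b" and g: "g \<in> hom A b c" and x: "x \<in> omap S a"
  shows "act S (g \<odot>\<^bsub>A\<^esub> f) x = act S g (act S f x)"
  using functor_comp[OF set_functor[OF S] f g] x
  by (subst act_def) (simp add: amap_eq(1)[OF S f] amap_eq(1)[OF S g] SetCat_Cmp compose_def)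

lemma morphism_obj:
  assumes "\<tau> \<in> hom PSh S T"
  shows "S \<in> Ob PSh" "T \<in> Ob PSh"
  using hom_obj[OF cat_PSh assms] by auto

lemma morphism_eq:
  assumes "\<tau> \<in> hom PSh S T"
  shows "\<exists>t. \<tau> = (S, T, t) \<and> nat_trans A SetCat S T t \<and> t \<in> extensional (Ob A)"
  using assms by (auto simp: Fun_hom)

lemma component_eq:
  assumes \<tau>: "\<tau> \<in> hom PSh S T" and a: "a \<in> Ob A"
  shows "datum \<tau> a = (omap S a, omap T a, app \<tau> a)" "app \<tau> a \<in> omap S a \<rightarrow>\<^sub>E omap T a"
proof -
  obtain t where "\<tau> = (S, T, t)" "nat_trans A SetCat S T t" using morphism_eq[OF \<tau>] by blast
  then show "datum \<tau> a = (omap S a, omap T a, app \<tau> a)" "app \<tau> a \<in> omap S a \<rightarrow>\<^sub>E omap T a"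
    using nat_trans_hom[of A SetCat S T t a] a by (auto simp: SetCat_hom app_def[abs_def])
qed

lemma app_in: "\<tau> \<in> hom PSh S T \<Longrightarrow> a \<in> Ob A \<Longrightarrow> x \<in> omap S a \<Longrightarrow> app \<tau> a x \<in> omap T a"
  using component_eq(2) by fast

lemma app_nat:
  assumes \<tau>: "\<tau> \<in> hom PSh S T" and f: "f \<in> hom A a b" and x: "x \<in> omap S a"
  shows "app \<tau> b (act S f x) = act T f (app \<tau> a x)"
proof -
  note ob = hom_obj[OF cat_A f]
  obtain t where t: "\<tau> = (S, T, t)" "nat_trans A SetCat S T t" using morphism_eq[OF \<tau>] by blast
  have "t a = (omap S a, omap T a, app \<tau> a)" "t b = (omap S b, omap T b, app \<tau> b)"
    using component_eq(1)[OF \<tau>] ob t(1) by auto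
  then have "compose (omap S a) (act T f) (app \<tau> a) = compose (omap S a) (app \<tau> b) (act S f)"
    using nat_trans_eq[OF t(2) f]
    by (simp add: amap_eq(1)[OF morphism_obj(1)[OF \<tau>] f] amap_eq(1)[OF morphism_obj(2)[OF \<tau>] f] SetCat_Cmp)
  then show ?thesis using compose_eq[OF x] by metis
qed

lemma morphism_ext:
  assumes \<tau>: "\<tau> \<in> hom PSh S T" and \<sigma>: "\<sigma> \<in> hom PSh S T"
    and eq: "\<And>a x. a \<in> Ob A \<Longrightarrow> x \<in> omap S a \<Longrightarrow> app \<tau> a x = app \<sigma> a x"
  shows "\<tau> = \<sigma>"
proof -
  obtain t s where t: "\<tau> = (S, T, t)" "t \<in> extensional (Ob A)"
    and s: "\<sigma> = (S, T, s)" "s \<in> extensional (Ob A)"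
    using morphism_eq[OF \<tau>] morphism_eq[OF \<sigma>] by blast
  have "t a = s a" if a: "a \<in> Ob A" for a
  proof -
    have "app \<tau> a = app \<sigma> a"
      using PiE_ext[OF component_eq(2)[OF \<tau> a] component_eq(2)[OF \<sigma> a]] eq[OF a] by blast
    then show ?thesis using component_eq(1)[OF \<tau> a] component_eq(1)[OF \<sigma> a] t(1) s(1) by simp
  qed
  then have "t = s" by (rule extensionalityI[OF t(2) s(2)])
  then show ?thesis using t s by simp
qed

lemma app_id: "S \<in> Ob PSh \<Longrightarrow> a \<in> Ob A \<Longrightarrow> x \<in> omap S a \<Longrightarrow> app (Idn PSh S) a x = x"
  by (simp add: app_def Fun_Idn SetCat_Idn)

lemma app_comp:
  assumes \<tau>: "\<tau> \<in> hom PSh S T" and \<sigma>: "\<sigma> \<in> hom PSh T V" and a: "a \<in> Ob A" and x: "x \<in> omap S a"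
  shows "app (\<sigma> \<odot>\<^bsub>PSh\<^esub> \<tau>) a x = app \<sigma> a (app \<tau> a x)"
proof -
  obtain t s where t: "\<tau> = (S, T, t)" and s: "\<sigma> = (T, V, s)"
    using morphism_eq[OF \<tau>] morphism_eq[OF \<sigma>] by blast
  have "t a = (omap S a, omap T a, app \<tau> a)" "s a = (omap T a, omap V a, app \<sigma> a)"
    using component_eq(1)[OF \<tau> a] component_eq(1)[OF \<sigma> a] t s by auto
  then show ?thesis using a x by (subst app_def) (simp add: t s Fun_Cmp SetCat_Cmp compose_def)
qed

lemma tr_hom:
  assumes S: "S \<in> Ob PSh" and T: "T \<in> Ob PSh"
    and "\<And>a x. a \<in> Ob A \<Longrightarrow> x \<in> omap S a \<Longrightarrow> \<phi> a x \<in> omap T a"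
    and "\<And>a b f x. f \<in> hom A a b \<Longrightarrow> x \<in> omap S a \<Longrightarrow> \<phi> b (act S f x) = act T f (\<phi> a x)"
  shows "tr A S T \<phi> \<in> hom PSh S T"
proof -
  have "nat_trans A SetCat S T (\<lambda>a\<in>Ob A. (omap S a, omap T a, \<lambda>x\<in>omap S a. \<phi> a x))"
  proof (rule nat_transI[OF set_functor[OF S] set_functor[OF T]])
    fix a b f assume a: "a \<in> Ob A" and b: "b \<in> Ob A" and f: "f \<in> hom A a b"
    show "amap T f \<odot>\<^bsub>SetCat\<^esub> (\<lambda>a\<in>Ob A. (omap S a, omap T a, \<lambda>x\<in>omap S a. \<phi> a x)) a =
        (\<lambda>a\<in>Ob A. (omap S a, omap T a, \<lambda>x\<in>omap S a. \<phi> a x)) b \<odot>\<^bsub>SetCat\<^esub> amap S f"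
      using a b assms(4)[OF f] act_in[OF S f]
      by (auto simp: amap_eq(1)[OF S f] amap_eq(1)[OF T f] SetCat_Cmp compose_def restrict_def)
  qed (use assms small_omap[OF S] small_omap[OF T] in \<open>auto simp: SetCat_hom\<close>)
  then show ?thesis using S T by (simp add: Fun_hom tr_def)
qed

lemma app_tr: "a \<in> Ob A \<Longrightarrow> x \<in> omap S a \<Longrightarrow> app (tr A S T \<phi>) a x = \<phi> a x"
  by (simp add: app_def tr_def)

text \<open>
  The elements of a set-valued functor may be described in whatever type is convenient, as pairs,
  families or equivalence classes, and are coded into the universe only afterwards.
\<close>

lemma coded_functor_exists:
  fixes X :: "'a \<Rightarrow> 'x set" and \<alpha> :: "'f \<Rightarrow> 'x \<Rightarrow> 'x"
  assumes small: "\<And>a. a \<in> Ob A \<Longrightarrow> small TYPE('u) (X a)"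
    and in_X: "\<And>a b f x. f \<in> hom A a b \<Longrightarrow> x \<in> X a \<Longrightarrow> \<alpha> f x \<in> X b"
    and id: "\<And>a x. a \<in> Ob A \<Longrightarrow> x \<in> X a \<Longrightarrow> \<alpha> (Idn A a) x = x"
    and comp: "\<And>a b c f g x. f \<in> hom A a b \<Longrightarrow> g \<in> hom A b c \<Longrightarrow> x \<in> X a \<Longrightarrow> \<alpha> (g \<odot>\<^bsub>A\<^esub> f) x = \<alpha> g (\<alpha> f x)"
  shows "\<exists>S (c :: 'a \<Rightarrow> 'x \<Rightarrow> 'u). S \<in> Ob PSh \<and> (\<forall>a\<in>Ob A. bij_betw (c a) (X a) (omap S a)) \<and>
     (\<forall>a b. \<forall>f\<in>hom A a b. \<forall>x\<in>X a. act S f (c a x) = c b (\<alpha> f x))"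
proof -
  define c :: "'a \<Rightarrow> 'x \<Rightarrow> 'u" where "c a = enc (X a)" for a
  define d where "d a = inv_into (X a) (c a)" for a
  have cd: "d a (c a x) = x" if "a \<in> Ob A" "x \<in> X a" for a x
    using enc_inj[OF small[OF that(1)]] that(2) by (simp add: c_def d_def)
  define S :: "('a, 'f, 'u set, 'u smap) func" where
    "S = \<lparr>omap = \<lambda>a\<in>Ob A. c a ` X a,
       amap = \<lambda>f\<in>Mor A. (c (Src A f) ` X (Src A f), c (Tgt A f) ` X (Tgt A f),
         \<lambda>u\<in>c (Src A f) ` X (Src A f). c (Tgt A f) (\<alpha> f (d (Src A f) u)))\<rparr>"
  have am: "amap S f = (c a ` X a, c b ` X b, \<lambda>u\<in>c a ` X a. c b (\<alpha> f (d a u)))" if "f \<in> hom A a b" for a b f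
    using homD[OF that] by (simp add: S_def)
  have c_inj: "x = y" if "a \<in> Ob A" "c a x = c a y" "x \<in> X a" "y \<in> X a" for a x y
    using cd that by metis
  have om: "omap S a = c a ` X a" if "a \<in> Ob A" for a using that by (simp add: S_def)
  have "is_functor A SetCat S"
  proof (rule is_functorI[OF cat_A SetCat_category])
    fix a assume a: "a \<in> Ob A"
    show "omap S a \<in> Ob SetCat" using a small_image[OF small[OF a]] by (simp add: om SetCat_Ob)
    show "amap S (Idn A a) = Idn SetCat (omap S a)"
      using a id[OF a] cd[OF a] by (auto simp: am[OF cat_id[OF cat_A a]] SetCat_Idn om fun_eq_iff
        restrict_def)
  next
    fix a b f assume a: "a \<in> Ob A" "b \<in> Ob A" and f: "f \<in> hom A a b"
    show "amap S f \<in> hom SetCat (omap S a) (omap S b)"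
      using a small_image[OF small[OF a(1)]] small_image[OF small[OF a(2)]] in_X[OF f] cd[OF a(1)]
      by (auto simp: am[OF f] SetCat_hom om)
  next
    fix a b e f g assume f: "f \<in> hom A a b" and g: "g \<in> hom A b e"
    note ob = hom_obj[OF cat_A f] hom_obj[OF cat_A g]
    show "amap S (g \<odot>\<^bsub>A\<^esub> f) = amap S g \<odot>\<^bsub>SetCat\<^esub> amap S f"
      using comp[OF f g] in_X[OF f] c_inj[OF ob(2)]
      by (auto simp: cd ob am[OF f] am[OF g] am[OF cat_comp[OF cat_A f g]] SetCat_Cmp compose_def fun_eq_iff
        restrict_def) metis
  qed
  then have "S \<in> Ob PSh" by (simp add: Fun_Ob S_def)
  moreover have "bij_betw (c a) (X a) (omap S a)" if "a \<in> Ob A" for a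
    using that enc_inj[OF small[OF that]] by (simp add: S_def c_def inj_on_imp_bij_betw)
  moreover have "act S f (c a x) = c b (\<alpha> f x)" if f: "f \<in> hom A a b" and x: "x \<in> X a" for a b f x
    using x cd[OF hom_obj(1)[OF cat_A f] x] by (simp add: act_def am[OF f])
  ultimately show ?thesis by blast
qed

text \<open>The same with the coding read backwards: \<open>d a u\<close> is the description of the element \<open>u\<close>.\<close>

lemma decoded_functor_exists:
  fixes X :: "'a \<Rightarrow> 'x set" and \<alpha> :: "'f \<Rightarrow> 'x \<Rightarrow> 'x"
  assumes small: "\<And>a. a \<in> Ob A \<Longrightarrow> small TYPE('u) (X a)"
    and in_X: "\<And>a b f x. f \<in> hom A a b \<Longrightarrow> x \<in> X a \<Longrightarrow> \<alpha> f x \<in> X b"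
    and id: "\<And>a x. a \<in> Ob A \<Longrightarrow> x \<in> X a \<Longrightarrow> \<alpha> (Idn A a) x = x"
    and comp: "\<And>a b c f g x. f \<in> hom A a b \<Longrightarrow> g \<in> hom A b c \<Longrightarrow> x \<in> X a \<Longrightarrow> \<alpha> (g \<odot>\<^bsub>A\<^esub> f) x = \<alpha> g (\<alpha> f x)"
  shows "\<exists>S (d :: 'a \<Rightarrow> 'u \<Rightarrow> 'x). S \<in> Ob PSh \<and> (\<forall>a\<in>Ob A. bij_betw (d a) (omap S a) (X a)) \<and>
     (\<forall>a b. \<forall>f\<in>hom A a b. \<forall>u\<in>omap S a. d b (act S f u) = \<alpha> f (d a u))"
proof -
  have "\<exists>S (c :: 'a \<Rightarrow> 'x \<Rightarrow> 'u). S \<in> Ob PSh \<and> (\<forall>a\<in>Ob A. bij_betw (c a) (X a) (omap S a)) \<and>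
     (\<forall>a b. \<forall>f\<in>hom A a b. \<forall>x\<in>X a. act S f (c a x) = c b (\<alpha> f x))"
    by (rule coded_functor_exists) (fact assms)+
  then obtain S and c :: "'a \<Rightarrow> 'x \<Rightarrow> 'u" where S: "S \<in> Ob PSh"
    and c: "\<And>a. a \<in> Ob A \<Longrightarrow> bij_betw (c a) (X a) (omap S a)"
    and cact: "\<And>a b f x. f \<in> hom A a b \<Longrightarrow> x \<in> X a \<Longrightarrow> act S f (c a x) = c b (\<alpha> f x)" by blast
  define d where "d a = inv_into (X a) (c a)" for a
  have d: "bij_betw (d a) (omap S a) (X a)" if "a \<in> Ob A" for a
    using bij_betw_inv_into[OF c[OF that]] by (simp add: d_def)
  have "d b (act S f u) = \<alpha> f (d a u)" if f: "f \<in> hom A a b" and u: "u \<in> omap S a" for a b f u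
  proof -
    note ob = hom_obj[OF cat_A f]
    have du: "d a u \<in> X a" using bij_betw_apply[OF d[OF ob(1)] u] .
    have "c a (d a u) = u" using bij_betw_inv_into_right[OF c[OF ob(1)] u] by (simp add: d_def)
    moreover have "d b (c b (\<alpha> f (d a u))) = \<alpha> f (d a u)"
      using bij_betw_inv_into_left[OF c[OF ob(2)] in_X[OF f du]] by (simp add: d_def)
    ultimately show ?thesis using cact[OF f du] by simp
  qed
  then show ?thesis using S d by blast
qed

text \<open>Isomorphisms and pullbacks are computed on elements.\<close>

lemma iso_iff_bij:
  assumes \<tau>: "\<tau> \<in> hom PSh S T"
  shows "is_iso PSh \<tau> \<longleftrightarrow> (\<forall>a\<in>Ob A. bij_betw (app \<tau> a) (omap S a) (omap T a))"
proof
  note S = morphism_obj(1)[OF \<tau>] and T = morphism_obj(2)[OF \<tau>]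
  assume "is_iso PSh \<tau>"
  then obtain \<sigma> where \<sigma>: "\<sigma> \<in> hom PSh T S" "\<sigma> \<odot>\<^bsub>PSh\<^esub> \<tau> = Idn PSh S" "\<tau> \<odot>\<^bsub>PSh\<^esub> \<sigma> = Idn PSh T"
    using is_iso_hom[OF \<tau>] by blast
  show "\<forall>a\<in>Ob A. bij_betw (app \<tau> a) (omap S a) (omap T a)"
  proof
    fix a assume a: "a \<in> Ob A"
    have "app \<sigma> a (app \<tau> a x) = x" if "x \<in> omap S a" for x
      using app_comp[OF \<tau> \<sigma>(1) a that] app_id[OF S a that] \<sigma>(2) by simp
    moreover have "app \<tau> a (app \<sigma> a x) = x" if "x \<in> omap T a" for x
      using app_comp[OF \<sigma>(1) \<tau> a that] app_id[OF T a that] \<sigma>(3) by simp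
    ultimately show "bij_betw (app \<tau> a) (omap S a) (omap T a)"
      by (intro bij_betw_byWitness[of _ "app \<sigma> a"]) (auto intro: app_in[OF \<tau> a] app_in[OF \<sigma>(1) a])
  qed
next
  note S = morphism_obj(1)[OF \<tau>] and T = morphism_obj(2)[OF \<tau>]
  assume bij: "\<forall>a\<in>Ob A. bij_betw (app \<tau> a) (omap S a) (omap T a)"
  define i where "i a = inv_into (omap S a) (app \<tau> a)" for a
  have i: "i a x \<in> omap S a" "app \<tau> a (i a x) = x" if "a \<in> Ob A" "x \<in> omap T a" for a x
    using bij that by (auto simp: i_def bij_betw_def inv_into_into f_inv_into_f)
  have i2: "i a (app \<tau> a x) = x" if "a \<in> Ob A" "x \<in> omap S a" for a x
    using bij that by (auto simp: i_def bij_betw_def)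
  have \<sigma>: "tr A T S i \<in> hom PSh T S"
  proof (rule tr_hom[OF T S i(1)])
    fix a b f x assume f: "f \<in> hom A a b" and x: "x \<in> omap T a"
    note ob = hom_obj[OF cat_A f]
    have "act T f x = app \<tau> b (act S f (i a x))"
      using app_nat[OF \<tau> f i(1)[OF ob(1) x]] i(2)[OF ob(1) x] by simp
    then show "i b (act T f x) = act S f (i a x)"
      using i2[OF ob(2) act_in[OF S f i(1)[OF ob(1) x]]] by simp
  qed
  have "tr A T S i \<odot>\<^bsub>PSh\<^esub> \<tau> = Idn PSh S"
    by (rule morphism_ext[OF cat_comp[OF cat_PSh \<tau> \<sigma>] cat_id[OF cat_PSh S]])
      (simp add: app_comp[OF \<tau> \<sigma>] app_tr app_id S app_in[OF \<tau>] i2)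
  moreover have "\<tau> \<odot>\<^bsub>PSh\<^esub> tr A T S i = Idn PSh T"
    by (rule morphism_ext[OF cat_comp[OF cat_PSh \<sigma> \<tau>] cat_id[OF cat_PSh T]])
      (simp add: app_comp[OF \<sigma> \<tau>] app_tr app_id T i)
  ultimately show "is_iso PSh \<tau>" using is_iso_hom[OF \<tau>] \<sigma> by blast
qed

lemma cw_inj_iff: "\<tau> \<in> hom PSh S T \<Longrightarrow> cw_inj A \<tau> \<longleftrightarrow> (\<forall>a\<in>Ob A. inj_on (app \<tau> a) (omap S a))"
  by (simp add: cw_inj_def component_eq)

lemma cw_surj_iff: "\<tau> \<in> hom PSh S T \<Longrightarrow> cw_surj A \<tau> \<longleftrightarrow> (\<forall>a\<in>Ob A. app \<tau> a ` omap S a = omap T a)"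
  by (simp add: cw_surj_def component_eq)

definition elementwise_pullback where
  "elementwise_pullback S E P f p f' p' \<longleftrightarrow>
     (\<forall>a\<in>Ob A. \<forall>z\<in>omap P a. app f a (app p' a z) = app p a (app f' a z)) \<and>
     (\<forall>a\<in>Ob A. \<forall>x\<in>omap S a. \<forall>e\<in>omap E a. app f a x = app p a e \<longrightarrow>
        (\<exists>!z. z \<in> omap P a \<and> app p' a z = x \<and> app f' a z = e))"

lemma pullback_of_elementwise:
  assumes f: "f \<in> hom PSh S T" and p: "p \<in> hom PSh E T" and f': "f' \<in> hom PSh P E"
    and p': "p' \<in> hom PSh P S"
    and el: "elementwise_pullback S E P f p f' p'"
  shows "is_pullback PSh f p f' p'"
proof -
  note s = homD[OF f] homD[OF p] homD[OF f'] homD[OF p']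
  note P = morphism_obj(1)[OF f'] and S = morphism_obj(1)[OF f] and E = morphism_obj(1)[OF p]
  have sq: "f \<odot>\<^bsub>PSh\<^esub> p' = p \<odot>\<^bsub>PSh\<^esub> f'"
    by (rule morphism_ext[OF cat_comp[OF cat_PSh p' f] cat_comp[OF cat_PSh f' p]])
      (use el in \<open>auto simp: app_comp[OF p' f] app_comp[OF f' p] elementwise_pullback_def\<close>)
  have uni: "\<exists>!w. w \<in> hom PSh X P \<and> p' \<odot>\<^bsub>PSh\<^esub> w = x \<and> f' \<odot>\<^bsub>PSh\<^esub> w = y"
    if x: "x \<in> hom PSh X S" and y: "y \<in> hom PSh X E" and xy: "f \<odot>\<^bsub>PSh\<^esub> x = p \<odot>\<^bsub>PSh\<^esub> y" for X x y
  proof -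
    note X = morphism_obj(1)[OF x]
    have ex: "\<exists>!z. z \<in> omap P a \<and> app p' a z = app x a t \<and> app f' a z = app y a t"
      if a: "a \<in> Ob A" and t: "t \<in> omap X a" for a t
    proof -
      have "app f a (app x a t) = app p a (app y a t)"
        using app_comp[OF x f a t] app_comp[OF y p a t] xy by simp
      then show ?thesis
        using el a app_in[OF x a t] app_in[OF y a t] unfolding elementwise_pullback_def by blast
    qed
    define w where "w a t = (THE z. z \<in> omap P a \<and> app p' a z = app x a t \<and> app f' a z = app y a t)" for a t
    have w: "w a t \<in> omap P a" "app p' a (w a t) = app x a t" "app f' a (w a t) = app y a t"
      if "a \<in> Ob A" "t \<in> omap X a" for a t
      using theI'[OF ex[OF that]] by (auto simp: w_def)
    have W: "tr A X P w \<in> hom PSh X P"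
    proof (rule tr_hom[OF X P w(1)])
      fix a b k t assume k: "k \<in> hom A a b" and t: "t \<in> omap X a"
      note ob = hom_obj[OF cat_A k] and wt = w[OF hom_obj(1)[OF cat_A k] t]
      have "act P k (w a t) \<in> omap P b \<and> app p' b (act P k (w a t)) = app x b (act X k t) \<and>
          app f' b (act P k (w a t)) = app y b (act X k t)"
        using act_in[OF P k wt(1)] app_nat[OF p' k wt(1)] app_nat[OF f' k wt(1)] app_nat[OF x k t]
          app_nat[OF y k t] wt by simp
      then show "w b (act X k t) = act P k (w a t)"
        using w[OF ob(2) act_in[OF X k t]] ex[OF ob(2) act_in[OF X k t]] by blast
    qed
    show ?thesis
    proof (rule ex1I[of _ "tr A X P w"], intro conjI W)
      show "p' \<odot>\<^bsub>PSh\<^esub> tr A X P w = x"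
        by (rule morphism_ext[OF cat_comp[OF cat_PSh W p'] x]) (simp add: app_comp[OF W p'] app_tr w)
      show "f' \<odot>\<^bsub>PSh\<^esub> tr A X P w = y"
        by (rule morphism_ext[OF cat_comp[OF cat_PSh W f'] y]) (simp add: app_comp[OF W f'] app_tr w)
    next
      fix v assume "v \<in> hom PSh X P \<and> p' \<odot>\<^bsub>PSh\<^esub> v = x \<and> f' \<odot>\<^bsub>PSh\<^esub> v = y"
      then have v: "v \<in> hom PSh X P" "p' \<odot>\<^bsub>PSh\<^esub> v = x" "f' \<odot>\<^bsub>PSh\<^esub> v = y" by auto
      show "v = tr A X P w"
      proof (rule morphism_ext[OF v(1) W])
        fix a t assume a: "a \<in> Ob A" and t: "t \<in> omap X a"
        have "app v a t \<in> omap P a \<and> app p' a (app v a t) = app x a t \<and> app f' a (app v a t) = app y a t"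
          using app_in[OF v(1) a t] app_comp[OF v(1) p' a t] app_comp[OF v(1) f' a t] v(2,3) by simp
        then show "app v a t = app (tr A X P w) a t"
          unfolding app_tr[OF a t] using ex[OF a t] w[OF a t] by blast
      qed
    qed
  qed
  show ?thesis
    unfolding is_pullback_def s
    by (intro conjI allI ballI impI) (use homD(1)[OF f] homD(1)[OF p] f' p' sq uni in auto)
qed

lemma elementwise_pullback_exists:
  assumes f: "f \<in> hom PSh S T" and p: "p \<in> hom PSh E T"
  shows "\<exists>P f' p'. f' \<in> hom PSh P E \<and> p' \<in> hom PSh P S \<and> elementwise_pullback S E P f p f' p'"
proof -
  note S = morphism_obj(1)[OF f] and E = morphism_obj(1)[OF p] and T = morphism_obj(2)[OF f]
  define X where "X a = {(x, e). x \<in> omap S a \<and> e \<in> omap E a \<and> app f a x = app p a e}" for a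
  define \<alpha> where "\<alpha> k = (\<lambda>(x, e). (act S k x, act E k e))" for k
  have "small TYPE('u) (X a)" if a: "a \<in> Ob A" for a
    by (rule small_subset[OF small_Sigma[OF univ small_omap[OF S a] small_omap[OF E a]]])
      (auto simp: X_def)
  then have "\<exists>P (d :: 'a \<Rightarrow> 'u \<Rightarrow> 'u \<times> 'u). P \<in> Ob PSh \<and> (\<forall>a\<in>Ob A. bij_betw (d a) (omap P a) (X a)) \<and>
     (\<forall>a b. \<forall>k\<in>hom A a b. \<forall>z\<in>omap P a. d b (act P k z) = \<alpha> k (d a z))"
    by (rule decoded_functor_exists)
      (auto simp: X_def \<alpha>_def act_id act_comp act_in S E app_nat[OF f] app_nat[OF p])
  then obtain P and d :: "'a \<Rightarrow> 'u \<Rightarrow> 'u \<times> 'u" where P: "P \<in> Ob PSh"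
    and bij: "\<And>a. a \<in> Ob A \<Longrightarrow> bij_betw (d a) (omap P a) (X a)"
    and dact: "\<And>a b k z. k \<in> hom A a b \<Longrightarrow> z \<in> omap P a \<Longrightarrow> d b (act P k z) = \<alpha> k (d a z)"
    by blast
  have d: "d a z \<in> X a" if "a \<in> Ob A" "z \<in> omap P a" for a z
    using bij_betw_apply[OF bij[OF that(1)] that(2)] .
  define f' p' where "f' = tr A P E (\<lambda>a z. snd (d a z))" and "p' = tr A P S (\<lambda>a z. fst (d a z))"
  have "f' \<in> hom PSh P E" "p' \<in> hom PSh P S"
    unfolding f'_def p'_def using d
    by (auto intro!: tr_hom simp: P S E dact \<alpha>_def X_def split_beta)
  moreover have "elementwise_pullback S E P f p f' p'"
    unfolding elementwise_pullback_def
  proof (intro conjI ballI impI)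
    fix a z assume a: "a \<in> Ob A" and z: "z \<in> omap P a"
    then show "app f a (app p' a z) = app p a (app f' a z)"
      using d[OF a z] by (simp add: f'_def p'_def app_tr X_def split_beta)
  next
    fix a x e assume a: "a \<in> Ob A" and "x \<in> omap S a" "e \<in> omap E a" "app f a x = app p a e"
    then have xe: "(x, e) \<in> X a" by (simp add: X_def)
    have iff: "app p' a z = x \<and> app f' a z = e \<longleftrightarrow> d a z = (x, e)" if "z \<in> omap P a" for z
      using a that by (auto simp: f'_def p'_def app_tr prod_eq_iff)
    have "\<exists>!z. z \<in> omap P a \<and> d a z = (x, e)"
      using bij[OF a] xe unfolding bij_betw_def inj_on_def by (metis (no_types, lifting) imageE)
    then show "\<exists>!z. z \<in> omap P a \<and> app p' a z = x \<and> app f' a z = e" using iff by metis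
  qed
  ultimately show ?thesis by blast
qed

text \<open>
  The converse holds for abstractly given pullbacks because they are isomorphic to the one whose
  elements are pairs.
\<close>

lemma elementwise_of_pullback:
  assumes pb: "is_pullback PSh f p f' p'" and f: "f \<in> hom PSh S T" and p: "p \<in> hom PSh E T"
  shows "f' \<in> hom PSh (Src PSh f') E" "p' \<in> hom PSh (Src PSh f') S"
    "elementwise_pullback S E (Src PSh f') f p f' p'"
proof -
  let ?P = "Src PSh f'"
  note B = is_pullbackD[OF pb, unfolded homD[OF f] homD[OF p]]
  show f': "f' \<in> hom PSh ?P E" and p': "p' \<in> hom PSh ?P S" using B(3,4) .
  note P = morphism_obj(1)[OF f']
  \<comment> \<open>The standard pullback maps to \<open>?P\<close>, and this map is onto because its composite with the
    map in the other direction is the identity.\<close>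
  obtain Q g q where g: "g \<in> hom PSh Q E" and q: "q \<in> hom PSh Q S"
    and el: "elementwise_pullback S E Q f p g q"
    using elementwise_pullback_exists[OF f p] by blast
  note Q = morphism_obj(1)[OF g]
  note pbQ = pullback_of_elementwise[OF f p g q el]
  note BQ = is_pullbackD[OF pbQ, unfolded homD[OF f] homD[OF p] homD[OF g]]
  obtain k where k: "k \<in> hom PSh Q ?P" "p' \<odot>\<^bsub>PSh\<^esub> k = q" "f' \<odot>\<^bsub>PSh\<^esub> k = g"
    using B(6)[OF q g BQ(5)] by blast
  obtain l where l: "l \<in> hom PSh ?P Q" "q \<odot>\<^bsub>PSh\<^esub> l = p'" "g \<odot>\<^bsub>PSh\<^esub> l = f'"
    using BQ(6)[OF p' f' B(5)] by blast
  have "k \<odot>\<^bsub>PSh\<^esub> l = Idn PSh ?P"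
  proof -
    have "p' \<odot>\<^bsub>PSh\<^esub> (k \<odot>\<^bsub>PSh\<^esub> l) = p'" "f' \<odot>\<^bsub>PSh\<^esub> (k \<odot>\<^bsub>PSh\<^esub> l) = f'"
      using cat_assoc[OF cat_PSh l(1) k(1) p'] cat_assoc[OF cat_PSh l(1) k(1) f'] k l by auto
    then show ?thesis
      using B(6)[OF p' f' B(5)] cat_comp[OF cat_PSh l(1) k(1)] cat_id[OF cat_PSh P]
        cat_idr[OF cat_PSh p'] cat_idr[OF cat_PSh f'] by blast
  qed
  then have kl: "app k a (app l a z) = z" if "a \<in> Ob A" "z \<in> omap ?P a" for a z
    using app_comp[OF l(1) k(1) that] app_id[OF P that] by simp
  show "elementwise_pullback S E ?P f p f' p'"
    unfolding elementwise_pullback_def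
  proof (intro conjI ballI impI)
    fix a z assume az: "a \<in> Ob A" "z \<in> omap ?P a"
    show "app f a (app p' a z) = app p a (app f' a z)"
      using app_comp[OF p' f az] app_comp[OF f' p az] B(5) by simp
  next
    fix a x e assume a: "a \<in> Ob A" and x: "x \<in> omap S a" and e: "e \<in> omap E a"
      and xe: "app f a x = app p a e"
    obtain z where z: "z \<in> omap Q a" "app q a z = x" "app g a z = e"
      and zu: "\<And>z'. z' \<in> omap Q a \<Longrightarrow> app q a z' = x \<Longrightarrow> app g a z' = e \<Longrightarrow> z' = z"
      using el a x e xe unfolding elementwise_pullback_def by blast
    show "\<exists>!z. z \<in> omap ?P a \<and> app p' a z = x \<and> app f' a z = e"
    proof (rule ex1I[of _ "app k a z"])
      show "app k a z \<in> omap ?P a \<and> app p' a (app k a z) = x \<and> app f' a (app k a z) = e"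
        using app_in[OF k(1) a z(1)] app_comp[OF k(1) p' a z(1)] app_comp[OF k(1) f' a z(1)] k z by simp
    next
      fix w assume w: "w \<in> omap ?P a \<and> app p' a w = x \<and> app f' a w = e"
      then have "app l a w = z"
        using zu[OF app_in[OF l(1) a, of w]] app_comp[OF l(1) q a, of w] app_comp[OF l(1) g a, of w] l
          by simp
      then show "w = app k a z" using kl[OF a, of w] w by simp
    qed
  qed
qed

lemma PSh_pullbacks: "has_pullbacks PSh"
  unfolding has_pullbacks_def
proof (intro ballI impI)
  fix f p assume f: "f \<in> Mor PSh" and p: "p \<in> Mor PSh" and fp: "Tgt PSh f = Tgt PSh p"
  have h: "f \<in> hom PSh (Src PSh f) (Tgt PSh p)" "p \<in> hom PSh (Src PSh p) (Tgt PSh p)"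
    using hom_Src_Tgt[OF f] hom_Src_Tgt[OF p] fp by auto
  show "\<exists>f' p'. is_pullback PSh f p f' p'"
    using elementwise_pullback_exists[OF h] pullback_of_elementwise[OF h] by blast
qed

end

section \<open>Quotients and images of set-valued functors\<close>

context set_valued_functors
begin

text \<open>
  The elements of the quotient are equivalence classes. A class is acted on by collecting all that is
  related to the image of one of its members, which avoids choosing representatives.
\<close>

lemma quotient_exists:
  assumes S: "S \<in> Ob PSh"
    and refl: "\<And>a x. a \<in> Ob A \<Longrightarrow> x \<in> omap S a \<Longrightarrow> r a x x"
    and sym: "\<And>a x y. a \<in> Ob A \<Longrightarrow> x \<in> omap S a \<Longrightarrow> y \<in> omap S a \<Longrightarrow> r a x y \<Longrightarrow> r a y x"
    and trans: "\<And>a x y z. a \<in> Ob A \<Longrightarrow> x \<in> omap S a \<Longrightarrow> y \<in> omap S a \<Longrightarrow> z \<in> omap S a \<Longrightarrow>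
       r a x y \<Longrightarrow> r a y z \<Longrightarrow> r a x z"
    and act: "\<And>a b f x y. f \<in> hom A a b \<Longrightarrow> x \<in> omap S a \<Longrightarrow> y \<in> omap S a \<Longrightarrow> r a x y \<Longrightarrow>
       r b (act S f x) (act S f y)"
  shows "\<exists>Q q. q \<in> hom PSh S Q \<and> cw_surj A q \<and>
     (\<forall>a\<in>Ob A. \<forall>x\<in>omap S a. \<forall>y\<in>omap S a. app q a x = app q a y \<longleftrightarrow> r a x y)"
proof -
  define cl where "cl a x = {y \<in> omap S a. r a x y}" for a x
  define X where "X a = cl a ` omap S a" for a
  define \<alpha> where "\<alpha> f C = {y \<in> omap S (Tgt A f). \<exists>x\<in>C. r (Tgt A f) (act S f x) y}" for f C
  have cl_eq: "cl a x = cl a y \<longleftrightarrow> r a x y" if "a \<in> Ob A" "x \<in> omap S a" "y \<in> omap S a" for a x y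
  proof
    assume "cl a x = cl a y"
    then have "x \<in> cl a y" using refl[OF that(1,2)] that(2) by (auto simp: cl_def)
    then show "r a x y" using sym[OF that(1,3,2)] by (simp add: cl_def)
  next
    assume r: "r a x y"
    show "cl a x = cl a y"
      unfolding cl_def using trans[OF that(1,3,2) _ sym[OF that r]] trans[OF that _ r] by auto
  qed
  have \<alpha>: "\<alpha> f (cl a x) = cl b (act S f x)" if f: "f \<in> hom A a b" and x: "x \<in> omap S a" for a b f x
  proof -
    note ob = hom_obj[OF cat_A f]
    have "(\<exists>y\<in>cl a x. r b (act S f y) z) \<longleftrightarrow> r b (act S f x) z" if z: "z \<in> omap S b" for z
    proof
      assume "\<exists>y\<in>cl a x. r b (act S f y) z"
      then obtain y where y: "y \<in> omap S a" "r a x y" "r b (act S f y) z" by (auto simp: cl_def)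
      show "r b (act S f x) z"
        by (rule trans[OF ob(2) act_in[OF S f x] act_in[OF S f y(1)] z act[OF f x y(1,2)] y(3)])
    next
      assume "r b (act S f x) z"
      then show "\<exists>y\<in>cl a x. r b (act S f y) z" using refl[OF ob(1) x] x by (auto simp: cl_def)
    qed
    then show ?thesis unfolding \<alpha>_def homD(3)[OF f] by (subst (2) cl_def) blast
  qed
  have "\<exists>Q (c :: 'a \<Rightarrow> 'u set \<Rightarrow> 'u). Q \<in> Ob PSh \<and> (\<forall>a\<in>Ob A. bij_betw (c a) (X a) (omap Q a)) \<and>
     (\<forall>a b. \<forall>f\<in>hom A a b. \<forall>C\<in>X a. act Q f (c a C) = c b (\<alpha> f C))"
  proof (rule coded_functor_exists)
    fix a b e f g C assume f: "f \<in> hom A a b" and g: "g \<in> hom A b e" and "C \<in> X a"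
    then obtain x where x: "x \<in> omap S a" and C: "C = cl a x" by (auto simp: X_def)
    show "\<alpha> (g \<odot>\<^bsub>A\<^esub> f) C = \<alpha> g (\<alpha> f C)"
      using \<alpha>[OF f x] \<alpha>[OF g act_in[OF S f x]] \<alpha>[OF cat_comp[OF cat_A f g] x] act_comp[OF S f g x] C by simp
  next
    fix a b f C assume f: "f \<in> hom A a b" and "C \<in> X a"
    then show "\<alpha> f C \<in> X b" using \<alpha>[OF f] act_in[OF S f] by (auto simp: X_def)
  next
    fix a C assume a: "a \<in> Ob A" and "C \<in> X a"
    then show "\<alpha> (Idn A a) C = C" using \<alpha>[OF cat_id[OF cat_A a]] act_id[OF S a] by (auto simp: X_def)
  qed (auto simp: X_def small_image small_omap[OF S])
  then obtain Q and c :: "'a \<Rightarrow> 'u set \<Rightarrow> 'u" where Q: "Q \<in> Ob PSh"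
    and c: "\<And>a. a \<in> Ob A \<Longrightarrow> bij_betw (c a) (X a) (omap Q a)"
    and cact: "\<And>a b f C. f \<in> hom A a b \<Longrightarrow> C \<in> X a \<Longrightarrow> act Q f (c a C) = c b (\<alpha> f C)" by blast
  let ?q = "tr A S Q (\<lambda>a x. c a (cl a x))"
  have clX: "cl a x \<in> X a" if "x \<in> omap S a" for a x using that by (simp add: X_def)
  have q: "?q \<in> hom PSh S Q"
  proof (rule tr_hom[OF S Q])
    fix a x assume "a \<in> Ob A" "x \<in> omap S a"
    then show "c a (cl a x) \<in> omap Q a" using bij_betw_apply[OF c clX] by simp
  next
    fix a b f x assume f: "f \<in> hom A a b" and x: "x \<in> omap S a"
    show "c b (cl b (act S f x)) = act Q f (c a (cl a x))" using cact[OF f clX[OF x]] \<alpha>[OF f x] by simp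
  qed
  have "app ?q a ` omap S a = omap Q a" if a: "a \<in> Ob A" for a
  proof -
    have "app ?q a ` omap S a = c a ` X a" using a by (force simp: app_tr X_def)
    then show ?thesis using c[OF a] by (simp add: bij_betw_def)
  qed
  moreover have "app ?q a x = app ?q a y \<longleftrightarrow> r a x y"
    if a: "a \<in> Ob A" and x: "x \<in> omap S a" and y: "y \<in> omap S a" for a x y
    unfolding app_tr[OF a x] app_tr[OF a y] cl_eq[OF a x y, symmetric]
    using bij_betw_imp_inj_on[OF c[OF a]] inj_on_eq_iff clX[OF x] clX[OF y] by metis
  ultimately show ?thesis
    using q cw_surj_iff[OF q] by (intro exI[of _ Q] exI[of _ ?q]) simp
qed

lemma surj_preimage:
  assumes q: "q \<in> hom PSh S Q" "cw_surj A q" and a: "a \<in> Ob A" and y: "y \<in> omap Q a"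
  obtains x where "x \<in> omap S a" "app q a x = y"
proof -
  have "y \<in> app q a ` omap S a" using cw_surj_iff[OF q(1)] q(2) a y by simp
  then show thesis using that by blast
qed

text \<open>Componentwise surjections are regular epimorphisms.\<close>

lemma factor_through_surj:
  assumes q: "q \<in> hom PSh S Q" "cw_surj A q" and g: "g \<in> hom PSh S V"
    and eq: "\<And>a x y. a \<in> Ob A \<Longrightarrow> x \<in> omap S a \<Longrightarrow> y \<in> omap S a \<Longrightarrow> app q a x = app q a y \<Longrightarrow>
       app g a x = app g a y"
  shows "\<exists>u\<in>hom PSh Q V. u \<odot>\<^bsub>PSh\<^esub> q = g \<and> (\<forall>a\<in>Ob A. \<forall>x\<in>omap S a. app u a (app q a x) = app g a x)"
proof -
  define s where "s a y = (SOME x. x \<in> omap S a \<and> app q a x = y)" for a y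
  have s: "s a y \<in> omap S a" "app q a (s a y) = y" if "a \<in> Ob A" "y \<in> omap Q a" for a y
  proof -
    have "\<exists>x. x \<in> omap S a \<and> app q a x = y" using surj_preimage[OF q that] by blast
    from someI_ex[OF this] show "s a y \<in> omap S a" "app q a (s a y) = y" by (auto simp: s_def)
  qed
  let ?u = "tr A Q V (\<lambda>a y. app g a (s a y))"
  have u: "?u \<in> hom PSh Q V"
  proof (rule tr_hom[OF morphism_obj(2)[OF q(1)] morphism_obj(2)[OF g]])
    fix a y assume a: "a \<in> Ob A" "y \<in> omap Q a"
    show "app g a (s a y) \<in> omap V a" using app_in[OF g a(1) s(1)[OF a]] .
  next
    fix a b f y assume f: "f \<in> hom A a b" and y: "y \<in> omap Q a"
    note ob = hom_obj[OF cat_A f] and S = morphism_obj(1)[OF q(1)] and Q = morphism_obj(2)[OF q(1)]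
    have "app q b (s b (act Q f y)) = app q b (act S f (s a y))"
      using s[OF ob(2) act_in[OF Q f y]] s[OF ob(1) y] app_nat[OF q(1) f] by simp
    then have "app g b (s b (act Q f y)) = app g b (act S f (s a y))"
      using eq[OF ob(2) s(1)[OF ob(2) act_in[OF Q f y]] act_in[OF S f s(1)[OF ob(1) y]]] by simp
    then show "app g b (s b (act Q f y)) = act V f (app g a (s a y))"
      using app_nat[OF g f s(1)[OF ob(1) y]] by simp
  qed
  have uq: "app ?u a (app q a x) = app g a x" if a: "a \<in> Ob A" and x: "x \<in> omap S a" for a x
    using eq[OF a s(1)[OF a] x] s[OF a] app_in[OF q(1) a x] by (simp add: app_tr[OF a])
  moreover have "?u \<odot>\<^bsub>PSh\<^esub> q = g"
    by (rule morphism_ext[OF cat_comp[OF cat_PSh q(1) u] g]) (simp add: app_comp[OF q(1) u] uq)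
  ultimately show ?thesis using u by blast
qed

lemma surj_epi:
  assumes q: "q \<in> hom PSh S Q" "cw_surj A q" and u: "u \<in> hom PSh Q V" and v: "v \<in> hom PSh Q V"
    and eq: "\<And>a x. a \<in> Ob A \<Longrightarrow> x \<in> omap S a \<Longrightarrow> app u a (app q a x) = app v a (app q a x)"
  shows "u = v"
proof (rule morphism_ext[OF u v])
  fix a y assume a: "a \<in> Ob A" and y: "y \<in> omap Q a"
  show "app u a y = app v a y" using surj_preimage[OF q a y] eq[OF a] by metis
qed

text \<open>The image is obtained as the quotient by the kernel congruence.\<close>

lemma image_factorization:
  assumes f: "f \<in> hom PSh S T"
  obtains M q i where "q \<in> hom PSh S M" "cw_surj A q" "i \<in> hom PSh M T" "cw_inj A i" "i \<odot>\<^bsub>PSh\<^esub> q = f"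
proof -
  note S = morphism_obj(1)[OF f]
  have "\<exists>Q q. q \<in> hom PSh S Q \<and> cw_surj A q \<and>
     (\<forall>a\<in>Ob A. \<forall>x\<in>omap S a. \<forall>y\<in>omap S a. app q a x = app q a y \<longleftrightarrow> app f a x = app f a y)"
    by (rule quotient_exists[OF S]) (auto simp: app_nat[OF f])
  then obtain M q where q: "q \<in> hom PSh S M" "cw_surj A q"
    and qe: "\<And>a x y. a \<in> Ob A \<Longrightarrow> x \<in> omap S a \<Longrightarrow> y \<in> omap S a \<Longrightarrow> app q a x = app q a y \<longleftrightarrow> app f a x = app f a y"
    by blast
  obtain i where i: "i \<in> hom PSh M T" "i \<odot>\<^bsub>PSh\<^esub> q = f"
    and iq: "\<And>a x. a \<in> Ob A \<Longrightarrow> x \<in> omap S a \<Longrightarrow> app i a (app q a x) = app f a x"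
    using factor_through_surj[OF q f] qe by blast
  have "inj_on (app i a) (omap M a)" if a: "a \<in> Ob A" for a
  proof (rule inj_onI)
    fix u v assume "u \<in> omap M a" "v \<in> omap M a" and uv: "app i a u = app i a v"
    then obtain x y where x: "x \<in> omap S a" "app q a x = u" and y: "y \<in> omap S a" "app q a y = v"
      using surj_preimage[OF q a] by metis
    then show "u = v" using uv iq[OF a] qe[OF a] by metis
  qed
  then show thesis using that q i cw_inj_iff[OF i(1)] by blast
qed

section \<open>Effective descent morphisms of set-valued functors\<close>

text \<open>
  If \<open>p\<close> factors through an injection \<open>i\<close>, then \<open>i\<close> becomes invertible when pulled back along \<open>p\<close>.
\<close>

lemma effective_descent_surj:
  assumes p: "p \<in> hom PSh E T" and ed: "effective_descent PSh p"
  shows "cw_surj A p"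
proof -
  obtain M q i where q: "q \<in> hom PSh E M" "cw_surj A q" and i: "i \<in> hom PSh M T" "cw_inj A i"
    and iq: "i \<odot>\<^bsub>PSh\<^esub> q = p"
    using image_factorization[OF p] by metis
  have inj: "inj_on (app i a) (omap M a)" if "a \<in> Ob A" for a using that i cw_inj_iff by blast
  have "is_iso PSh f'" if "is_pullback PSh i p f' p'" for f' p'
  proof -
    note el = elementwise_of_pullback[OF that i(1) p]
    let ?P = "Src PSh f'"
    have ex: "\<exists>!z. z \<in> omap ?P a \<and> app f' a z = e" if a: "a \<in> Ob A" and e: "e \<in> omap E a" for a e
    proof -
      have ie: "app i a (app q a e) = app p a e" using app_comp[OF q(1) i(1) a e] iq by simp
      obtain z where z: "z \<in> omap ?P a" "app p' a z = app q a e" "app f' a z = e"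
        and zu: "\<And>z'. z' \<in> omap ?P a \<Longrightarrow> app p' a z' = app q a e \<Longrightarrow> app f' a z' = e \<Longrightarrow> z' = z"
        using el(3) a e app_in[OF q(1) a e] ie unfolding elementwise_pullback_def by metis
      have "z' = z" if z': "z' \<in> omap ?P a" "app f' a z' = e" for z'
      proof (rule zu[OF z'(1) _ z'(2)])
        have "app i a (app p' a z') = app i a (app q a e)"
          using el(3) a z' ie unfolding elementwise_pullback_def by metis
        then show "app p' a z' = app q a e"
          using inj_onD[OF inj[OF a]] app_in[OF el(2) a z'(1)] app_in[OF q(1) a e] by blast
      qed
      then show ?thesis using z by blast
    qed
    have "bij_betw (app f' a) (omap ?P a) (omap E a)" if a: "a \<in> Ob A" for a
      unfolding bij_betw_def
    proof
      show "inj_on (app f' a) (omap ?P a)"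
        using ex[OF a] app_in[OF el(1) a] by (metis (no_types, lifting) inj_onI)
      show "app f' a ` omap ?P a = omap E a"
        using ex[OF a] app_in[OF el(1) a] by blast
    qed
    then show ?thesis using iso_iff_bij[OF el(1)] by blast
  qed
  then have "is_iso PSh i"
    using effective_descent_reflects_iso[OF cat_PSh ed homD(1)[OF i(1)]] homD(3)[OF i(1)] homD(3)[OF p]
      by simp
  then have bij: "bij_betw (app i a) (omap M a) (omap T a)" if "a \<in> Ob A" for a
    using that iso_iff_bij[OF i(1)] by blast
  have "app p a ` omap E a = omap T a" if a: "a \<in> Ob A" for a
  proof -
    have "app p a e = app i a (app q a e)" if "e \<in> omap E a" for e
      using app_comp[OF q(1) i(1) a that] iq by simp
    then have "app p a ` omap E a = app i a ` app q a ` omap E a" by force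
    also have "\<dots> = omap T a" using bij[OF a] q a cw_surj_iff[OF q(1)] by (simp add: bij_betw_def)
    finally show ?thesis .
  qed
  then show ?thesis using cw_surj_iff[OF p] by blast
qed

end

text \<open>
  For the converse, algebras for the monad of \<open>p\<close> are morphisms \<open>q : X \<rightarrow> E\<close> in which an
  element \<open>x\<close> over \<open>q x\<close> can be transported to any \<open>e\<close> with \<open>p e = p (q x)\<close>. The locale fixes a pullback
  functor \<open>G\<close> along a surjection, presented as a right adjoint, with \<open>\<pi> f\<close> the projection of the
  pullback of \<open>f\<close> to the domain of \<open>f\<close>.
\<close>

locale surjective_base = set_valued_functors A U
  for A :: "('a, 'f) cat" and U :: "'u itself" +
  fixes E T and p :: "('a, 'f, 'u set, 'u smap) ntrans" and G \<eta> \<pi>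
  assumes p: "p \<in> hom PSh E T" and p_surj: "cw_surj A p"
    and adj: "adjunction (slice PSh E) (slice PSh T) (postcomp PSh p) G \<eta> (\<lambda>f. (p \<odot>\<^bsub>PSh\<^esub> omap G f, f, \<pi> f))"
    and pb: "\<And>f. f \<in> Ob (slice PSh T) \<Longrightarrow> is_pullback PSh f p (omap G f) (\<pi> f)"
    and nat: "\<And>f g u. (f, g, u) \<in> hom (slice PSh T) f g \<Longrightarrow>
       \<pi> g \<odot>\<^bsub>PSh\<^esub> datum (amap G (f, g, u)) = u \<odot>\<^bsub>PSh\<^esub> \<pi> f"
begin

abbreviation SE where "SE \<equiv> slice PSh E"
abbreviation ST where "ST \<equiv> slice PSh T"
abbreviation eps where "eps f \<equiv> (p \<odot>\<^bsub>PSh\<^esub> omap G f, f, \<pi> f)"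
abbreviation Pb where "Pb f \<equiv> Src PSh (omap G f)"
abbreviation Gm where "Gm f g u \<equiv> datum (amap G (f, g, u))"
abbreviation Alg where
  "Alg \<equiv> EM SE (G \<circ>\<^sub>F postcomp PSh p) \<eta> (\<lambda>q. amap G (eps (omap (postcomp PSh p) q)))"
abbreviation Comparison where "Comparison \<equiv> EM_comparison ST G eps"

lemma ST_Ob: "f \<in> hom PSh X T \<Longrightarrow> f \<in> Ob ST \<and> Src PSh f = X"
  by (simp add: slice_Ob hom_def)

lemma ST_ObD: "f \<in> Ob ST \<Longrightarrow> f \<in> hom PSh (Src PSh f) T"
  by (simp add: slice_Ob hom_def)

lemma SE_ObD: "q \<in> Ob SE \<Longrightarrow> q \<in> hom PSh (Src PSh q) E"
  by (simp add: slice_Ob hom_def)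

lemma G_functor: "is_functor ST SE G"
  using adjunctionD(2)[OF adj] .

lemma monad_functor: "is_functor SE SE (G \<circ>\<^sub>F postcomp PSh p)"
  using comp_functor[OF adjunctionD(1)[OF adj] G_functor] .

context
  fixes f assumes f: "f \<in> Ob ST"
begin

lemma G_hom: "omap G f \<in> hom PSh (Pb f) E" and \<pi>_hom: "\<pi> f \<in> hom PSh (Pb f) (Src PSh f)"
  using elementwise_of_pullback(1,2)[OF pb[OF f] ST_ObD[OF f] p] .

lemma pb_square: "a \<in> Ob A \<Longrightarrow> z \<in> omap (Pb f) a \<Longrightarrow> app f a (app (\<pi> f) a z) = app p a (app (omap G f) a z)"
  using elementwise_of_pullback(3)[OF pb[OF f] ST_ObD[OF f] p] by (simp add: elementwise_pullback_def)

lemma pb_ex1: "a \<in> Ob A \<Longrightarrow> y \<in> omap (Src PSh f) a \<Longrightarrow> e \<in> omap E a \<Longrightarrow> app f a y = app p a e \<Longrightarrow>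
    \<exists>!z. z \<in> omap (Pb f) a \<and> app (\<pi> f) a z = y \<and> app (omap G f) a z = e"
  using elementwise_of_pullback(3)[OF pb[OF f] ST_ObD[OF f] p] by (simp add: elementwise_pullback_def)

lemma pb_eqI:
  assumes a: "a \<in> Ob A" and z: "z \<in> omap (Pb f) a" and w: "w \<in> omap (Pb f) a"
    and eq: "app (\<pi> f) a z = app (\<pi> f) a w" "app (omap G f) a z = app (omap G f) a w"
  shows "z = w"
  using pb_ex1[OF a app_in[OF \<pi>_hom a z] app_in[OF G_hom a z] pb_square[OF a z]] z w eq by metis

definition pair where
  "pair a y e = (THE z. z \<in> omap (Pb f) a \<and> app (\<pi> f) a z = y \<and> app (omap G f) a z = e)"

lemma pair:
  assumes "a \<in> Ob A" "y \<in> omap (Src PSh f) a" "e \<in> omap E a" "app f a y = app p a e"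
  shows "pair a y e \<in> omap (Pb f) a" "app (\<pi> f) a (pair a y e) = y" "app (omap G f) a (pair a y e) = e"
  using theI'[OF pb_ex1[OF assms]] by (auto simp: pair_def)

lemma pb_elem:
  assumes a: "a \<in> Ob A" and z: "z \<in> omap (Pb f) a"
  shows "pair a (app (\<pi> f) a z) (app (omap G f) a z) = z"
  by (rule pb_eqI[OF a]) (use pair[OF a app_in[OF \<pi>_hom a z] app_in[OF G_hom a z] pb_square[OF a z]] z in
    auto)

lemma \<pi>_surj: "cw_surj A (\<pi> f)"
proof -
  have "\<exists>z\<in>omap (Pb f) a. app (\<pi> f) a z = y" if a: "a \<in> Ob A" and y: "y \<in> omap (Src PSh f) a" for a y
  proof -
    obtain e where "e \<in> omap E a" "app p a e = app f a y"
      using surj_preimage[OF p p_surj a app_in[OF ST_ObD[OF f] a y]] by metis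
    then show ?thesis using pair[OF a y] by metis
  qed
  then show ?thesis using cw_surj_iff[OF \<pi>_hom] app_in[OF \<pi>_hom] by blast
qed

end

lemma G_mor:
  assumes k: "(f, g, u) \<in> hom ST f g"
  shows "amap G (f, g, u) = (omap G f, omap G g, Gm f g u)" "Gm f g u \<in> hom PSh (Pb f) (Pb g)"
    "\<And>a z. a \<in> Ob A \<Longrightarrow> z \<in> omap (Pb f) a \<Longrightarrow> app (omap G g) a (app (Gm f g u) a z) = app (omap G f) a z"
    "\<And>a z. a \<in> Ob A \<Longrightarrow> z \<in> omap (Pb f) a \<Longrightarrow> app (\<pi> g) a (app (Gm f g u) a z) = app u a (app (\<pi> f) a z)"
proof -
  note ob = hom_obj[OF slice_category[OF cat_PSh] k]
  obtain v where v: "amap G (f, g, u) = (omap G f, omap G g, v)" "v \<in> hom PSh (Pb f) (Pb g)"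
    "omap G g \<odot>\<^bsub>PSh\<^esub> v = omap G f"
    using functor_hom[OF G_functor k] by (auto elim!: slice_homE)
  then show 1: "amap G (f, g, u) = (omap G f, omap G g, Gm f g u)" and 2: "Gm f g u \<in> hom PSh (Pb f) (Pb g)"
    by auto
  have u: "u \<in> hom PSh (Src PSh f) (Src PSh g)" using k by (auto elim!: slice_homE)
  fix a z assume a: "a \<in> Ob A" and z: "z \<in> omap (Pb f) a"
  show "app (omap G g) a (app (Gm f g u) a z) = app (omap G f) a z"
    using app_comp[OF v(2) G_hom[OF ob(2)] a z] v(1,3) by simp
  show "app (\<pi> g) a (app (Gm f g u) a z) = app u a (app (\<pi> f) a z)"
    using app_comp[OF 2 \<pi>_hom[OF ob(2)] a z] app_comp[OF \<pi>_hom[OF ob(1)] u a z] nat[OF k] by simp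
qed

lemma Cmp_G_mor:
  assumes k: "(f, g, u) \<in> hom ST f g"
  shows "(x, r, v) \<odot>\<^bsub>SE\<^esub> amap G (f, g, u) = (omap G f, r, v \<odot>\<^bsub>PSh\<^esub> Gm f g u)"
  by (subst G_mor(1)[OF k]) (rule slice_Cmp)

lemma G_mor_Cmp_G_mor:
  assumes k: "(f, g, u) \<in> hom ST f g" and l: "(g', h, v) \<in> hom ST g' h"
  shows "amap G (g', h, v) \<odot>\<^bsub>SE\<^esub> amap G (f, g, u) = (omap G f, omap G h, Gm g' h v \<odot>\<^bsub>PSh\<^esub> Gm f g u)"
  by (subst G_mor(1)[OF k], subst G_mor(1)[OF l]) (rule slice_Cmp)

lemma eps_hom: "f \<in> Ob ST \<Longrightarrow> eps f \<in> hom ST (p \<odot>\<^bsub>PSh\<^esub> omap G f) f"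
  using nat_trans_hom[OF adjunctionD(4)[OF adj]] by (simp add: postcomp_def)

lemma postcomp_Ob:
  assumes q: "q \<in> hom PSh X E"
  shows "p \<odot>\<^bsub>PSh\<^esub> q \<in> Ob ST" "Src PSh (p \<odot>\<^bsub>PSh\<^esub> q) = X"
  using ST_Ob[OF cat_comp[OF cat_PSh q p]] by auto

lemma postcomp_mor:
  assumes "(q, q', u) \<in> hom SE q q'"
  shows "(p \<odot>\<^bsub>PSh\<^esub> q, p \<odot>\<^bsub>PSh\<^esub> q', u) \<in> hom ST (p \<odot>\<^bsub>PSh\<^esub> q) (p \<odot>\<^bsub>PSh\<^esub> q')"
  using functor_hom[OF adjunctionD(1)[OF adj] assms] by (simp add: postcomp_def)

text \<open>
  As \<open>p\<close> is surjective, so are its pullbacks \<open>\<pi> f\<close>. A morphism over \<open>T\<close> is therefore determined by its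
  pullback, and a morphism of pullbacks comes from one over \<open>T\<close> when it respects the fibres of \<open>\<pi> f\<close>.
\<close>

lemma comparison_fully_faithful:
  assumes f: "f \<in> Ob ST" and g: "g \<in> Ob ST" and k: "k \<in> hom Alg (omap Comparison f) (omap Comparison g)"
  shows "\<exists>!u. u \<in> hom ST f g \<and> amap Comparison u = k"
proof -
  let ?Gf = "omap G f" and ?Gg = "omap G g"
  let ?mf = "Gm (p \<odot>\<^bsub>PSh\<^esub> ?Gf) f (\<pi> f)" and ?mg = "Gm (p \<odot>\<^bsub>PSh\<^esub> ?Gg) g (\<pi> g)"
  note Gf = G_hom[OF f] and Gg = G_hom[OF g] and \<pi>f = \<pi>_hom[OF f] and \<pi>g = \<pi>_hom[OF g]
  obtain s where k_eq: "k = (omap Comparison f, omap Comparison g, s)" and s: "s \<in> hom SE ?Gf ?Gg"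
    and alg: "s \<odot>\<^bsub>SE\<^esub> amap G (eps f) = amap G (eps g) \<odot>\<^bsub>SE\<^esub> amap (G \<circ>\<^sub>F postcomp PSh p) s"
    using k by (auto simp: EM_comparison_def EM_hom)
  obtain \<kappa> where s_eq: "s = (?Gf, ?Gg, \<kappa>)" and \<kappa>: "\<kappa> \<in> hom PSh (Pb f) (Pb g)" and G\<kappa>: "?Gg \<odot>\<^bsub>PSh\<^esub> \<kappa> = ?Gf"
    using s by (elim slice_homE)
  have G\<kappa>: "app ?Gg a (app \<kappa> a z) = app ?Gf a z" if "a \<in> Ob A" "z \<in> omap (Pb f) a" for a z
    using app_comp[OF \<kappa> Gg that] G\<kappa> by simp
  let ?k' = "Gm (p \<odot>\<^bsub>PSh\<^esub> ?Gf) (p \<odot>\<^bsub>PSh\<^esub> ?Gg) \<kappa>"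
  note K = postcomp_mor[OF s[unfolded s_eq]]
  note ef = eps_hom[OF f] and eg = eps_hom[OF g]
  note pf = postcomp_Ob[OF Gf] and pg = postcomp_Ob[OF Gg]
  have "\<kappa> \<odot>\<^bsub>PSh\<^esub> ?mf = ?mg \<odot>\<^bsub>PSh\<^esub> ?k'"
    using alg Cmp_G_mor[OF ef] G_mor_Cmp_G_mor[OF K eg] by (simp add: s_eq postcomp_def)
  then have alg_el: "app \<kappa> a (app ?mf a w) = app ?mg a (app ?k' a w)"
    if "a \<in> Ob A" "w \<in> omap (Pb (p \<odot>\<^bsub>PSh\<^esub> ?Gf)) a" for a w
    using app_comp[OF G_mor(2)[OF ef] \<kappa> that] app_comp[OF G_mor(2)[OF K] G_mor(2)[OF eg] that] by simp
  \<comment> \<open>An algebra morphism is constant along the fibres of \<open>\<pi> f\<close>, so it descends.\<close>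
  have const: "app (\<pi> g) a (app \<kappa> a z) = app (\<pi> g) a (app \<kappa> a w)"
    if a: "a \<in> Ob A" and z: "z \<in> omap (Pb f) a" and w: "w \<in> omap (Pb f) a"
      and zw: "app (\<pi> f) a z = app (\<pi> f) a w" for a z w
  proof -
    let ?e = "app ?Gf a w"
    have e: "?e \<in> omap E a" using app_in[OF Gf a w] .
    have pe: "app (p \<odot>\<^bsub>PSh\<^esub> ?Gf) a z = app p a ?e"
      using app_comp[OF Gf p a z] pb_square[OF f a z] pb_square[OF f a w] zw by simp
    let ?t = "pair (p \<odot>\<^bsub>PSh\<^esub> ?Gf) a z ?e"
    have t: "?t \<in> omap (Pb (p \<odot>\<^bsub>PSh\<^esub> ?Gf)) a" "app (\<pi> (p \<odot>\<^bsub>PSh\<^esub> ?Gf)) a ?t = z"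
      "app (omap G (p \<odot>\<^bsub>PSh\<^esub> ?Gf)) a ?t = ?e"
      using pair[OF pf(1) a _ e pe] z pf(2) by auto
    have "app ?mf a ?t = w"
      by (rule pb_eqI[OF f a app_in[OF G_mor(2)[OF ef] a t(1)] w])
        (use G_mor(3,4)[OF ef a t(1)] t zw in auto)
    then have "app (\<pi> g) a (app \<kappa> a w) = app (\<pi> g) a (app ?mg a (app ?k' a ?t))"
      using alg_el[OF a t(1)] by simp
    also have "\<dots> = app (\<pi> g) a (app \<kappa> a z)"
      using G_mor(4)[OF eg a app_in[OF G_mor(2)[OF K] a t(1)]] G_mor(4)[OF K a t(1)] t(2) by simp
    finally show ?thesis by simp
  qed
  have "app (\<pi> g \<odot>\<^bsub>PSh\<^esub> \<kappa>) a z = app (\<pi> g \<odot>\<^bsub>PSh\<^esub> \<kappa>) a w"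
    if "a \<in> Ob A" "z \<in> omap (Pb f) a" "w \<in> omap (Pb f) a" "app (\<pi> f) a z = app (\<pi> f) a w" for a z w
    using const[OF that] app_comp[OF \<kappa> \<pi>g] that by simp
  from factor_through_surj[OF \<pi>f \<pi>_surj[OF f] cat_comp[OF cat_PSh \<kappa> \<pi>g] this]
  obtain u where u: "u \<in> hom PSh (Src PSh f) (Src PSh g)"
    and u\<pi>: "\<And>a z. a \<in> Ob A \<Longrightarrow> z \<in> omap (Pb f) a \<Longrightarrow> app u a (app (\<pi> f) a z) = app (\<pi> g \<odot>\<^bsub>PSh\<^esub> \<kappa>) a z"
    by blast
  then have u\<pi>: "app u a (app (\<pi> f) a z) = app (\<pi> g) a (app \<kappa> a z)" if "a \<in> Ob A" "z \<in> omap (Pb f) a"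
    for a z
    using that app_comp[OF \<kappa> \<pi>g] by simp
  have "g \<odot>\<^bsub>PSh\<^esub> u = f"
  proof (rule surj_epi[OF \<pi>f \<pi>_surj[OF f] cat_comp[OF cat_PSh u ST_ObD[OF g]] ST_ObD[OF f]])
    fix a z assume a: "a \<in> Ob A" and z: "z \<in> omap (Pb f) a"
    show "app (g \<odot>\<^bsub>PSh\<^esub> u) a (app (\<pi> f) a z) = app f a (app (\<pi> f) a z)"
      using app_comp[OF u ST_ObD[OF g] a app_in[OF \<pi>f a z]] u\<pi>[OF a z] pb_square[OF f a z]
        pb_square[OF g a app_in[OF \<kappa> a z]] G\<kappa>[OF a z] by simp
  qed
  then have U: "(f, g, u) \<in> hom ST f g" by (rule slice_homI[OF ST_ObD[OF f] ST_ObD[OF g] u])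
  have "Gm f g u = \<kappa>"
  proof (rule morphism_ext[OF G_mor(2)[OF U] \<kappa>])
    fix a z assume a: "a \<in> Ob A" and z: "z \<in> omap (Pb f) a"
    show "app (Gm f g u) a z = app \<kappa> a z"
      by (rule pb_eqI[OF g a app_in[OF G_mor(2)[OF U] a z] app_in[OF \<kappa> a z]])
        (use G_mor(3,4)[OF U a z] G\<kappa>[OF a z] u\<pi>[OF a z] in auto)
  qed
  then have "amap Comparison (f, g, u) = k"
    using G_mor(1)[OF U] homD(2,3)[OF U] by (simp add: EM_comparison_def k_eq s_eq)
  moreover have "v = (f, g, u)" if v: "v \<in> hom ST f g" "amap Comparison v = k" for v
  proof -
    obtain v' where v': "v = (f, g, v')" "v' \<in> hom PSh (Src PSh f) (Src PSh g)" using v(1)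
      by (elim slice_homE)
    note V = v(1)[unfolded v'(1)]
    have "Gm f g v' = \<kappa>" using v(2) G_mor(1)[OF V] homD(2,3)[OF V]
      by (simp add: EM_comparison_def k_eq s_eq v')
    then have "app v' a (app (\<pi> f) a z) = app u a (app (\<pi> f) a z)" if "a \<in> Ob A" "z \<in> omap (Pb f) a" for a z
      using G_mor(4)[OF V that] u\<pi>[OF that] by simp
    then have "v' = u" using surj_epi[OF \<pi>f \<pi>_surj[OF f] v'(2) u] by blast
    then show ?thesis using v'(1) by simp
  qed
  ultimately show ?thesis using U by blast
qed

text \<open>
  An algebra descends to the quotient of \<open>X\<close> that identifies \<open>x\<close> with all its transports. The relation
  is phrased by comparing transports to every \<open>e\<close>, which makes it an equivalence at once.
\<close>

lemma comparison_essentially_surjective: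
  assumes d: "d \<in> Ob Alg"
  shows "\<exists>f\<in>Ob ST. \<exists>i\<in>hom Alg (omap Comparison f) d. is_iso Alg i"
proof -
  obtain q al where d_eq: "d = (q, al)" by (cases d)
  let ?f = "p \<odot>\<^bsub>PSh\<^esub> q" and ?X = "Src PSh q"
  have qO: "q \<in> Ob SE" and al: "al \<in> hom SE (omap G ?f) q" and unit: "al \<odot>\<^bsub>SE\<^esub> \<eta> q = Idn SE q"
    and assoc: "al \<odot>\<^bsub>SE\<^esub> amap G (eps ?f) = al \<odot>\<^bsub>SE\<^esub> amap (G \<circ>\<^sub>F postcomp PSh p) al"
    using d by (auto simp: d_eq EM_Ob postcomp_def)
  note q = SE_ObD[OF qO] and X = morphism_obj(1)[OF SE_ObD[OF qO]]
  note f = postcomp_Ob[OF q]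
  note Gf = G_hom[OF f(1)] and \<pi>f = \<pi>_hom[OF f(1), unfolded f(2)]
  have fx: "app ?f a x = app p a (app q a x)" if "a \<in> Ob A" "x \<in> omap ?X a" for a x
    using app_comp[OF q p that] .
  note pr = pair[OF f(1), unfolded f(2)]
  obtain \<alpha> where al_eq: "al = (omap G ?f, q, \<alpha>)" and \<alpha>: "\<alpha> \<in> hom PSh (Pb ?f) ?X"
    and q\<alpha>: "q \<odot>\<^bsub>PSh\<^esub> \<alpha> = omap G ?f"
    using al by (elim slice_homE)
  \<comment> \<open>The transport of \<open>x\<close> to \<open>e\<close>; the algebra laws become \<open>\<beta>_unit\<close> and \<open>\<beta>_assoc\<close>.\<close>
  define \<beta> where "\<beta> a e x = app \<alpha> a (pair ?f a x e)" for a e x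
  have \<beta>_in: "\<beta> a e x \<in> omap ?X a" and q\<beta>: "app q a (\<beta> a e x) = e"
    if "a \<in> Ob A" "x \<in> omap ?X a" "e \<in> omap E a" "app p a (app q a x) = app p a e" for a e x
    using pr[OF that(1-3)] that app_in[OF \<alpha>] fx[OF that(1,2)] app_comp[OF \<alpha> q that(1)] q\<alpha>
      by (auto simp: \<beta>_def)
  have \<beta>_act: "act ?X h (\<beta> a e x) = \<beta> b (act E h e) (act ?X h x)"
    if h: "h \<in> hom A a b" and x: "x \<in> omap ?X a" and e: "e \<in> omap E a"
      and pe: "app p a (app q a x) = app p a e" for a b h e x
  proof -
    note ob = hom_obj[OF cat_A h] and E = morphism_obj(2)[OF q] and P = morphism_obj(1)[OF Gf]
    note z = pr[OF ob(1) x e] fx[OF ob(1) x]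
    have hx: "app ?f b (act ?X h x) = app p b (act E h e)"
      using fx[OF ob(2) act_in[OF X h x]] app_nat[OF q h x] app_nat[OF p h app_in[OF q ob(1) x]] app_nat[OF
        p h e] pe by simp
    note w = pr[OF ob(2) act_in[OF X h x] act_in[OF E h e] hx]
    have "act (Pb ?f) h (pair ?f a x e) = pair ?f b (act ?X h x) (act E h e)"
      by (rule pb_eqI[OF f(1) ob(2) act_in[OF P h] w(1)])
        (use z w pe app_nat[OF \<pi>f h] app_nat[OF Gf h] in auto)
    then show ?thesis using app_nat[OF \<alpha> h, of "pair ?f a x e"] z pe by (simp add: \<beta>_def)
  qed
  have \<beta>_unit: "\<beta> a (app q a x) x = x" if a: "a \<in> Ob A" and x: "x \<in> omap ?X a" for a x
  proof -
    obtain n where n: "\<eta> q = (q, omap G ?f, n)" "n \<in> hom PSh ?X (Pb ?f)" "omap G ?f \<odot>\<^bsub>PSh\<^esub> n = q"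
      using nat_trans_hom[OF adjunctionD(3)[OF adj] qO] by (auto simp: postcomp_def elim!: slice_homE)
    have "\<pi> ?f \<odot>\<^bsub>PSh\<^esub> n = Idn PSh ?X"
      using adjunctionD(5)[OF adj qO] f(2) by (simp add: n postcomp_def slice_Cmp slice_Idn)
    then have "app (\<pi> ?f) a (app n a x) = x" "app (omap G ?f) a (app n a x) = app q a x"
      using app_comp[OF n(2) \<pi>f a x] app_comp[OF n(2) Gf a x] app_id[OF X a x] n(3) by auto
    then have "pair ?f a x (app q a x) = app n a x"
      using pb_elem[OF f(1) a app_in[OF n(2) a x]] by simp
    moreover have "\<alpha> \<odot>\<^bsub>PSh\<^esub> n = Idn PSh ?X" using unit by (simp add: al_eq n slice_Cmp slice_Idn)
    ultimately show ?thesis using app_comp[OF n(2) \<alpha> a x] app_id[OF X a x] by (simp add: \<beta>_def)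
  qed
  have GfO: "omap G ?f \<in> Ob SE" using functor_obj[OF G_functor f(1)] .
  note ff = postcomp_Ob[OF Gf] and ef = eps_hom[OF f(1)]
  note K = postcomp_mor[OF al[unfolded al_eq]]
  let ?m = "Gm (p \<odot>\<^bsub>PSh\<^esub> omap G ?f) ?f (\<pi> ?f)" and ?k = "Gm (p \<odot>\<^bsub>PSh\<^esub> omap G ?f) ?f \<alpha>"
  have assoc': "app \<alpha> a (app ?m a t) = app \<alpha> a (app ?k a t)"
    if "a \<in> Ob A" "t \<in> omap (Pb (p \<odot>\<^bsub>PSh\<^esub> omap G ?f)) a" for a t
  proof -
    have "\<alpha> \<odot>\<^bsub>PSh\<^esub> ?m = \<alpha> \<odot>\<^bsub>PSh\<^esub> ?k"
      using assoc Cmp_G_mor[OF ef] Cmp_G_mor[OF K] by (simp add: al_eq postcomp_def)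
    then show ?thesis using app_comp[OF G_mor(2)[OF ef] \<alpha> that] app_comp[OF G_mor(2)[OF K] \<alpha> that] by simp
  qed
  have \<beta>_assoc: "\<beta> a e (\<beta> a e' x) = \<beta> a e x"
    if a: "a \<in> Ob A" and x: "x \<in> omap ?X a" and e: "e \<in> omap E a" and e': "e' \<in> omap E a"
      and pe: "app p a (app q a x) = app p a e" and pe': "app p a (app q a x) = app p a e'" for a e e' x
  proof -
    let ?z = "pair ?f a x e'" and ?g = "p \<odot>\<^bsub>PSh\<^esub> omap G ?f"
    note z = pr[OF a x e'] fx[OF a x]
    have ze: "app ?g a ?z = app p a e" using app_comp[OF Gf p a] z pe pe' by simp
    let ?t = "pair ?g a ?z e"
    have t: "?t \<in> omap (Pb ?g) a" "app (\<pi> ?g) a ?t = ?z" "app (omap G ?g) a ?t = e"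
      using pair[OF ff(1) a _ e ze] z pe' ff(2) by auto
    have "app ?m a ?t = pair ?f a x e"
      by (rule pb_eqI[OF f(1) a app_in[OF G_mor(2)[OF ef] a t(1)]])
        (use pr[OF a x e] z G_mor(3,4)[OF ef a t(1)] t pe pe' in auto)
    moreover have "app ?k a ?t = pair ?f a (app \<alpha> a ?z) e"
      by (rule pb_eqI[OF f(1) a app_in[OF G_mor(2)[OF K] a t(1)]])
        (use pr[OF a _ e, of "app \<alpha> a ?z"] \<beta>_in[OF a x e' pe'] q\<beta>[OF a x e' pe'] fx[OF a, of "app \<alpha> a ?z"]
           G_mor(3,4)[OF K a t(1)] t pe pe' in \<open>auto simp: \<beta>_def\<close>)
    ultimately show ?thesis using assoc'[OF a t(1)] by (simp add: \<beta>_def)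
  qed
  define r where "r a x y \<longleftrightarrow> app p a (app q a x) = app p a (app q a y) \<and>
     (\<forall>e\<in>omap E a. app p a (app q a x) = app p a e \<longrightarrow> \<beta> a e x = \<beta> a e y)" for a x y
  have "\<exists>Y c. c \<in> hom PSh ?X Y \<and> cw_surj A c \<and>
     (\<forall>a\<in>Ob A. \<forall>x\<in>omap ?X a. \<forall>y\<in>omap ?X a. app c a x = app c a y \<longleftrightarrow> r a x y)"
  proof (rule quotient_exists[OF X])
    fix a b h x y assume h: "h \<in> hom A a b" and x: "x \<in> omap ?X a" and y: "y \<in> omap ?X a" and r: "r a x y"
    note ob = hom_obj[OF cat_A h] and E = morphism_obj(2)[OF q]
    note hx = act_in[OF X h x] and hy = act_in[OF X h y]
    have pq: "app p b (app q b (act ?X h v)) = act T h (app p a (app q a v))" if "v \<in> omap ?X a" for v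
      using app_nat[OF q h that] app_nat[OF p h app_in[OF q ob(1) that]] by simp
    have pxy: "app p a (app q a x) = app p a (app q a y)" using r by (simp add: r_def)
    show "r b (act ?X h x) (act ?X h y)"
      unfolding r_def
    proof (intro conjI ballI impI)
      show 1: "app p b (app q b (act ?X h x)) = app p b (app q b (act ?X h y))" using pq x y pxy by simp
      fix e assume e: "e \<in> omap E b" and pe: "app p b (app q b (act ?X h x)) = app p b e"
      \<comment> \<open>\<open>e\<close> need not come from \<open>a\<close>, so the transport to \<open>e\<close> is routed through \<open>q y\<close>, which does.\<close>
      let ?e = "app q a y"
      have qy: "?e \<in> omap E a" using app_in[OF q ob(1) y] .
      have "act ?X h (\<beta> a ?e v) = \<beta> b (act E h ?e) (act ?X h v)" if "v = x \<or> v = y" for v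
        using \<beta>_act[OF h _ qy, of v] x y pxy that by auto
      moreover have "\<beta> a ?e x = \<beta> a ?e y" using r qy pxy by (simp add: r_def)
      ultimately have "\<beta> b (act E h ?e) (act ?X h x) = \<beta> b (act E h ?e) (act ?X h y)" by metis
      moreover have "\<beta> b e (\<beta> b (act E h ?e) (act ?X h v)) = \<beta> b e (act ?X h v)" if "v = x \<or> v = y" for v
        using that \<beta>_assoc[OF ob(2) _ e act_in[OF E h qy], of "act ?X h v"] hx hy pe 1 app_nat[OF q h y]
          by auto
      ultimately show "\<beta> b e (act ?X h x) = \<beta> b e (act ?X h y)" by metis
    qed
  qed (auto simp: r_def)
  then obtain Y c where c: "c \<in> hom PSh ?X Y" "cw_surj A c"
    and ceq: "\<And>a x y. a \<in> Ob A \<Longrightarrow> x \<in> omap ?X a \<Longrightarrow> y \<in> omap ?X a \<Longrightarrow> app c a x = app c a y \<longleftrightarrow> r a x y"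
    by blast
  obtain t where t: "t \<in> hom PSh Y T" "t \<odot>\<^bsub>PSh\<^esub> c = ?f"
    and tc: "\<And>a x. a \<in> Ob A \<Longrightarrow> x \<in> omap ?X a \<Longrightarrow> app t a (app c a x) = app ?f a x"
  proof -
    have "app ?f a x = app ?f a y"
      if "a \<in> Ob A" "x \<in> omap ?X a" "y \<in> omap ?X a" "app c a x = app c a y" for a x y
      using that ceq fx by (simp add: r_def)
    from factor_through_surj[OF c cat_comp[OF cat_PSh q p] this] show thesis using that by blast
  qed
  have tO: "t \<in> Ob ST" "Src PSh t = Y" using ST_Ob[OF t(1)] by auto
  note Gt = G_hom[OF tO(1)] and \<pi>t = \<pi>_hom[OF tO(1), unfolded tO(2)]
  obtain \<phi> where \<phi>: "\<phi> \<in> hom PSh ?X (Pb t)" "\<pi> t \<odot>\<^bsub>PSh\<^esub> \<phi> = c" "omap G t \<odot>\<^bsub>PSh\<^esub> \<phi> = q"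
    using is_pullbackD(6)[OF pb[OF tO(1)], of c ?X q] c(1) q t(2) homD(2)[OF p] tO(2) by auto
  have \<phi>el: "app (\<pi> t) a (app \<phi> a x) = app c a x" "app (omap G t) a (app \<phi> a x) = app q a x"
    if "a \<in> Ob A" "x \<in> omap ?X a" for a x
    using app_comp[OF \<phi>(1) \<pi>t that] app_comp[OF \<phi>(1) Gt that] \<phi> by auto
  have c\<beta>: "app c a (\<beta> a e x) = app c a x"
    if a: "a \<in> Ob A" and x: "x \<in> omap ?X a" and e: "e \<in> omap E a" and pe: "app p a (app q a x) = app p a e"
      for a e x
    unfolding ceq[OF a \<beta>_in[OF a x e pe] x] r_def using q\<beta>[OF a x e pe] \<beta>_assoc[OF a x _ e _ pe] pe by auto
  have "bij_betw (app \<phi> a) (omap ?X a) (omap (Pb t) a)" if a: "a \<in> Ob A" for a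
    unfolding bij_betw_def
  proof
    show "inj_on (app \<phi> a) (omap ?X a)"
    proof (rule inj_onI)
      fix x y assume x: "x \<in> omap ?X a" and y: "y \<in> omap ?X a" and xy: "app \<phi> a x = app \<phi> a y"
      have "r a x y" and qxy: "app q a x = app q a y" using \<phi>el[OF a] x y xy ceq[OF a x y] by metis+
      then have "\<beta> a (app q a x) x = \<beta> a (app q a y) y"
        using app_in[OF q a x] by (simp add: r_def)
      then show "x = y" using \<beta>_unit[OF a] x y by simp
    qed
    have "\<exists>x\<in>omap ?X a. app \<phi> a x = z" if z: "z \<in> omap (Pb t) a" for z
    proof -
      obtain x where x: "x \<in> omap ?X a" "app c a x = app (\<pi> t) a z"
        using surj_preimage[OF c a app_in[OF \<pi>t a z]] .
      let ?e = "app (omap G t) a z"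
      have e: "?e \<in> omap E a" using app_in[OF Gt a z] .
      have pe: "app p a (app q a x) = app p a ?e"
        using tc[OF a x(1)] pb_square[OF tO(1) a z] fx[OF a x(1)] x(2) by simp
      note b = \<beta>_in[OF a x(1) e pe]
      have "app \<phi> a (\<beta> a ?e x) = z"
        by (rule pb_eqI[OF tO(1) a app_in[OF \<phi>(1) a b] z])
          (use \<phi>el[OF a b] c\<beta>[OF a x(1) e pe] q\<beta>[OF a x(1) e pe] x(2) in auto)
      then show ?thesis using b by blast
    qed
    then show "app \<phi> a ` omap ?X a = omap (Pb t) a" using app_in[OF \<phi>(1) a] by blast
  qed
  then have iso\<phi>: "is_iso PSh \<phi>" using iso_iff_bij[OF \<phi>(1)] by blast
  let ?s = "(q, omap G t, \<phi>)"
  have s: "?s \<in> hom SE q (omap G t)" using slice_homI[OF q Gt \<phi>(1,3)] .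
  note et = eps_hom[OF tO(1)] and S = postcomp_mor[OF s]
  let ?mt = "Gm (p \<odot>\<^bsub>PSh\<^esub> omap G t) t (\<pi> t)" and ?\<phi>' = "Gm ?f (p \<odot>\<^bsub>PSh\<^esub> omap G t) \<phi>"
  have alg: "\<phi> \<odot>\<^bsub>PSh\<^esub> \<alpha> = ?mt \<odot>\<^bsub>PSh\<^esub> ?\<phi>'"
  proof (rule morphism_ext[OF cat_comp[OF cat_PSh \<alpha> \<phi>(1)] cat_comp[OF cat_PSh G_mor(2)[OF S] G_mor(2)[OF
    et]]])
    fix a z assume a: "a \<in> Ob A" and z: "z \<in> omap (Pb ?f) a"
    let ?x = "app (\<pi> ?f) a z" and ?e = "app (omap G ?f) a z"
    have x: "?x \<in> omap ?X a" and e: "?e \<in> omap E a" using app_in[OF \<pi>f a z] app_in[OF Gf a z] .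
    have pe: "app p a (app q a ?x) = app p a ?e" using pb_square[OF f(1) a z] fx[OF a x] by simp
    have \<alpha>z: "app \<alpha> a z = \<beta> a ?e ?x" using pb_elem[OF f(1) a z] by (simp add: \<beta>_def)
    note b = \<beta>_in[OF a x e pe]
    have z': "app ?\<phi>' a z \<in> omap (Pb (p \<odot>\<^bsub>PSh\<^esub> omap G t)) a" using app_in[OF G_mor(2)[OF S] a z] .
    have "app \<phi> a (\<beta> a ?e ?x) = app ?mt a (app ?\<phi>' a z)"
      by (rule pb_eqI[OF tO(1) a app_in[OF \<phi>(1) a b] app_in[OF G_mor(2)[OF et] a z']])
        (use \<phi>el[OF a b] c\<beta>[OF a x e pe] q\<beta>[OF a x e pe] G_mor(3,4)[OF et a z'] G_mor(3,4)[OF S a z] \<phi>el[OF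
          a x] in auto)
    then show "app (\<phi> \<odot>\<^bsub>PSh\<^esub> \<alpha>) a z = app (?mt \<odot>\<^bsub>PSh\<^esub> ?\<phi>') a z"
      using app_comp[OF \<alpha> \<phi>(1) a z] app_comp[OF G_mor(2)[OF S] G_mor(2)[OF et] a z] \<alpha>z by simp
  qed
  have Kt: "omap Comparison t = (omap G t, amap G (eps t))" by (simp add: EM_comparison_def)
  have "?s \<odot>\<^bsub>SE\<^esub> al = amap G (eps t) \<odot>\<^bsub>SE\<^esub> amap (G \<circ>\<^sub>F postcomp PSh p) ?s"
    using alg G_mor_Cmp_G_mor[OF S et] by (simp add: al_eq slice_Cmp postcomp_def)
  then have h: "(d, omap Comparison t, ?s) \<in> hom Alg d (omap Comparison t)"
    using d s functor_obj[OF EM_comparison_functor[OF adj] tO(1)] unfolding d_eq Kt by (intro EM_homI)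
  have "is_iso SE ?s" using slice_iso[OF cat_PSh s] iso\<phi> by simp
  then have iso: "is_iso Alg (d, omap Comparison t, ?s)"
    unfolding d_eq Kt by (rule EM_iso[OF monad_functor h[unfolded d_eq Kt]])
  obtain j where "j \<in> hom Alg (omap Comparison t) d" "is_iso Alg j"
    by (rule iso_inverse[OF h iso])
  then show ?thesis by (intro bexI[OF _ tO(1)] bexI[of _ j])
qed

end

context set_valued_functors
begin

lemma surj_effective_descent:
  assumes p: "p \<in> hom PSh E T" and surj: "cw_surj A p"
  shows "effective_descent PSh p"
proof -
  note s = homD[OF p]
  obtain G \<eta> \<pi> where
    adj: "adjunction (slice PSh E) (slice PSh T) (postcomp PSh p) G \<eta> (\<lambda>f. (p \<odot>\<^bsub>PSh\<^esub> omap G f, f, \<pi> f))"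
    and pf: "is_pullback_functor PSh p G"
    and pb: "\<And>f. f \<in> Ob (slice PSh T) \<Longrightarrow> is_pullback PSh f p (omap G f) (\<pi> f)"
    and nat: "\<And>f g u. (f, g, u) \<in> hom (slice PSh T) f g \<Longrightarrow>
       \<pi> g \<odot>\<^bsub>PSh\<^esub> datum (amap G (f, g, u)) = u \<odot>\<^bsub>PSh\<^esub> \<pi> f"
    using pullback_functor_exists[OF cat_PSh PSh_pullbacks s(1)] unfolding s by blast
  interpret surjective_base A U E T p G \<eta> \<pi>
    by unfold_locales (use p surj adj pb nat in auto)
  have "equivalence_functor ST Alg Comparison"
    by (rule equivalence_of_fully_faithful[OF EM_comparison_functor[OF adj]])
      (use comparison_fully_faithful comparison_essentially_surjective in auto)
  then have "monadic ST SE G" unfolding monadic_def using adj by blast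
  then show ?thesis unfolding effective_descent_def using s pf by auto
qed

end

section \<open>Right Kan extensions of set-valued functors\<close>

lemma SetCat_homD:
  assumes "f \<in> hom (SetCat :: ('u set, 'u smap) cat) X Y"
  shows "f = (X, Y, datum f)" "datum f \<in> X \<rightarrow>\<^sub>E Y" "small TYPE('u) X" "small TYPE('u) Y"
  using assms by (auto simp: SetCat_hom)

lemma SetCat_homI:
  assumes "small TYPE('u) X" "small TYPE('u) Y" "f \<in> X \<rightarrow>\<^sub>E Y"
  shows "(X, Y, f) \<in> hom (SetCat :: ('u set, 'u smap) cat) X Y"
  using assms by (simp add: SetCat_hom)

lemma SetCat_comp_apply:
  assumes "f \<in> hom SetCat X Y" "g \<in> hom SetCat Y Z" "x \<in> X"
  shows "datum (g \<odot>\<^bsub>SetCat\<^esub> f) x = datum g (datum f x)"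
proof -
  have "g \<odot>\<^bsub>SetCat\<^esub> f = (X, Z, compose X (datum g) (datum f))"
    by (subst SetCat_homD(1)[OF assms(1)], subst SetCat_homD(1)[OF assms(2)]) (rule SetCat_Cmp)
  then show ?thesis using assms(3) by (simp add: compose_eq)
qed

lemma SetCat_ext:
  assumes f: "f \<in> hom SetCat X Y" and g: "g \<in> hom SetCat X Y"
    and eq: "\<And>x. x \<in> X \<Longrightarrow> datum f x = datum g x"
  shows "f = g"
proof -
  have "datum f = datum g" by (rule PiE_ext[OF SetCat_homD(2)[OF f] SetCat_homD(2)[OF g] eq])
  then show ?thesis using SetCat_homD(1)[OF f] SetCat_homD(1)[OF g] by metis
qed

text \<open>Elements of a limit are maps from a singleton, so they are determined by their projections.\<close>

lemma limit_elements_eqI: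
  assumes U: "universe TYPE('u)" and lim: "is_limit J (SetCat :: ('u set, 'u smap) cat) F L \<pi>"
    and u: "u \<in> L" and v: "v \<in> L" and eq: "\<And>j. j \<in> Ob J \<Longrightarrow> datum (\<pi> j) u = datum (\<pi> j) v"
  shows "u = v"
proof -
  have cone: "is_cone J SetCat F L \<pi>" using lim by (simp add: is_limit_def)
  then have F: "is_functor J SetCat F" and L: "small TYPE('u) L"
    and \<pi>: "\<And>j. j \<in> Ob J \<Longrightarrow> \<pi> j \<in> hom SetCat L (omap F j)"
    and nat: "\<And>k. k \<in> Mor J \<Longrightarrow> amap F k \<odot>\<^bsub>SetCat\<^esub> \<pi> (Src J k) = \<pi> (Tgt J k)"
    by (auto simp: is_cone_def SetCat_Ob)
  note J = functor_cat(1)[OF F]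
  let ?X = "{u}" and ?f = "\<lambda>w. ({u}, L, \<lambda>x\<in>{u}. w)"
  have X: "small TYPE('u) ?X" by (rule small_finite[OF U]) simp
  have f: "?f w \<in> hom SetCat ?X L" if "w \<in> L" for w using that by (intro SetCat_homI X L) auto
  define \<kappa> where "\<kappa> j = \<pi> j \<odot>\<^bsub>SetCat\<^esub> ?f u" for j
  have "is_cone J SetCat F ?X \<kappa>"
    unfolding is_cone_def
  proof (intro conjI ballI)
    fix k assume k: "k \<in> Mor J"
    note ob = cat_obj[OF J k]
    show "amap F k \<odot>\<^bsub>SetCat\<^esub> \<kappa> (Src J k) = \<kappa> (Tgt J k)"
      using cat_assoc[OF SetCat_category f[OF u] \<pi>[OF ob(1)] functor_hom[OF F hom_Src_Tgt[OF k]]] nat[OF k]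
      by (simp add: \<kappa>_def)
  qed (use F X cat_comp[OF SetCat_category f[OF u] \<pi>] in \<open>auto simp: SetCat_Ob \<kappa>_def\<close>)
  then have "\<exists>!f. f \<in> hom SetCat ?X L \<and> (\<forall>j\<in>Ob J. \<pi> j \<odot>\<^bsub>SetCat\<^esub> f = \<kappa> j)"
    using lim by (simp add: is_limit_def)
  then obtain f\<^sub>0 where f\<^sub>0: "\<And>f. f \<in> hom SetCat ?X L \<Longrightarrow> \<forall>j\<in>Ob J. \<pi> j \<odot>\<^bsub>SetCat\<^esub> f = \<kappa> j \<Longrightarrow> f = f\<^sub>0"
    by (elim ex1E) blast
  have \<kappa>v: "\<pi> j \<odot>\<^bsub>SetCat\<^esub> ?f v = \<kappa> j" if j: "j \<in> Ob J" for j
    unfolding \<kappa>_def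
    by (rule SetCat_ext[OF cat_comp[OF SetCat_category f[OF v] \<pi>[OF j]] cat_comp[OF SetCat_category f[OF u]
      \<pi>[OF j]]])
      (use SetCat_comp_apply[OF f[OF u] \<pi>[OF j]] SetCat_comp_apply[OF f[OF v] \<pi>[OF j]] eq[OF j] in auto)
  have "?f u = f\<^sub>0" by (rule f\<^sub>0[OF f[OF u]]) (simp add: \<kappa>_def)
  moreover have "?f v = f\<^sub>0" by (rule f\<^sub>0[OF f[OF v]]) (use \<kappa>v in blast)
  ultimately have "?f u = ?f v" by metis
  then have "(\<lambda>x\<in>{u}. u) u = (\<lambda>x\<in>{u}. v) u" by simp
  then show ?thesis by simp
qed

lemma precomp_functor:
  assumes K: "is_functor B A K"
  shows "is_functor (Fun A D) (Fun B D) (precomp B K)"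
proof -
  note B = functor_cat(1)[OF K]
  have ob: "precomp_ob B K S \<in> Ob (Fun B D)" if "S \<in> Ob (Fun A D)" for S
  proof -
    have S: "is_functor A D S" using that by (simp add: Fun_Ob)
    note SK = comp_functor[OF K S]
    have "is_functor B D (precomp_ob B K S)"
    proof (rule is_functorI[OF B functor_cat(2)[OF S]])
      fix a assume a: "a \<in> Ob B"
      show "omap (precomp_ob B K S) a \<in> Ob D"
        using functor_obj[OF SK a] a by (simp add: precomp_ob_def)
      show "amap (precomp_ob B K S) (Idn B a) = Idn D (omap (precomp_ob B K S) a)"
        using functor_id[OF SK a] a homD(1)[OF cat_id[OF B a]] by (simp add: precomp_ob_def)
    next
      fix a b f assume "a \<in> Ob B" "b \<in> Ob B" "f \<in> hom B a b"
      then show "amap (precomp_ob B K S) f \<in> hom D (omap (precomp_ob B K S) a) (omap (precomp_ob B K S) b)"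
        using functor_hom[OF SK, of f a b] homD(1)[of f B a b] by (simp add: precomp_ob_def)
    next
      fix a b c f g assume f: "f \<in> hom B a b" and g: "g \<in> hom B b c"
      show "amap (precomp_ob B K S) (g \<odot>\<^bsub>B\<^esub> f) = amap (precomp_ob B K S) g \<odot>\<^bsub>D\<^esub> amap (precomp_ob B K S) f"
        using functor_comp[OF SK f g] homD(1)[OF f] homD(1)[OF g] homD(1)[OF cat_comp[OF B f g]]
        by (simp add: precomp_ob_def)
    qed
    then show ?thesis by (simp add: Fun_Ob precomp_ob_def)
  qed
  have mor: "nat_trans B D (precomp_ob B K S) (precomp_ob B K T) (\<lambda>b\<in>Ob B. \<tau> (omap K b))"
    if "nat_trans A D S T \<tau>" "S \<in> Ob (Fun A D)" "T \<in> Ob (Fun A D)" for S T \<tau>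
  proof (rule nat_transI)
    show "is_functor B D (precomp_ob B K S)" "is_functor B D (precomp_ob B K T)"
      using ob that by (simp_all add: Fun_Ob)
    fix a assume a: "a \<in> Ob B"
    show "(\<lambda>b\<in>Ob B. \<tau> (omap K b)) a \<in> hom D (omap (precomp_ob B K S) a) (omap (precomp_ob B K T) a)"
      using nat_trans_hom[OF that(1) functor_obj[OF K a]] a by (simp add: precomp_ob_def)
  next
    fix a b f assume "a \<in> Ob B" "b \<in> Ob B" and f: "f \<in> hom B a b"
    then show "amap (precomp_ob B K T) f \<odot>\<^bsub>D\<^esub> (\<lambda>b\<in>Ob B. \<tau> (omap K b)) a =
        (\<lambda>b\<in>Ob B. \<tau> (omap K b)) b \<odot>\<^bsub>D\<^esub> amap (precomp_ob B K S) f"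
      using nat_trans_eq[OF that(1) functor_hom[OF K f]] homD(1)[OF f] by (simp add: precomp_ob_def)
  qed
  show ?thesis
  proof (rule is_functorI[OF Fun_category Fun_category])
    fix S assume S: "S \<in> Ob (Fun A D)"
    show "omap (precomp B K) S \<in> Ob (Fun B D)" using ob[OF S] by (simp add: precomp_def)
    show "amap (precomp B K) (Idn (Fun A D) S) = Idn (Fun B D) (omap (precomp B K) S)"
      using functor_obj[OF K] by (auto simp: precomp_def Fun_Idn precomp_ob_def)
  next
    fix S T f assume "f \<in> hom (Fun A D) S T"
    then show "amap (precomp B K) f \<in> hom (Fun B D) (omap (precomp B K) S) (omap (precomp B K) T)"
      using mor ob by (auto simp: Fun_hom precomp_def)
  next
    fix S T V f g assume "f \<in> hom (Fun A D) S T" "g \<in> hom (Fun A D) T V"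
    then show "amap (precomp B K) (g \<odot>\<^bsub>Fun A D\<^esub> f) = amap (precomp B K) g \<odot>\<^bsub>Fun B D\<^esub> amap (precomp B K) f"
      using functor_obj[OF K] by (auto simp: Fun_hom precomp_def Fun_Cmp intro!: restrict_ext)
  qed
qed

lemma comma_Ob: "(b, h) \<in> Ob (comma B A a K) \<longleftrightarrow> b \<in> Ob B \<and> h \<in> hom A a (omap K b)"
  by (simp add: comma_def)

lemma comma_hom: "k \<in> hom (comma B A a K) (b, h) (b', h') \<longleftrightarrow>
   (\<exists>g. k = ((b, h), (b', h'), g) \<and> (b, h) \<in> Ob (comma B A a K) \<and> (b', h') \<in> Ob (comma B A a K) \<and>
      g \<in> hom B b b' \<and> amap K g \<odot>\<^bsub>A\<^esub> h = h')"
  by (auto simp: comma_def triple_cat_hom)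

lemma comma_category:
  assumes K: "is_functor B A K"
  shows "category (comma B A a K)"
proof -
  note B = functor_cat(1)[OF K] and A = functor_cat(2)[OF K]
  show ?thesis
    unfolding comma_def
  proof (rule triple_cat_category, goal_cases)
    case (1 X)
    then show ?case by (auto simp: cat_id[OF B] functor_id[OF K] cat_idl[OF A])
  next
    case (2 X Y Z g g')
    obtain b h b' h' b'' h'' where [simp]: "X = (b, h)" "Y = (b', h')" "Z = (b'', h'')" by (metis surj_pair)
    have "h \<in> hom A a (omap K b)" "g \<in> hom B b b'" "g' \<in> hom B b' b''" "amap K g \<odot>\<^bsub>A\<^esub> h = h'"
      "amap K g' \<odot>\<^bsub>A\<^esub> h' = h''"
      using 2 by auto
    then show ?case
      using cat_assoc[OF A, of h a "omap K b" "amap K g" "omap K b'" "amap K g'" "omap K b''"]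
        functor_hom[OF K, of g b b'] functor_hom[OF K, of g' b' b''] functor_comp[OF K, of g b b' g' b'']
        cat_comp[OF B, of g b b' g' b''] by simp
  qed (auto simp: cat_idl[OF B] cat_idr[OF B] cat_assoc[OF B])
qed

lemma comma_proj_functor:
  assumes K: "is_functor B A K"
  shows "is_functor (comma B A a K) B comma_proj"
proof (rule is_functorI[OF comma_category[OF K] functor_cat(1)[OF K]])
  fix x y f assume "f \<in> hom (comma B A a K) x y"
  then show "amap comma_proj f \<in> hom B (omap comma_proj x) (omap comma_proj y)"
    by (cases x; cases y) (auto simp: comma_hom comma_proj_def)
next
  fix x y z f g assume "f \<in> hom (comma B A a K) x y" "g \<in> hom (comma B A a K) y z"
  then show "amap comma_proj (g \<odot>\<^bsub>comma B A a K\<^esub> f) = amap comma_proj g \<odot>\<^bsub>B\<^esub> amap comma_proj f"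
    by (cases x; cases y; cases z) (auto simp: comma_hom comma_proj_def, simp add: comma_def)
qed (auto simp: comma_proj_def comma_def)

locale kan_extension = set_valued_functors A U
  for A :: "('a, 'f) cat" and U :: "'u itself" +
  fixes B :: "('b, 'g) cat" and K :: "('b, 'g, 'a, 'f) func"
  assumes small_B: "small_category TYPE('u) B" and small_A: "small_homs TYPE('u) A"
    and K: "is_functor B A K"
begin

sublocale B: set_valued_functors B U
  by unfold_locales (use small_B univ in \<open>auto simp: small_category_def\<close>)

abbreviation SK where "SK \<equiv> precomp B K :: (('a, 'f, 'u set, 'u smap) func, ('a, 'f, 'u set,
  'u smap) ntrans,
  ('b, 'g, 'u set, 'u smap) func, ('b, 'g, 'u set, 'u smap) ntrans) func"

lemmas SK_functor = precomp_functor[OF K, of "SetCat :: ('u set, 'u smap) cat"]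

lemma omap_SK: "b \<in> Ob B \<Longrightarrow> omap (omap SK S) b = omap S (omap K b)"
  by (simp add: precomp_def precomp_ob_def)

lemma act_SK: "g \<in> hom B b b' \<Longrightarrow> act (omap SK S) g x = act S (amap K g) x"
  using homD(1) by (fastforce simp: act_def precomp_def precomp_ob_def)

lemma app_SK:
  assumes \<tau>: "\<tau> \<in> hom PSh S T" and b: "b \<in> Ob B"
  shows "app (amap SK \<tau>) b x = app \<tau> (omap K b) x"
proof -
  obtain t where "\<tau> = (S, T, t)" using morphism_eq[OF \<tau>] by blast
  then show ?thesis using b by (simp add: app_def precomp_def)
qed

text \<open>
  The value of the Kan extension of \<open>T\<close> at \<open>a\<close>: compatible families indexed by the morphisms from \<open>a\<close>
  into the image of \<open>K\<close>.
\<close>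

definition fam where
  "fam T a = {t \<in> Ob (comma B A a K) \<rightarrow>\<^sub>E (\<Union>b\<in>Ob B. omap T b).
     (\<forall>b\<in>Ob B. \<forall>h\<in>hom A a (omap K b). t (b, h) \<in> omap T b) \<and>
     (\<forall>b b'. \<forall>g\<in>hom B b b'. \<forall>h\<in>hom A a (omap K b). act T g (t (b, h)) = t (b', amap K g \<odot>\<^bsub>A\<^esub> h))}"

lemma fam_eqI:
  assumes "s \<in> fam T a" "t \<in> fam T a"
    and "\<And>b h. b \<in> Ob B \<Longrightarrow> h \<in> hom A a (omap K b) \<Longrightarrow> s (b, h) = t (b, h)"
  shows "s = t"
proof (rule PiE_ext)
  show "s \<in> Ob (comma B A a K) \<rightarrow>\<^sub>E (\<Union>b\<in>Ob B. omap T b)" "t \<in> Ob (comma B A a K) \<rightarrow>\<^sub>E (\<Union>b\<in>Ob B. omap T b)"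
    using assms by (auto simp: fam_def)
qed (use assms(3) in \<open>auto simp: comma_def\<close>)

lemma famI:
  assumes "\<And>b h. b \<in> Ob B \<Longrightarrow> h \<in> hom A a (omap K b) \<Longrightarrow> s (b, h) \<in> omap T b"
    and "\<And>b b' g h. g \<in> hom B b b' \<Longrightarrow> h \<in> hom A a (omap K b) \<Longrightarrow> act T g (s (b, h)) = s (b', amap K g \<odot>\<^bsub>A\<^esub> h)"
  shows "restrict s (Ob (comma B A a K)) \<in> fam T a"
proof -
  have "amap K g \<odot>\<^bsub>A\<^esub> h \<in> hom A a (omap K b')" if "g \<in> hom B b b'" "h \<in> hom A a (omap K b)" for g h b b'
    using cat_comp[OF cat_A that(2) functor_hom[OF K that(1)]] .
  then show ?thesis
    unfolding fam_def using assms hom_obj[OF B.cat_A] by (fastforce simp: comma_Ob comma_def)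
qed

lemma small_fam:
  assumes T: "T \<in> Ob B.PSh" and a: "a \<in> Ob A"
  shows "small TYPE('u) (fam T a)"
proof -
  have sB: "small TYPE('u) (Ob B)" and sA: "\<And>b. b \<in> Ob B \<Longrightarrow> small TYPE('u) (hom A a (omap K b))"
    using small_B small_A a functor_obj[OF K] by (auto simp: small_category_def small_homs_def)
  have "small TYPE('u) (Ob (comma B A a K))"
    by (rule small_subset[OF small_Sigma[OF univ sB sA]]) (auto simp: comma_def)
  moreover have "small TYPE('u) (\<Union>b\<in>Ob B. omap T b)"
    by (rule small_subset[OF small_image[OF small_Sigma[OF univ sB B.small_omap[OF T]], where f = snd]])
      force+
  ultimately show ?thesis
    by (intro small_subset[OF small_PiE[OF univ]]) (auto simp: fam_def)
qed

text \<open>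
  A morphism \<open>k\<close> of \<open>A\<close> acts on families by precomposing their indices with \<open>k\<close>. The bijections \<open>d a\<close>
  read off the family that an element stands for.
\<close>

lemma ran_exists:
  assumes T: "T \<in> Ob B.PSh"
  shows "\<exists>S d. S \<in> Ob PSh \<and> (\<forall>a\<in>Ob A. bij_betw (d a) (omap S a) (fam T a)) \<and>
     (\<forall>a a'. \<forall>k\<in>hom A a a'. \<forall>r\<in>omap S a. \<forall>b\<in>Ob B. \<forall>h\<in>hom A a' (omap K b).
        d a' (act S k r) (b, h) = d a r (b, h \<odot>\<^bsub>A\<^esub> k))"
proof -
  define \<alpha> where "\<alpha> k t = restrict (\<lambda>(b, h). t (b, h \<odot>\<^bsub>A\<^esub> k)) (Ob (comma B A (Tgt A k) K))"
    for k and t :: "'b \<times> 'f \<Rightarrow> 'u"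
  have \<alpha>: "\<alpha> k t \<in> fam T a'" if k: "k \<in> hom A a a'" and t: "t \<in> fam T a" for a a' k t
  proof -
    have "act T g (t (b, h \<odot>\<^bsub>A\<^esub> k)) = t (b', (amap K g \<odot>\<^bsub>A\<^esub> h) \<odot>\<^bsub>A\<^esub> k)"
      if g: "g \<in> hom B b b'" and h: "h \<in> hom A a' (omap K b)" for b b' g h
      using t g cat_comp[OF cat_A k h] cat_assoc[OF cat_A k h functor_hom[OF K g]] by (simp add: fam_def)
    then show ?thesis
      unfolding \<alpha>_def homD(3)[OF k] using t cat_comp[OF cat_A k] by (intro famI) (auto simp: fam_def)
  qed
  have \<alpha>_apply: "\<alpha> k t (b, h) = t (b, h \<odot>\<^bsub>A\<^esub> k)"
    if "k \<in> hom A a a'" "b \<in> Ob B" "h \<in> hom A a' (omap K b)" for a a' k b h t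
    using that homD(3)[OF that(1)] by (simp add: \<alpha>_def comma_Ob)
  have "\<exists>S (d :: 'a \<Rightarrow> 'u \<Rightarrow> 'b \<times> 'f \<Rightarrow> 'u). S \<in> Ob PSh \<and> (\<forall>a\<in>Ob A. bij_betw (d a) (omap S a) (fam T a)) \<and>
     (\<forall>a b. \<forall>k\<in>hom A a b. \<forall>r\<in>omap S a. d b (act S k r) = \<alpha> k (d a r))"
  proof (rule decoded_functor_exists)
    fix a t assume a: "a \<in> Ob A" and t: "t \<in> fam T a"
    note i = cat_id[OF cat_A a]
    show "\<alpha> (Idn A a) t = t"
      by (rule fam_eqI[OF \<alpha>[OF i t] t]) (simp add: \<alpha>_apply[OF i] cat_idr[OF cat_A])
  next
    fix a a' a'' k l t assume k: "k \<in> hom A a a'" and l: "l \<in> hom A a' a''" and t: "t \<in> fam T a"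
    note kl = cat_comp[OF cat_A k l]
    show "\<alpha> (l \<odot>\<^bsub>A\<^esub> k) t = \<alpha> l (\<alpha> k t)"
    proof (rule fam_eqI[OF \<alpha>[OF kl t] \<alpha>[OF l \<alpha>[OF k t]]])
      fix b h assume b: "b \<in> Ob B" and h: "h \<in> hom A a'' (omap K b)"
      show "\<alpha> (l \<odot>\<^bsub>A\<^esub> k) t (b, h) = \<alpha> l (\<alpha> k t) (b, h)"
        using \<alpha>_apply[OF kl b h] \<alpha>_apply[OF l b h] \<alpha>_apply[OF k b cat_comp[OF cat_A l h]]
          cat_assoc[OF cat_A k l h] by simp
    qed
  qed (use small_fam[OF T] \<alpha> in auto)
  then obtain S and d :: "'a \<Rightarrow> 'u \<Rightarrow> 'b \<times> 'f \<Rightarrow> 'u" where S: "S \<in> Ob PSh"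
    and d: "\<And>a. a \<in> Ob A \<Longrightarrow> bij_betw (d a) (omap S a) (fam T a)"
    and act: "\<And>a a' k r. k \<in> hom A a a' \<Longrightarrow> r \<in> omap S a \<Longrightarrow> d a' (act S k r) = \<alpha> k (d a r)"
    by blast
  have "d a' (act S k r) (b, h) = d a r (b, h \<odot>\<^bsub>A\<^esub> k)"
    if "k \<in> hom A a a'" "r \<in> omap S a" "b \<in> Ob B" "h \<in> hom A a' (omap K b)" for a a' k r b h
    using act[OF that(1,2)] \<alpha>_apply[OF that(1,3,4)] by simp
  then show ?thesis using S d by blast
qed

context
  fixes T S d
  assumes T: "T \<in> Ob B.PSh" and S: "S \<in> Ob PSh"
    and d: "\<And>a. a \<in> Ob A \<Longrightarrow> bij_betw (d a) (omap S a) (fam T a)"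
    and d_act: "\<And>a a' k r b h. k \<in> hom A a a' \<Longrightarrow> r \<in> omap S a \<Longrightarrow> b \<in> Ob B \<Longrightarrow> h \<in> hom A a' (omap K b) \<Longrightarrow>
       d a' (act S k r) (b, h) = d a r (b, h \<odot>\<^bsub>A\<^esub> k)"
begin

definition counit where
  "counit = tr B (omap SK S) T (\<lambda>b r. d (omap K b) r (b, Idn A (omap K b)))"

lemma d_fam: "a \<in> Ob A \<Longrightarrow> r \<in> omap S a \<Longrightarrow> d a r \<in> fam T a"
  using bij_betw_apply[OF d] .

lemma d_eqI:
  assumes "a \<in> Ob A" "r \<in> omap S a" "s \<in> omap S a"
    "\<And>b h. b \<in> Ob B \<Longrightarrow> h \<in> hom A a (omap K b) \<Longrightarrow> d a r (b, h) = d a s (b, h)"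
  shows "r = s"
  using fam_eqI[OF d_fam[OF assms(1,2)] d_fam[OF assms(1,3)] assms(4)]
    inj_onD[OF bij_betw_imp_inj_on[OF d[OF assms(1)]]] assms(2,3) by blast

lemma d_inv:
  assumes "a \<in> Ob A" "t \<in> fam T a"
  shows "inv_into (omap S a) (d a) t \<in> omap S a" "d a (inv_into (omap S a) (d a) t) = t"
  using bij_betw_apply[OF bij_betw_inv_into[OF d[OF assms(1)]] assms(2)]
    bij_betw_inv_into_right[OF d[OF assms(1)] assms(2)] by auto

lemma counit_hom: "counit \<in> hom B.PSh (omap SK S) T"
  unfolding counit_def
proof (rule B.tr_hom[OF functor_obj[OF SK_functor S] T])
  fix b r assume b: "b \<in> Ob B" and r: "r \<in> omap (omap SK S) b"
  show "d (omap K b) r (b, Idn A (omap K b)) \<in> omap T b"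
    using d_fam[OF functor_obj[OF K b]] r b cat_id[OF cat_A functor_obj[OF K b]]
      by (simp add: omap_SK fam_def)
next
  fix b b' g r assume g: "g \<in> hom B b b'" and r: "r \<in> omap (omap SK S) b"
  note ob = hom_obj[OF B.cat_A g]
  note Kb = functor_obj[OF K ob(1)] functor_obj[OF K ob(2)] and Kg = functor_hom[OF K g]
  have r: "r \<in> omap S (omap K b)" using r ob by (simp add: omap_SK)
  have "d (omap K b') (act S (amap K g) r) (b', Idn A (omap K b')) = d (omap K b) r (b',
    amap K g \<odot>\<^bsub>A\<^esub> Idn A (omap K b))"
    using d_act[OF Kg r ob(2) cat_id[OF cat_A Kb(2)]] cat_idl[OF cat_A Kg] cat_idr[OF cat_A Kg] by simp
  also have "\<dots> = act T g (d (omap K b) r (b, Idn A (omap K b)))"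
    using d_fam[OF Kb(1) r] g cat_id[OF cat_A Kb(1)] by (simp add: fam_def)
  finally show "d (omap K b') (act (omap SK S) g r) (b', Idn A (omap K b')) = act T g (d (omap K b) r (b,
    Idn A (omap K b)))"
    by (simp add: act_SK[OF g])
qed

lemma counit_act:
  assumes a: "a \<in> Ob A" and r: "r \<in> omap S a" and b: "b \<in> Ob B" and h: "h \<in> hom A a (omap K b)"
  shows "app counit b (act S h r) = d a r (b, h)"
proof -
  note Kb = functor_obj[OF K b]
  have "app counit b (act S h r) = d (omap K b) (act S h r) (b, Idn A (omap K b))"
    unfolding counit_def by (rule B.app_tr[OF b]) (simp add: omap_SK b act_in[OF S h r])
  then show ?thesis using d_act[OF h r b cat_id[OF cat_A Kb]] cat_idl[OF cat_A h] by simp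
qed

text \<open>The transpose of \<open>\<sigma>\<close> sends \<open>x\<close> to the family of all \<open>\<sigma> (V h x)\<close>.\<close>

lemma counit_universal:
  assumes V: "V \<in> Ob PSh" and \<sigma>: "\<sigma> \<in> hom B.PSh (omap SK V) T"
  shows "\<exists>!u. u \<in> hom PSh V S \<and> counit \<odot>\<^bsub>B.PSh\<^esub> amap SK u = \<sigma>"
proof -
  define m where "m a x = restrict (\<lambda>(b, h). app \<sigma> b (act V h x)) (Ob (comma B A a K))" for a x
  have m_apply: "m a x (b, h) = app \<sigma> b (act V h x)" if "b \<in> Ob B" "h \<in> hom A a (omap K b)" for a x b h
    using that by (simp add: m_def comma_Ob)
  have m: "m a x \<in> fam T a" if x: "x \<in> omap V a" for a x
    unfolding m_def
  proof (rule famI, unfold prod.case)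
    fix b h assume b: "b \<in> Ob B" and h: "h \<in> hom A a (omap K b)"
    show "app \<sigma> b (act V h x) \<in> omap T b"
      using B.app_in[OF \<sigma> b] act_in[OF V h x] b by (simp add: omap_SK)
  next
    fix b b' g h assume g: "g \<in> hom B b b'" and h: "h \<in> hom A a (omap K b)"
    note ob = hom_obj[OF B.cat_A g]
    have "act V h x \<in> omap (omap SK V) b" using act_in[OF V h x] ob by (simp add: omap_SK)
    then show "act T g (app \<sigma> b (act V h x)) = app \<sigma> b' (act V (amap K g \<odot>\<^bsub>A\<^esub> h) x)"
      using B.app_nat[OF \<sigma> g] act_comp[OF V h functor_hom[OF K g] x] by (simp add: act_SK[OF g])
  qed
  define w where "w a x = inv_into (omap S a) (d a) (m a x)" for a x
  have w: "w a x \<in> omap S a" "d a (w a x) = m a x" if "a \<in> Ob A" "x \<in> omap V a" for a x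
    using d_inv[OF that(1) m[OF that(2)]] by (auto simp: w_def)
  have W: "tr A V S w \<in> hom PSh V S"
  proof (rule tr_hom[OF V S w(1)])
    fix a a' k x assume k: "k \<in> hom A a a'" and x: "x \<in> omap V a"
    note ob = hom_obj[OF cat_A k] and kx = act_in[OF V k x]
    show "w a' (act V k x) = act S k (w a x)"
    proof (rule d_eqI[OF ob(2) w(1)[OF ob(2) kx] act_in[OF S k w(1)[OF ob(1) x]]])
      fix b h assume b: "b \<in> Ob B" and h: "h \<in> hom A a' (omap K b)"
      show "d a' (w a' (act V k x)) (b, h) = d a' (act S k (w a x)) (b, h)"
        using w(2)[OF ob(2) kx] w(2)[OF ob(1) x] d_act[OF k w(1)[OF ob(1) x] b h] m_apply[OF b h]
          m_apply[OF b cat_comp[OF cat_A k h]] act_comp[OF V k h x] by simp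
    qed
  qed
  have SKu: "amap SK u \<in> hom B.PSh (omap SK V) (omap SK S)" if "u \<in> hom PSh V S" for u
    using functor_hom[OF SK_functor that] .
  have el: "app (counit \<odot>\<^bsub>B.PSh\<^esub> amap SK u) b x = app counit b (app u (omap K b) x)"
    if u: "u \<in> hom PSh V S" and b: "b \<in> Ob B" and x: "x \<in> omap V (omap K b)" for u b x
    using B.app_comp[OF SKu[OF u] counit_hom b] x b app_SK[OF u b] by (simp add: omap_SK)
  have c1: "counit \<odot>\<^bsub>B.PSh\<^esub> amap SK (tr A V S w) = \<sigma>"
  proof (rule B.morphism_ext[OF cat_comp[OF B.cat_PSh SKu[OF W] counit_hom] \<sigma>])
    fix b x assume b: "b \<in> Ob B" and "x \<in> omap (omap SK V) b"
    then have x: "x \<in> omap V (omap K b)" by (simp add: omap_SK)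
    note Kb = functor_obj[OF K b]
    note i = cat_id[OF cat_A Kb] and wx = w[OF Kb x]
    show "app (counit \<odot>\<^bsub>B.PSh\<^esub> amap SK (tr A V S w)) b x = app \<sigma> b x"
      using el[OF W b x] app_tr[OF Kb x] counit_act[OF Kb wx(1) b i] act_id[OF S Kb wx(1)] wx(2)
        m_apply[OF b i] act_id[OF V Kb x] by simp
  qed
  have "u = tr A V S w" if u: "u \<in> hom PSh V S" and c: "counit \<odot>\<^bsub>B.PSh\<^esub> amap SK u = \<sigma>" for u
  proof (rule morphism_ext[OF u W])
    fix a x assume a: "a \<in> Ob A" and x: "x \<in> omap V a"
    show "app u a x = app (tr A V S w) a x"
      unfolding app_tr[OF a x]
    proof (rule d_eqI[OF a app_in[OF u a x] w(1)[OF a x]])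
      fix b h assume b: "b \<in> Ob B" and h: "h \<in> hom A a (omap K b)"
      show "d a (app u a x) (b, h) = d a (w a x) (b, h)"
        using counit_act[OF a app_in[OF u a x] b h] app_nat[OF u h x] el[OF u b act_in[OF V h x]] c
          w(2)[OF a x] m_apply[OF b h] by simp
    qed
  qed
  then show ?thesis using W c1 by blast
qed

text \<open>
  By \<open>counit_act\<close> the projection at \<open>h\<close> is evaluation of families at \<open>h\<close>, and a cone is a map into the
  set of compatible families.
\<close>

lemma counit_limit:
  assumes a: "a \<in> Ob A"
  shows "is_limit (comma B A a K) SetCat (T \<circ>\<^sub>F comma_proj) (omap S a)
     (\<lambda>(b, h). datum counit b \<odot>\<^bsub>SetCat\<^esub> amap S h)"
proof -
  let ?J = "comma B A a K" and ?F = "T \<circ>\<^sub>F comma_proj"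
  define \<pi> where "\<pi> = (\<lambda>(b, h). datum counit b \<odot>\<^bsub>SetCat\<^esub> amap S h)"
  have F: "is_functor ?J SetCat ?F" using comp_functor[OF comma_proj_functor[OF K] B.set_functor[OF T]] .
  have Fo: "omap ?F (b, h) = omap T b" for b h by (simp add: comma_proj_def)
  have sS: "small TYPE('u) (omap S a)" using small_omap[OF S a] .
  have \<pi>: "\<pi> (b, h) \<in> hom SetCat (omap S a) (omap T b)"
    and \<pi>_apply: "\<And>r. r \<in> omap S a \<Longrightarrow> datum (\<pi> (b, h)) r = d a r (b, h)"
    if b: "b \<in> Ob B" and h: "h \<in> hom A a (omap K b)" for b h
  proof -
    have 1: "amap S h \<in> hom SetCat (omap S a) (omap S (omap K b))"
      using functor_hom[OF set_functor[OF S] h] .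
    have "datum counit b \<in> hom SetCat (omap (omap SK S) b) (omap T b)"
      using nat_trans_hom[of B SetCat "omap SK S" T "datum counit" b] B.morphism_eq[OF counit_hom] b by auto
    then have 2: "datum counit b \<in> hom SetCat (omap S (omap K b)) (omap T b)" using b by (simp add: omap_SK)
    show "\<pi> (b, h) \<in> hom SetCat (omap S a) (omap T b)" using cat_comp[OF SetCat_category 1 2]
      by (simp add: \<pi>_def)
    fix r assume r: "r \<in> omap S a"
    show "datum (\<pi> (b, h)) r = d a r (b, h)"
      using SetCat_comp_apply[OF 1 2 r] counit_act[OF a r b h] by (simp add: \<pi>_def act_def app_def)
  qed
  have "is_cone ?J SetCat ?F (omap S a) \<pi>"
    unfolding is_cone_def
  proof (intro conjI ballI)
    fix j assume "j \<in> Ob ?J"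
    then obtain b h where "j = (b, h)" "b \<in> Ob B" "h \<in> hom A a (omap K b)"
      by (cases j) (auto simp: comma_Ob)
    then show "\<pi> j \<in> hom SetCat (omap S a) (omap ?F j)" using \<pi> Fo by metis
  next
    fix k assume k: "k \<in> Mor ?J"
    obtain b h b' h' where st: "Src ?J k = (b, h)" "Tgt ?J k = (b', h')" by (metis surj_pair)
    then obtain g where k': "k = ((b, h), (b', h'), g)" and b: "b \<in> Ob B" "h \<in> hom A a (omap K b)"
      and b': "b' \<in> Ob B" "h' \<in> hom A a (omap K b')" and g: "g \<in> hom B b b'" "amap K g \<odot>\<^bsub>A\<^esub> h = h'"
      using hom_Src_Tgt[OF k] by (auto simp: comma_hom comma_Ob)
    have Tg: "amap T g \<in> hom SetCat (omap T b) (omap T b')" using functor_hom[OF B.set_functor[OF T] g(1)] .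
    have "amap T g \<odot>\<^bsub>SetCat\<^esub> \<pi> (b, h) = \<pi> (b', h')"
    proof (rule SetCat_ext[OF cat_comp[OF SetCat_category \<pi>[OF b] Tg] \<pi>[OF b']])
      fix r assume r: "r \<in> omap S a"
      have "act T g (d a r (b, h)) = d a r (b', h')" using d_fam[OF a r] g b by (simp add: fam_def)
      then show "datum (amap T g \<odot>\<^bsub>SetCat\<^esub> \<pi> (b, h)) r = datum (\<pi> (b', h')) r"
        using SetCat_comp_apply[OF \<pi>[OF b] Tg r] \<pi>_apply[OF b r] \<pi>_apply[OF b' r] by (simp add: act_def)
    qed
    then show "amap ?F k \<odot>\<^bsub>SetCat\<^esub> \<pi> (Src ?J k) = \<pi> (Tgt ?J k)" unfolding st
      by (simp add: k' comma_proj_def)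
  qed (use F sS in \<open>auto simp: SetCat_Ob\<close>)
  moreover have "\<exists>!f. f \<in> hom SetCat X (omap S a) \<and> (\<forall>j\<in>Ob ?J. \<pi> j \<odot>\<^bsub>SetCat\<^esub> f = \<kappa> j)"
    if cone: "is_cone ?J SetCat ?F X \<kappa>" for X \<kappa>
  proof -
    have X: "small TYPE('u) X" using cone by (simp add: is_cone_def SetCat_Ob)
    have \<kappa>: "\<kappa> (b, h) \<in> hom SetCat X (omap T b)" if "b \<in> Ob B" "h \<in> hom A a (omap K b)" for b h
    proof -
      have "(b, h) \<in> Ob ?J" using that by (simp add: comma_Ob)
      then have "\<kappa> (b, h) \<in> hom SetCat X (omap ?F (b, h))" using cone unfolding is_cone_def by blast
      then show ?thesis by (simp only: Fo)
    qed
    have \<kappa>_nat: "act T g (datum (\<kappa> (b, h)) x) = datum (\<kappa> (b', amap K g \<odot>\<^bsub>A\<^esub> h)) x"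
      if g: "g \<in> hom B b b'" and h: "h \<in> hom A a (omap K b)" and x: "x \<in> X" for b b' g h x
    proof -
      note ob = hom_obj[OF B.cat_A g] and h' = cat_comp[OF cat_A h functor_hom[OF K g]]
      let ?k = "((b, h), (b', amap K g \<odot>\<^bsub>A\<^esub> h), g)"
      have k: "?k \<in> hom ?J (b, h) (b', amap K g \<odot>\<^bsub>A\<^esub> h)" using ob g h h' by (simp add: comma_hom comma_Ob)
      have "amap ?F ?k \<odot>\<^bsub>SetCat\<^esub> \<kappa> (b, h) = \<kappa> (b', amap K g \<odot>\<^bsub>A\<^esub> h)"
      proof -
        have "amap ?F ?k \<odot>\<^bsub>SetCat\<^esub> \<kappa> (Src ?J ?k) = \<kappa> (Tgt ?J ?k)"
          using cone homD(1)[OF k] unfolding is_cone_def by blast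
        then show ?thesis using homD(2,3)[OF k] by simp
      qed
      then have "amap T g \<odot>\<^bsub>SetCat\<^esub> \<kappa> (b, h) = \<kappa> (b', amap K g \<odot>\<^bsub>A\<^esub> h)" by (simp add: comma_proj_def)
      then show ?thesis
        using SetCat_comp_apply[OF \<kappa>[OF ob(1) h] functor_hom[OF B.set_functor[OF T] g] x]
          by (simp add: act_def)
    qed
    define m where "m x = restrict (\<lambda>(b, h). datum (\<kappa> (b, h)) x) (Ob ?J)" for x
    have m_apply: "m x (b, h) = datum (\<kappa> (b, h)) x" if "b \<in> Ob B" "h \<in> hom A a (omap K b)" for b h x
      using that by (simp add: m_def comma_Ob)
    have m: "m x \<in> fam T a" if x: "x \<in> X" for x
      unfolding m_def
      by (rule famI) (use SetCat_homD(2)[OF \<kappa>] x \<kappa>_nat in \<open>auto simp: PiE_mem\<close>)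
    define w where "w x = inv_into (omap S a) (d a) (m x)" for x
    have w: "w x \<in> omap S a" "d a (w x) = m x" if "x \<in> X" for x
      using d_inv[OF a m[OF that]] by (auto simp: w_def)
    let ?f = "(X, omap S a, restrict w X)"
    have f: "?f \<in> hom SetCat X (omap S a)" using w by (intro SetCat_homI X sS) auto
    have iff: "(\<forall>j\<in>Ob ?J. \<pi> j \<odot>\<^bsub>SetCat\<^esub> f = \<kappa> j) \<longleftrightarrow> f = ?f" if f': "f \<in> hom SetCat X (omap S a)" for f
    proof
      assume eq: "\<forall>j\<in>Ob ?J. \<pi> j \<odot>\<^bsub>SetCat\<^esub> f = \<kappa> j"
      show "f = ?f"
      proof (rule SetCat_ext[OF f' f])
        fix x assume x: "x \<in> X"
        have fx: "datum f x \<in> omap S a" using SetCat_homD(2)[OF f'] x by auto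
        have "datum f x = w x"
        proof (rule d_eqI[OF a fx w(1)[OF x]])
          fix b h assume b: "b \<in> Ob B" and h: "h \<in> hom A a (omap K b)"
          have "\<pi> (b, h) \<odot>\<^bsub>SetCat\<^esub> f = \<kappa> (b, h)" using eq b h by (simp add: comma_Ob)
          then show "d a (datum f x) (b, h) = d a (w x) (b, h)"
            using SetCat_comp_apply[OF f' \<pi>[OF b h] x] \<pi>_apply[OF b h fx] w(2)[OF x] m_apply[OF b h] by simp
        qed
        then show "datum f x = datum ?f x" using x by simp
      qed
    next
      assume eq: "f = ?f"
      have "\<pi> (b, h) \<odot>\<^bsub>SetCat\<^esub> f = \<kappa> (b, h)" if b: "b \<in> Ob B" and h: "h \<in> hom A a (omap K b)" for b h
      proof (rule SetCat_ext[OF cat_comp[OF SetCat_category f' \<pi>[OF b h]] \<kappa>[OF b h]])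
        fix x assume x: "x \<in> X"
        show "datum (\<pi> (b, h) \<odot>\<^bsub>SetCat\<^esub> f) x = datum (\<kappa> (b, h)) x"
          using SetCat_comp_apply[OF f' \<pi>[OF b h] x] \<pi>_apply[OF b h w(1)[OF x]] w(2)[OF x] m_apply[OF b h] x
          by (simp add: eq)
      qed
      then show "\<forall>j\<in>Ob ?J. \<pi> j \<odot>\<^bsub>SetCat\<^esub> f = \<kappa> j" by (auto simp: comma_def)
    qed
    show ?thesis using iff f by blast
  qed
  ultimately show ?thesis by (simp add: is_limit_def \<pi>_def)
qed

end

lemma pointwise_ran_exists: "\<exists>R \<theta> \<epsilon>. pointwise_ran_adjunction A B (SetCat :: ('u set, 'u smap) cat) K R \<theta> \<epsilon>"
proof -
  have "\<forall>T\<in>Ob B.PSh. \<exists>Sd. fst Sd \<in> Ob PSh \<and> (\<forall>a\<in>Ob A. bij_betw (snd Sd a) (omap (fst Sd) a) (fam T a)) \<and>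
     (\<forall>a a'. \<forall>k\<in>hom A a a'. \<forall>r\<in>omap (fst Sd) a. \<forall>b\<in>Ob B. \<forall>h\<in>hom A a' (omap K b).
        snd Sd a' (act (fst Sd) k r) (b, h) = snd Sd a r (b, h \<odot>\<^bsub>A\<^esub> k))"
  proof
    fix T :: "('b, 'g, 'u set, 'u smap) func" assume "T \<in> Ob B.PSh"
    from ran_exists[OF this] show "\<exists>Sd. fst Sd \<in> Ob PSh \<and>
      (\<forall>a\<in>Ob A. bij_betw (snd Sd a) (omap (fst Sd) a) (fam T a)) \<and>
       (\<forall>a a'. \<forall>k\<in>hom A a a'. \<forall>r\<in>omap (fst Sd) a. \<forall>b\<in>Ob B. \<forall>h\<in>hom A a' (omap K b).
          snd Sd a' (act (fst Sd) k r) (b, h) = snd Sd a r (b, h \<odot>\<^bsub>A\<^esub> k))"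
      unfolding split_paired_Ex fst_conv snd_conv .
  qed
  from bchoice[OF this] obtain Sd where Sd: "\<forall>T\<in>Ob B.PSh. fst (Sd T) \<in> Ob PSh \<and>
     (\<forall>a\<in>Ob A. bij_betw (snd (Sd T) a) (omap (fst (Sd T)) a) (fam T a)) \<and>
     (\<forall>a a'. \<forall>k\<in>hom A a a'. \<forall>r\<in>omap (fst (Sd T)) a. \<forall>b\<in>Ob B. \<forall>h\<in>hom A a' (omap K b).
        snd (Sd T) a' (act (fst (Sd T)) k r) (b, h) = snd (Sd T) a r (b, h \<odot>\<^bsub>A\<^esub> k))" ..
  define S where "S T = fst (Sd T)" for T
  define d where "d T = snd (Sd T)" for T
  define e where "e T = counit T (S T) (d T)" for T
  have S: "S T \<in> Ob PSh" and d: "\<And>a. a \<in> Ob A \<Longrightarrow> bij_betw (d T a) (omap (S T) a) (fam T a)"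
    and d_act: "\<And>a a' k r b h. k \<in> hom A a a' \<Longrightarrow> r \<in> omap (S T) a \<Longrightarrow> b \<in> Ob B \<Longrightarrow> h \<in> hom A a' (omap K b) \<Longrightarrow>
       d T a' (act (S T) k r) (b, h) = d T a r (b, h \<odot>\<^bsub>A\<^esub> k)" if "T \<in> Ob B.PSh" for T
    using Sd that by (auto simp: S_def d_def)
  have "\<exists>R \<theta>. adjunction PSh B.PSh SK R \<theta> e \<and> omap R = S"
  proof (rule right_adjoint_of_universal_arrows[OF SK_functor B.cat_PSh])
    fix T assume T: "T \<in> Ob B.PSh"
    show "S T \<in> Ob PSh" using S[OF T] .
    show "e T \<in> hom B.PSh (omap SK (S T)) T"
      unfolding e_def by (rule counit_hom[OF T S[OF T] d[OF T] d_act[OF T]])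
    fix V \<sigma> assume V: "V \<in> Ob PSh" and \<sigma>: "\<sigma> \<in> hom B.PSh (omap SK V) T"
    show "\<exists>!u. u \<in> hom PSh V (S T) \<and> e T \<odot>\<^bsub>B.PSh\<^esub> amap SK u = \<sigma>"
      unfolding e_def by (rule counit_universal[OF T S[OF T] d[OF T] d_act[OF T] V \<sigma>])
  qed
  then obtain R \<theta> where adj: "adjunction PSh B.PSh SK R \<theta> e" and R: "omap R = S" by blast
  have "is_limit (comma B A a K) SetCat (T \<circ>\<^sub>F comma_proj) (omap (omap R T) a)
      (\<lambda>(b, h). datum (e T) b \<odot>\<^bsub>SetCat\<^esub> amap (omap R T) h)" if T: "T \<in> Ob B.PSh" and a: "a \<in> Ob A" for T a
    unfolding e_def R by (rule counit_limit[OF T S[OF T] d[OF T] d_act[OF T] a])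
  then show ?thesis unfolding pointwise_ran_adjunction_def using adj by blast
qed

end

section \<open>The reflection onto separated functors\<close>

context kan_extension
begin

text \<open>
  The kernel congruence of the unit of the Kan extension, by \<open>theta_kernel\<close>.
\<close>

definition indist where
  "indist S a x y \<longleftrightarrow> (\<forall>b\<in>Ob B. \<forall>h\<in>hom A a (omap K b). act S h x = act S h y)"

definition separated where
  "separated S \<longleftrightarrow> (\<forall>a\<in>Ob A. \<forall>x\<in>omap S a. \<forall>y\<in>omap S a. indist S a x y \<longrightarrow> x = y)"

lemma indist_refl: "indist S a x x"
  and indist_sym: "indist S a x y \<Longrightarrow> indist S a y x"
  and indist_trans: "indist S a x y \<Longrightarrow> indist S a y z \<Longrightarrow> indist S a x z"
  by (simp_all add: indist_def)

lemma indist_act: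
  assumes S: "S \<in> Ob PSh" and k: "k \<in> hom A a a'" and x: "x \<in> omap S a" and y: "y \<in> omap S a"
    and xy: "indist S a x y"
  shows "indist S a' (act S k x) (act S k y)"
  unfolding indist_def
proof (intro ballI)
  fix b h assume b: "b \<in> Ob B" and h: "h \<in> hom A a' (omap K b)"
  show "act S h (act S k x) = act S h (act S k y)"
    using act_comp[OF S k h x] act_comp[OF S k h y] xy b cat_comp[OF cat_A k h] by (simp add: indist_def)
qed

lemma indist_app:
  assumes \<tau>: "\<tau> \<in> hom PSh S T" and x: "x \<in> omap S a" and y: "y \<in> omap S a" and xy: "indist S a x y"
  shows "indist T a (app \<tau> a x) (app \<tau> a y)"
  using xy app_nat[OF \<tau> _ x] app_nat[OF \<tau> _ y] unfolding indist_def by metis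

lemma indist_K:
  assumes S: "S \<in> Ob PSh" and b: "b \<in> Ob B" and x: "x \<in> omap S (omap K b)" and y: "y \<in> omap S (omap K b)"
    and xy: "indist S (omap K b) x y"
  shows "x = y"
proof -
  note Kb = functor_obj[OF K b]
  have "act S (Idn A (omap K b)) x = act S (Idn A (omap K b)) y"
    using xy b cat_id[OF cat_A Kb] by (simp add: indist_def)
  then show ?thesis using act_id[OF S Kb x] act_id[OF S Kb y] by simp
qed

text \<open>The elements \<open>S h x\<close> live on the image of \<open>K\<close>, so they may be compared after applying \<open>\<tau>\<close>.\<close>

lemma indist_reflect:
  assumes \<tau>: "\<tau> \<in> hom PSh S T" and inj: "\<And>b. b \<in> Ob B \<Longrightarrow> inj_on (app \<tau> (omap K b)) (omap S (omap K b))"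
    and x: "x \<in> omap S a" and y: "y \<in> omap S a" and xy: "indist T a (app \<tau> a x) (app \<tau> a y)"
  shows "indist S a x y"
  unfolding indist_def
proof (intro ballI)
  fix b h assume b: "b \<in> Ob B" and h: "h \<in> hom A a (omap K b)"
  note S = morphism_obj(1)[OF \<tau>]
  have "app \<tau> (omap K b) (act S h x) = app \<tau> (omap K b) (act S h y)"
    using xy b h app_nat[OF \<tau> h x] app_nat[OF \<tau> h y] by (simp add: indist_def)
  then show "act S h x = act S h y"
    using inj_onD[OF inj[OF b]] act_in[OF S h x] act_in[OF S h y] by blast
qed

text \<open>
  The two classes of the factorization system, described by elements. They are identified with the
  stabilization of \<open>E\<close> and the localization of \<open>M\<close> in \<open>E'_cls_eq_collapsing\<close> and
  \<open>Mstar_cls_eq_separating\<close>.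
\<close>

definition collapsing where
  "collapsing = {e \<in> Mor PSh. cw_surj A e \<and>
     (\<forall>b\<in>Ob B. inj_on (app e (omap K b)) (omap (Src PSh e) (omap K b)))}"

definition separating where
  "separating = {m \<in> Mor PSh. \<forall>a\<in>Ob A. \<forall>x\<in>omap (Src PSh m) a. \<forall>y\<in>omap (Src PSh m) a.
     app m a x = app m a y \<longrightarrow> indist (Src PSh m) a x y \<longrightarrow> x = y}"

lemma collapsing_iff:
  "e \<in> hom PSh S T \<Longrightarrow> e \<in> collapsing \<longleftrightarrow> cw_surj A e \<and>
     (\<forall>b\<in>Ob B. inj_on (app e (omap K b)) (omap S (omap K b)))"
  by (simp add: collapsing_def hom_def)

lemma separating_iff:
  "m \<in> hom PSh S T \<Longrightarrow> m \<in> separating \<longleftrightarrow>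
     (\<forall>a\<in>Ob A. \<forall>x\<in>omap S a. \<forall>y\<in>omap S a. app m a x = app m a y \<longrightarrow> indist S a x y \<longrightarrow> x = y)"
  by (simp add: separating_def hom_def)

lemma iso_bij: "i \<in> hom PSh S T \<Longrightarrow> is_iso PSh i \<Longrightarrow> a \<in> Ob A \<Longrightarrow> bij_betw (app i a) (omap S a) (omap T a)"
  using iso_iff_bij by blast

lemma collapsing_comp_iso:
  assumes e: "e \<in> collapsing" and i: "is_iso PSh i" and ei: "Tgt PSh e = Src PSh i"
  shows "i \<odot>\<^bsub>PSh\<^esub> e \<in> collapsing"
proof -
  have eh: "e \<in> hom PSh (Src PSh e) (Src PSh i)" using e ei by (simp add: collapsing_def hom_def)
  have ih: "i \<in> hom PSh (Src PSh i) (Tgt PSh i)" using i by (simp add: is_iso_def hom_Src_Tgt)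
  have comp: "app (i \<odot>\<^bsub>PSh\<^esub> e) a x = app i a (app e a x)" if "a \<in> Ob A" "x \<in> omap (Src PSh e) a" for a x
    using app_comp[OF eh ih that] .
  have "app (i \<odot>\<^bsub>PSh\<^esub> e) a ` omap (Src PSh e) a = omap (Tgt PSh i) a" if a: "a \<in> Ob A" for a
  proof -
    have "app (i \<odot>\<^bsub>PSh\<^esub> e) a ` omap (Src PSh e) a = app i a ` app e a ` omap (Src PSh e) a"
      using comp[OF a] by (force simp: image_image)
    also have "\<dots> = app i a ` omap (Src PSh i) a"
      using e a cw_surj_iff[OF eh] collapsing_iff[OF eh] by simp
    finally show ?thesis using iso_bij[OF ih i a] by (simp add: bij_betw_def)
  qed
  moreover have "inj_on (app (i \<odot>\<^bsub>PSh\<^esub> e) (omap K b)) (omap (Src PSh e) (omap K b))" if b: "b \<in> Ob B" for b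
  proof (rule inj_onI)
    note Kb = functor_obj[OF K b]
    fix x y assume x: "x \<in> omap (Src PSh e) (omap K b)" and y: "y \<in> omap (Src PSh e) (omap K b)"
      and "app (i \<odot>\<^bsub>PSh\<^esub> e) (omap K b) x = app (i \<odot>\<^bsub>PSh\<^esub> e) (omap K b) y"
    then have "app e (omap K b) x = app e (omap K b) y"
      using comp[OF Kb] inj_onD[OF bij_betw_imp_inj_on[OF iso_bij[OF ih i Kb]]] app_in[OF eh Kb] by metis
    then show "x = y" using e collapsing_iff[OF eh] b x y by (meson inj_onD)
  qed
  ultimately show ?thesis
    using collapsing_iff[OF cat_comp[OF cat_PSh eh ih]] cw_surj_iff[OF cat_comp[OF cat_PSh eh ih]] by simp
qed

lemma separating_comp_iso:
  assumes m: "m \<in> separating" and i: "is_iso PSh i" and im: "Tgt PSh i = Src PSh m"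
  shows "m \<odot>\<^bsub>PSh\<^esub> i \<in> separating"
proof -
  have mh: "m \<in> hom PSh (Src PSh m) (Tgt PSh m)" using m by (simp add: separating_def hom_def)
  have ih: "i \<in> hom PSh (Src PSh i) (Src PSh m)" using i im by (simp add: is_iso_def hom_def)
  show ?thesis
    unfolding separating_iff[OF cat_comp[OF cat_PSh ih mh]]
  proof (intro ballI impI)
    fix a x y assume a: "a \<in> Ob A" and x: "x \<in> omap (Src PSh i) a" and y: "y \<in> omap (Src PSh i) a"
      and eq: "app (m \<odot>\<^bsub>PSh\<^esub> i) a x = app (m \<odot>\<^bsub>PSh\<^esub> i) a y" and xy: "indist (Src PSh i) a x y"
    have "app m a (app i a x) = app m a (app i a y)" using eq app_comp[OF ih mh a x] app_comp[OF ih mh a y]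
      by simp
    then have "app i a x = app i a y"
      using m separating_iff[OF mh] a app_in[OF ih a x] app_in[OF ih a y] indist_app[OF ih x y xy] by blast
    then show "x = y" using inj_onD[OF bij_betw_imp_inj_on[OF iso_bij[OF ih i a]]] x y by blast
  qed
qed

text \<open>
  Elements with equal image under a collapsing \<open>e\<close> are indistinguishable, because \<open>e\<close> is injective on
  the image of \<open>K\<close>. A separating \<open>m\<close> therefore forces the lifting to be well defined.
\<close>

lemma collapsing_separating_orthogonal:
  assumes e: "e \<in> collapsing" and m: "m \<in> separating"
  shows "orthogonal PSh e m"
  unfolding orthogonal_def
proof (intro ballI impI)
  let ?X = "Src PSh e" and ?Y = "Tgt PSh e" and ?S = "Src PSh m" and ?T = "Tgt PSh m"
  have eh: "e \<in> hom PSh ?X ?Y" and mh: "m \<in> hom PSh ?S ?T"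
    using e m by (simp_all add: collapsing_def separating_def hom_def)
  have surj: "cw_surj A e" and inj: "\<And>b. b \<in> Ob B \<Longrightarrow> inj_on (app e (omap K b)) (omap ?X (omap K b))"
    using e collapsing_iff[OF eh] by auto
  fix u v assume u: "u \<in> hom PSh ?X ?S" and v: "v \<in> hom PSh ?Y ?T" and sq: "v \<odot>\<^bsub>PSh\<^esub> e = m \<odot>\<^bsub>PSh\<^esub> u"
  have sq': "app v a (app e a x) = app m a (app u a x)" if "a \<in> Ob A" "x \<in> omap ?X a" for a x
    using app_comp[OF eh v that] app_comp[OF u mh that] sq by simp
  have "app u a x = app u a y"
    if a: "a \<in> Ob A" and x: "x \<in> omap ?X a" and y: "y \<in> omap ?X a" and xy: "app e a x = app e a y" for a x y
  proof -
    have "indist ?X a x y" by (rule indist_reflect[OF eh inj x y]) (simp_all add: xy indist_refl)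
    then have "indist ?S a (app u a x) (app u a y)" using indist_app[OF u x y] by blast
    moreover have "app m a (app u a x) = app m a (app u a y)" using sq'[OF a x] sq'[OF a y] xy by simp
    ultimately show ?thesis using m separating_iff[OF mh] a app_in[OF u a x] app_in[OF u a y] by blast
  qed
  from factor_through_surj[OF eh surj u this]
  obtain w where w: "w \<in> hom PSh ?Y ?S" "w \<odot>\<^bsub>PSh\<^esub> e = u"
    and we: "\<And>a x. a \<in> Ob A \<Longrightarrow> x \<in> omap ?X a \<Longrightarrow> app w a (app e a x) = app u a x" by blast
  have "m \<odot>\<^bsub>PSh\<^esub> w = v"
  proof (rule surj_epi[OF eh surj cat_comp[OF cat_PSh w(1) mh] v])
    fix a x assume a: "a \<in> Ob A" and x: "x \<in> omap ?X a"
    show "app (m \<odot>\<^bsub>PSh\<^esub> w) a (app e a x) = app v a (app e a x)"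
      using app_comp[OF w(1) mh a app_in[OF eh a x]] we[OF a x] sq'[OF a x] by simp
  qed
  moreover have "w' = w" if w': "w' \<in> hom PSh ?Y ?S" "w' \<odot>\<^bsub>PSh\<^esub> e = u" for w'
    by (rule surj_epi[OF eh surj w'(1) w(1)]) (use app_comp[OF eh w'(1)] app_comp[OF eh w(1)] w w' in simp)
  ultimately show "\<exists>!w. w \<in> hom PSh ?Y ?S \<and> w \<odot>\<^bsub>PSh\<^esub> e = u \<and> m \<odot>\<^bsub>PSh\<^esub> w = v"
    using w by blast
qed

text \<open>
  The middle object identifies indistinguishable elements that have the same image. On the image of
  \<open>K\<close> nothing is identified.
\<close>

lemma collapsing_separating_factorization:
  assumes f: "f \<in> Mor PSh"
  shows "\<exists>e\<in>collapsing. \<exists>m\<in>separating. Tgt PSh e = Src PSh m \<and> f = m \<odot>\<^bsub>PSh\<^esub> e"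
proof -
  let ?S = "Src PSh f" and ?T = "Tgt PSh f"
  have fh: "f \<in> hom PSh ?S ?T" using hom_Src_Tgt[OF f] .
  note S = morphism_obj(1)[OF fh]
  have "\<exists>Q q. q \<in> hom PSh ?S Q \<and> cw_surj A q \<and>
     (\<forall>a\<in>Ob A. \<forall>x\<in>omap ?S a. \<forall>y\<in>omap ?S a. app q a x = app q a y \<longleftrightarrow>
        app f a x = app f a y \<and> indist ?S a x y)"
  proof (rule quotient_exists[OF S])
    fix a b k x y assume k: "k \<in> hom A a b" and x: "x \<in> omap ?S a" and y: "y \<in> omap ?S a"
      and "app f a x = app f a y \<and> indist ?S a x y"
    then show "app f b (act ?S k x) = app f b (act ?S k y) \<and> indist ?S b (act ?S k x) (act ?S k y)"
      using app_nat[OF fh k x] app_nat[OF fh k y] indist_act[OF S k x y] by simp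
  qed (auto simp: indist_def)
  then obtain Q q where q: "q \<in> hom PSh ?S Q" "cw_surj A q"
    and qe: "\<And>a x y. a \<in> Ob A \<Longrightarrow> x \<in> omap ?S a \<Longrightarrow> y \<in> omap ?S a \<Longrightarrow>
       app q a x = app q a y \<longleftrightarrow> app f a x = app f a y \<and> indist ?S a x y" by blast
  have "\<exists>u\<in>hom PSh Q ?T. u \<odot>\<^bsub>PSh\<^esub> q = f \<and> (\<forall>a\<in>Ob A. \<forall>x\<in>omap ?S a. app u a (app q a x) = app f a x)"
    by (rule factor_through_surj[OF q fh]) (simp add: qe)
  then obtain u where u: "u \<in> hom PSh Q ?T" "u \<odot>\<^bsub>PSh\<^esub> q = f"
    and uq: "\<And>a x. a \<in> Ob A \<Longrightarrow> x \<in> omap ?S a \<Longrightarrow> app u a (app q a x) = app f a x" by blast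
  have qK: "inj_on (app q (omap K b)) (omap ?S (omap K b))" if b: "b \<in> Ob B" for b
    by (rule inj_onI) (use qe[OF functor_obj[OF K b]] indist_K[OF S b] in blast)
  have "q \<in> collapsing" using collapsing_iff[OF q(1)] q(2) qK by blast
  moreover have "u \<in> separating"
    unfolding separating_iff[OF u(1)]
  proof (intro ballI impI)
    fix a v w assume a: "a \<in> Ob A" and v: "v \<in> omap Q a" and w: "w \<in> omap Q a"
      and uvw: "app u a v = app u a w" and vw: "indist Q a v w"
    obtain x where x: "x \<in> omap ?S a" "app q a x = v" using surj_preimage[OF q a v] .
    obtain y where y: "y \<in> omap ?S a" "app q a y = w" using surj_preimage[OF q a w] .
    have "indist ?S a x y" using indist_reflect[OF q(1) qK x(1) y(1)] vw x(2) y(2) by simp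
    then show "v = w" using qe[OF a x(1) y(1)] uq[OF a x(1)] uq[OF a y(1)] uvw x(2) y(2) by simp
  qed
  ultimately show ?thesis using homD(3)[OF q(1)] homD(2)[OF u(1)] u(2) by metis
qed

lemma collapsing_separating_factorization_system: "factorization_system PSh collapsing separating"
  by (rule factorization_systemI[OF cat_PSh])
    (auto simp: collapsing_separating_orthogonal collapsing_comp_iso separating_comp_iso
      intro: collapsing_separating_factorization, auto simp: collapsing_def separating_def)

lemma collapsing_pullback:
  assumes f: "f \<in> collapsing" and pb: "is_pullback PSh f p f' p'"
  shows "f' \<in> collapsing"
proof -
  note fh = is_pullbackD(1)[OF pb] and ph = is_pullbackD(2)[OF pb]
  note el = elementwise_of_pullback[OF pb fh ph]
  let ?S = "Src PSh f" and ?E = "Src PSh p" and ?P = "Src PSh f'"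
  have surj: "cw_surj A f" and inj: "\<And>b. b \<in> Ob B \<Longrightarrow> inj_on (app f (omap K b)) (omap ?S (omap K b))"
    using f collapsing_iff[OF fh] by auto
  have "app f' a ` omap ?P a = omap ?E a" if a: "a \<in> Ob A" for a
  proof -
    have "\<exists>z\<in>omap ?P a. app f' a z = e" if e: "e \<in> omap ?E a" for e
    proof -
      obtain x where x: "x \<in> omap ?S a" "app f a x = app p a e"
        using surj_preimage[OF fh surj a app_in[OF ph a e]] .
      then show ?thesis using el(3) a e unfolding elementwise_pullback_def by blast
    qed
    then show ?thesis using app_in[OF el(1) a] by blast
  qed
  moreover have "inj_on (app f' (omap K b)) (omap ?P (omap K b))" if b: "b \<in> Ob B" for b
  proof (rule inj_onI)
    note Kb = functor_obj[OF K b]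
    fix z w assume z: "z \<in> omap ?P (omap K b)" and w: "w \<in> omap ?P (omap K b)"
      and zw: "app f' (omap K b) z = app f' (omap K b) w"
    note pz = app_in[OF el(2) Kb z] and pw = app_in[OF el(2) Kb w] and fz = app_in[OF el(1) Kb z]
    have sq: "app f (omap K b) (app p' (omap K b) t) = app p (omap K b) (app f' (omap K b) t)"
      if "t \<in> omap ?P (omap K b)" for t
      using el(3) Kb that unfolding elementwise_pullback_def by blast
    have eq: "app p' (omap K b) z = app p' (omap K b) w"
      using inj_onD[OF inj[OF b] _ pz pw] sq[OF z] sq[OF w] zw by simp
    have "\<exists>!t. t \<in> omap ?P (omap K b) \<and> app p' (omap K b) t = app p' (omap K b) z \<and>
        app f' (omap K b) t = app f' (omap K b) z"
      using el(3) Kb pz fz sq[OF z] unfolding elementwise_pullback_def by blast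
    then show "z = w" using z w zw eq by metis
  qed
  ultimately show ?thesis using collapsing_iff[OF el(1)] cw_surj_iff[OF el(1)] by simp
qed

text \<open>
  The property of \<open>e\<close> that makes its reflection invertible: the reflection only sees values on the
  image of \<open>K\<close>, and elements up to indistinguishability.
\<close>

definition dense_iso where
  "dense_iso S T e \<longleftrightarrow> (\<forall>b\<in>Ob B. bij_betw (app e (omap K b)) (omap S (omap K b)) (omap T (omap K b))) \<and>
     (\<forall>a\<in>Ob A. \<forall>y\<in>omap T a. \<exists>x\<in>omap S a. indist T a (app e a x) y)"

lemma dense_iso_inj:
  "dense_iso S T e \<Longrightarrow> b \<in> Ob B \<Longrightarrow> inj_on (app e (omap K b)) (omap S (omap K b))"
  by (simp add: dense_iso_def bij_betw_def)

lemma dense_iso_dense: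
  assumes "dense_iso S T e" "a \<in> Ob A" "y \<in> omap T a"
  obtains x where "x \<in> omap S a" "indist T a (app e a x) y"
  using assms unfolding dense_iso_def by blast

lemma collapsing_dense:
  assumes e: "e \<in> hom PSh S T" and c: "e \<in> collapsing"
  shows "dense_iso S T e"
proof -
  have surj: "\<And>a. a \<in> Ob A \<Longrightarrow> app e a ` omap S a = omap T a" using c collapsing_iff[OF e] cw_surj_iff[OF e]
    by blast
  have "\<exists>x\<in>omap S a. indist T a (app e a x) y" if a: "a \<in> Ob A" and y: "y \<in> omap T a" for a y
  proof -
    have "y \<in> app e a ` omap S a" using surj[OF a] y by simp
    then obtain x where "x \<in> omap S a" "y = app e a x" by (elim imageE)
    then show ?thesis by (intro bexI[of _ x]) (simp_all add: indist_refl)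
  qed
  moreover have "bij_betw (app e (omap K b)) (omap S (omap K b)) (omap T (omap K b))" if b: "b \<in> Ob B" for b
    using c collapsing_iff[OF e] surj[OF functor_obj[OF K b]] b by (simp add: bij_betw_def)
  ultimately show ?thesis unfolding dense_iso_def by blast
qed

text \<open>
  The lifting sends \<open>y\<close> to \<open>u x\<close> for any \<open>x\<close> with \<open>e x\<close> indistinguishable from \<open>y\<close>. It is well defined as
  \<open>P\<close> is separated, and lies over \<open>v\<close> as \<open>E\<close> is.
\<close>

lemma dense_orthogonal_separated:
  assumes e: "e \<in> hom PSh X Y" and de: "dense_iso X Y e" and g: "g \<in> hom PSh P E"
    and P: "separated P" and E: "separated E"
  shows "orthogonal PSh e g"
  unfolding orthogonal_def homD[OF e] homD[OF g]
proof (intro ballI impI)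
  fix u v assume u: "u \<in> hom PSh X P" and v: "v \<in> hom PSh Y E" and sq: "v \<odot>\<^bsub>PSh\<^esub> e = g \<odot>\<^bsub>PSh\<^esub> u"
  note Pob = morphism_obj(1)[OF g] and Y = morphism_obj(2)[OF e]
  have inj: "\<And>b. b \<in> Ob B \<Longrightarrow> inj_on (app e (omap K b)) (omap X (omap K b))"
    by (rule dense_iso_inj[OF de])
  have sepP: "x = y" if "a \<in> Ob A" "x \<in> omap P a" "y \<in> omap P a" "indist P a x y" for a x y
    using P that by (simp add: separated_def)
  have sepE: "x = y" if "a \<in> Ob A" "x \<in> omap E a" "y \<in> omap E a" "indist E a x y" for a x y
    using E that by (simp add: separated_def)
  have u_eq: "app u a x = app u a x'"
    if a: "a \<in> Ob A" and x: "x \<in> omap X a" and x': "x' \<in> omap X a"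
      and xx: "indist Y a (app e a x) (app e a x')" for a x x'
    by (rule sepP[OF a app_in[OF u a x] app_in[OF u a x'] indist_app[OF u x x' indist_reflect[OF e inj x x'
      xx]]])
  define s where "s a y = (SOME x. x \<in> omap X a \<and> indist Y a (app e a x) y)" for a y
  have s: "s a y \<in> omap X a" "indist Y a (app e a (s a y)) y" if "a \<in> Ob A" "y \<in> omap Y a" for a y
  proof -
    have "\<exists>x. x \<in> omap X a \<and> indist Y a (app e a x) y" using dense_iso_dense[OF de that] by blast
    from someI_ex[OF this] show "s a y \<in> omap X a" "indist Y a (app e a (s a y)) y" by (auto simp: s_def)
  qed
  let ?w = "tr A Y P (\<lambda>a y. app u a (s a y))"
  have w: "?w \<in> hom PSh Y P"
  proof (rule tr_hom[OF Y Pob])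
    fix a y assume "a \<in> Ob A" "y \<in> omap Y a"
    then show "app u a (s a y) \<in> omap P a" using app_in[OF u _ s(1)] by simp
  next
    fix a b k y assume k: "k \<in> hom A a b" and y: "y \<in> omap Y a"
    note ob = hom_obj[OF cat_A k] and X = morphism_obj(1)[OF e]
    note ky = act_in[OF Y k y] and sy = s[OF ob(1) y]
    have i: "indist Y b (app e b (act X k (s a y))) (act Y k y)"
      using indist_act[OF Y k app_in[OF e ob(1) sy(1)] y sy(2)] app_nat[OF e k sy(1)] by simp
    have "app u b (s b (act Y k y)) = app u b (act X k (s a y))"
      by (rule u_eq[OF ob(2) s(1)[OF ob(2) ky] act_in[OF X k sy(1)]
        indist_trans[OF s(2)[OF ob(2) ky] indist_sym[OF i]]])
    then show "app u b (s b (act Y k y)) = act P k (app u a (s a y))" using app_nat[OF u k sy(1)] by simp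
  qed
  have we: "app ?w a (app e a x) = app u a x" if a: "a \<in> Ob A" and x: "x \<in> omap X a" for a x
    unfolding app_tr[OF a app_in[OF e a x]]
    by (rule u_eq[OF a s(1)[OF a app_in[OF e a x]] x s(2)[OF a app_in[OF e a x]]])
  have "?w \<odot>\<^bsub>PSh\<^esub> e = u"
    by (rule morphism_ext[OF cat_comp[OF cat_PSh e w] u]) (simp add: app_comp[OF e w] we)
  moreover have "g \<odot>\<^bsub>PSh\<^esub> ?w = v"
  proof (rule morphism_ext[OF cat_comp[OF cat_PSh w g] v])
    fix a y assume a: "a \<in> Ob A" and y: "y \<in> omap Y a"
    note sy = s[OF a y]
    have "app v a (app e a (s a y)) = app g a (app u a (s a y))"
      using app_comp[OF e v a sy(1)] app_comp[OF u g a sy(1)] sq by simp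
    then have "indist E a (app g a (app u a (s a y))) (app v a y)"
      using indist_app[OF v app_in[OF e a sy(1)] y sy(2)] by simp
    then have "app g a (app u a (s a y)) = app v a y"
      using sepE[OF a app_in[OF g a app_in[OF u a sy(1)]] app_in[OF v a y]] by simp
    then show "app (g \<odot>\<^bsub>PSh\<^esub> ?w) a y = app v a y" using app_comp[OF w g a y] app_tr[OF a y] by simp
  qed
  moreover have "w' = ?w" if w': "w' \<in> hom PSh Y P" "w' \<odot>\<^bsub>PSh\<^esub> e = u" for w'
  proof (rule morphism_ext[OF w'(1) w])
    fix a y assume a: "a \<in> Ob A" and y: "y \<in> omap Y a"
    note sy = s[OF a y]
    have "indist P a (app w' a (app e a (s a y))) (app w' a y)"
      using indist_app[OF w'(1) app_in[OF e a sy(1)] y sy(2)] .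
    then have "app w' a (app e a (s a y)) = app w' a y"
      by (rule sepP[OF a app_in[OF w'(1) a app_in[OF e a sy(1)]] app_in[OF w'(1) a y]])
    then show "app w' a y = app ?w a y"
      using app_comp[OF e w'(1) a sy(1)] w'(2) app_tr[OF a y] by simp
  qed
  ultimately show "\<exists>!w. w \<in> hom PSh Y P \<and> w \<odot>\<^bsub>PSh\<^esub> e = u \<and> g \<odot>\<^bsub>PSh\<^esub> w = v" using w by blast
qed

section \<open>Covers by coproducts of representables\<close>

lemma cogenerating_eqI:
  assumes cog: "cogenerating A (omap K ` Ob B)" and k: "k \<in> hom A a c" and l: "l \<in> hom A a c"
    and eq: "\<And>b h. b \<in> Ob B \<Longrightarrow> h \<in> hom A c (omap K b) \<Longrightarrow> h \<odot>\<^bsub>A\<^esub> k = h \<odot>\<^bsub>A\<^esub> l"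
  shows "k = l"
proof (rule ccontr)
  assume "k \<noteq> l"
  moreover have "\<forall>f\<in>Mor A. \<forall>g\<in>Mor A. Src A f = Src A g \<longrightarrow> Tgt A f = Tgt A g \<longrightarrow> f \<noteq> g \<longrightarrow>
      (\<exists>N\<in>omap K ` Ob B. \<exists>h\<in>hom A (Tgt A f) N. h \<odot>\<^bsub>A\<^esub> f \<noteq> h \<odot>\<^bsub>A\<^esub> g)"
    using cog by (simp add: cogenerating_def)
  ultimately have "\<exists>N\<in>omap K ` Ob B. \<exists>h\<in>hom A c N. h \<odot>\<^bsub>A\<^esub> k \<noteq> h \<odot>\<^bsub>A\<^esub> l"
    using homD[OF k] homD[OF l] by metis
  then show False using eq by blast
qed

lemma small_hom: "a \<in> Ob A \<Longrightarrow> c \<in> Ob A \<Longrightarrow> small TYPE('u) (hom A a c)"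
  using small_A by (simp add: small_homs_def)

text \<open>
  An element of a coproduct of representables is a summand \<open>(g, t)\<close> with a morphism out of \<open>g\<close>.
  Morphisms into the image of \<open>K\<close> separate different morphisms because \<open>K\<close> is cogenerating, and
  different summands because there is such a morphism at all.
\<close>

lemma separated_cover_exists:
  assumes T: "T \<in> Ob PSh" and cog: "cogenerating A (omap K ` Ob B)"
    and ess: "essentially_small TYPE('u) A" and into: "all_map_into A (omap K ` Ob B)"
  shows "\<exists>E p. p \<in> hom PSh E T \<and> cw_surj A p \<and> separated E"
proof -
  obtain G where G: "G \<subseteq> Ob A" "small TYPE('u) G" and Giso: "\<And>a. a \<in> Ob A \<Longrightarrow> \<exists>g\<in>G. \<exists>f\<in>hom A a g. is_iso A f"
    using ess by (auto simp: essentially_small_def)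
  define X where "X c = (SIGMA g:G. omap T g \<times> hom A g c)" for c
  define \<alpha> :: "'f \<Rightarrow> 'a \<times> 'u \<times> 'f \<Rightarrow> 'a \<times> 'u \<times> 'f" where
    "\<alpha> l = (\<lambda>(g, t, k). (g, t, l \<odot>\<^bsub>A\<^esub> k))" for l
  have "\<exists>E (d :: 'a \<Rightarrow> 'u \<Rightarrow> 'a \<times> 'u \<times> 'f). E \<in> Ob PSh \<and> (\<forall>a\<in>Ob A. bij_betw (d a) (omap E a) (X a)) \<and>
     (\<forall>a b. \<forall>f\<in>hom A a b. \<forall>u\<in>omap E a. d b (act E f u) = \<alpha> f (d a u))"
  proof (rule decoded_functor_exists)
    fix c assume c: "c \<in> Ob A"
    show "small TYPE('u) (X c)"
      unfolding X_def using G small_omap[OF T] small_hom[OF _ c] by (intro small_Sigma univ) auto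
  next
    fix a b f x assume "f \<in> hom A a b" "x \<in> X a"
    then show "\<alpha> f x \<in> X b" using cat_comp[OF cat_A] by (auto simp: X_def \<alpha>_def)
  next
    fix a x assume "a \<in> Ob A" "x \<in> X a"
    then show "\<alpha> (Idn A a) x = x" using cat_idl[OF cat_A] by (auto simp: X_def \<alpha>_def)
  next
    fix a b c f g x assume "f \<in> hom A a b" "g \<in> hom A b c" "x \<in> X a"
    then show "\<alpha> (g \<odot>\<^bsub>A\<^esub> f) x = \<alpha> g (\<alpha> f x)" using cat_assoc[OF cat_A] by (auto simp: X_def \<alpha>_def)
  qed
  then obtain E and d :: "'a \<Rightarrow> 'u \<Rightarrow> 'a \<times> 'u \<times> 'f" where E: "E \<in> Ob PSh"
    and bij: "\<And>a. a \<in> Ob A \<Longrightarrow> bij_betw (d a) (omap E a) (X a)"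
    and dact: "\<And>a b f u. f \<in> hom A a b \<Longrightarrow> u \<in> omap E a \<Longrightarrow> d b (act E f u) = \<alpha> f (d a u)" by blast
  have d: "\<exists>g t k. d c u = (g, t, k) \<and> g \<in> G \<and> g \<in> Ob A \<and> t \<in> omap T g \<and> k \<in> hom A g c"
    if "c \<in> Ob A" "u \<in> omap E c" for c u
    using bij_betw_apply[OF bij[OF that(1)] that(2)] G(1) by (auto simp: X_def)
  define \<phi> where "\<phi> c u = act T (snd (snd (d c u))) (fst (snd (d c u)))" for c u
  have p: "tr A E T \<phi> \<in> hom PSh E T"
  proof (rule tr_hom[OF E T])
    fix c u assume c: "c \<in> Ob A" and u: "u \<in> omap E c"
    show "\<phi> c u \<in> omap T c" using d[OF c u] act_in[OF T] by (auto simp: \<phi>_def)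
  next
    fix c c' l u assume l: "l \<in> hom A c c'" and u: "u \<in> omap E c"
    obtain g t k where k: "d c u = (g, t, k)" "t \<in> omap T g" "k \<in> hom A g c"
      using d[OF hom_obj(1)[OF cat_A l] u] by blast
    show "\<phi> c' (act E l u) = act T l (\<phi> c u)"
      using act_comp[OF T k(3) l k(2)] dact[OF l u] k(1) by (simp add: \<phi>_def \<alpha>_def)
  qed
  have "app (tr A E T \<phi>) c ` omap E c = omap T c" if c: "c \<in> Ob A" for c
  proof -
    have "\<exists>u\<in>omap E c. \<phi> c u = s" if s: "s \<in> omap T c" for s
    proof -
      obtain g f where g: "g \<in> G" and f: "f \<in> hom A c g" "is_iso A f" using Giso[OF c] by blast
      obtain k where k: "k \<in> hom A g c" "k \<odot>\<^bsub>A\<^esub> f = Idn A c" using iso_inverse[OF f] by metis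
      have "(g, act T f s, k) \<in> X c" using g k(1) act_in[OF T f(1) s] by (simp add: X_def)
      then obtain u where u: "u \<in> omap E c" "d c u = (g, act T f s, k)" using bij[OF c]
        by (metis bij_betw_imp_surj_on imageE)
      have "\<phi> c u = s" using act_comp[OF T f(1) k(1) s] k(2) act_id[OF T c s] u(2) by (simp add: \<phi>_def)
      then show ?thesis using u(1) by blast
    qed
    then have "\<phi> c ` omap E c = omap T c" using app_in[OF p c] app_tr[OF c]
      by (metis (no_types, lifting) image_eqI image_subsetI subsetI subset_antisym)
    then show ?thesis using app_tr[OF c] by (metis (no_types, lifting) image_cong)
  qed
  then have surj: "cw_surj A (tr A E T \<phi>)" using cw_surj_iff[OF p] by blast
  have "separated E"
    unfolding separated_def
  proof (intro ballI impI)
    fix c u v assume c: "c \<in> Ob A" and u: "u \<in> omap E c" and v: "v \<in> omap E c" and uv: "indist E c u v"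
    obtain g t k where k: "d c u = (g, t, k)" "k \<in> hom A g c" using d[OF c u] by blast
    obtain g' t' k' where k': "d c v = (g', t', k')" "k' \<in> hom A g' c" using d[OF c v] by blast
    have eq: "(g, t, h \<odot>\<^bsub>A\<^esub> k) = (g', t', h \<odot>\<^bsub>A\<^esub> k')" if b: "b \<in> Ob B" and h: "h \<in> hom A c (omap K b)"
      for b h
    proof -
      have "act E h u = act E h v" using uv b h by (simp add: indist_def)
      then have "\<alpha> h (d c u) = \<alpha> h (d c v)" using dact[OF h u] dact[OF h v] by simp
      then show ?thesis by (simp add: k k' \<alpha>_def)
    qed
    obtain b h where "b \<in> Ob B" "h \<in> hom A c (omap K b)" using into c unfolding all_map_into_def by blast
    from eq[OF this] have gt: "g = g'" "t = t'" by auto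
    have "k = k'"
      by (rule cogenerating_eqI[OF cog k(2)]) (use k' gt eq in auto)
    then have "d c u = d c v" using k k' gt by simp
    then show "u = v" using inj_onD[OF bij_betw_imp_inj_on[OF bij[OF c]]] u v by blast
  qed
  then show ?thesis using p surj by blast
qed

text \<open>
  Pulling \<open>f\<close> back along the element \<open>t\<close>, seen as a morphism from a representable, produces
  a preimage of \<open>t\<close> up to an endomorphism of \<open>a\<close> that no morphism into the image of \<open>K\<close> separates from
  the identity.
\<close>

lemma surj_of_stably_dense:
  assumes f: "f \<in> hom PSh S T" and cog: "cogenerating A (omap K ` Ob B)"
    and st: "\<And>p f' p'. is_pullback PSh f p f' p' \<Longrightarrow> dense_iso (Src PSh f') (Src PSh p) f'"
  shows "cw_surj A f"
proof -
  note T = morphism_obj(2)[OF f]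
  have "\<exists>x\<in>omap S a. app f a x = t" if a: "a \<in> Ob A" and t: "t \<in> omap T a" for a t
  proof -
    have "\<exists>Y (d :: 'a \<Rightarrow> 'u \<Rightarrow> 'f). Y \<in> Ob PSh \<and> (\<forall>c\<in>Ob A. bij_betw (d c) (omap Y c) (hom A a c)) \<and>
       (\<forall>c e. \<forall>l\<in>hom A c e. \<forall>u\<in>omap Y c. d e (act Y l u) = l \<odot>\<^bsub>A\<^esub> d c u)"
      by (rule decoded_functor_exists)
        (use small_hom[OF a] cat_comp[OF cat_A] cat_idl[OF cat_A] cat_assoc[OF cat_A] in blast)+
    then obtain Y and d :: "'a \<Rightarrow> 'u \<Rightarrow> 'f" where Y: "Y \<in> Ob PSh"
      and bij: "\<And>c. c \<in> Ob A \<Longrightarrow> bij_betw (d c) (omap Y c) (hom A a c)"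
      and dact: "\<And>c e l u. l \<in> hom A c e \<Longrightarrow> u \<in> omap Y c \<Longrightarrow> d e (act Y l u) = l \<odot>\<^bsub>A\<^esub> d c u" by blast
    note d = bij_betw_apply[OF bij]
    let ?p = "tr A Y T (\<lambda>c u. act T (d c u) t)"
    have p: "?p \<in> hom PSh Y T"
    proof (rule tr_hom[OF Y T])
      fix c u assume "c \<in> Ob A" "u \<in> omap Y c"
      then show "act T (d c u) t \<in> omap T c" using act_in[OF T d t] by simp
    next
      fix c e l u assume l: "l \<in> hom A c e" and u: "u \<in> omap Y c"
      show "act T (d e (act Y l u)) t = act T l (act T (d c u) t)"
        using dact[OF l u] act_comp[OF T d[OF hom_obj(1)[OF cat_A l] u] l t] by simp
    qed
    obtain P f' p' where f': "f' \<in> hom PSh P Y" and p': "p' \<in> hom PSh P S"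
      and el: "elementwise_pullback S Y P f ?p f' p'"
      using elementwise_pullback_exists[OF f p] by blast
    have dense: "dense_iso P Y f'"
      using st[OF pullback_of_elementwise[OF f p f' p' el]] homD(2)[OF f'] homD(2)[OF p] by simp
    have i: "Idn A a \<in> d a ` omap Y a" using bij[OF a] cat_id[OF cat_A a] by (simp add: bij_betw_def)
    then obtain u where u: "u \<in> omap Y a" "d a u = Idn A a" by auto
    obtain z where z: "z \<in> omap P a" "indist Y a (app f' a z) u" using dense_iso_dense[OF dense a u(1)] .
    note fz = app_in[OF f' a z(1)]
    have "d a (app f' a z) = Idn A a"
    proof (rule cogenerating_eqI[OF cog d[OF a fz] cat_id[OF cat_A a]])
      fix b h assume b: "b \<in> Ob B" and h: "h \<in> hom A a (omap K b)"
      have "act Y h (app f' a z) = act Y h u" using z(2) b h by (simp add: indist_def)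
      then show "h \<odot>\<^bsub>A\<^esub> d a (app f' a z) = h \<odot>\<^bsub>A\<^esub> Idn A a" using dact[OF h fz] dact[OF h u(1)] u(2) by simp
    qed
    then have "app ?p a (app f' a z) = t" using app_tr[OF a fz] act_id[OF T a t] by simp
    then have "app f a (app p' a z) = t" using el a z(1) by (simp add: elementwise_pullback_def)
    then show ?thesis using app_in[OF p' a z(1)] by blast
  qed
  then show ?thesis using cw_surj_iff[OF f] app_in[OF f] by blast
qed

text \<open>
  Together with \<open>dense_orthogonal_separated\<close> this puts the pullback of a separating morphism along a
  separated cover in \<open>M\<close>.
\<close>

lemma pullback_of_separating_separated:
  assumes f: "f \<in> hom PSh S T" and p: "p \<in> hom PSh E T" and f': "f' \<in> hom PSh P E"
    and p': "p' \<in> hom PSh P S"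
    and el: "elementwise_pullback S E P f p f' p'" and sep: "f \<in> separating" and E: "separated E"
  shows "separated P"
  unfolding separated_def
proof (intro ballI impI)
  fix a z w assume a: "a \<in> Ob A" and z: "z \<in> omap P a" and w: "w \<in> omap P a" and zw: "indist P a z w"
  have f'zw: "app f' a z = app f' a w"
    using E a app_in[OF f' a z] app_in[OF f' a w] indist_app[OF f' z w zw] by (simp add: separated_def)
  have sq: "app f a (app p' a t) = app p a (app f' a t)" if "t \<in> omap P a" for t
    using el a that by (simp add: elementwise_pullback_def)
  have "app p' a z = app p' a w"
    using sep separating_iff[OF f] a app_in[OF p' a z] app_in[OF p' a w] indist_app[OF p' z w zw] sq[OF z]
      sq[OF w] f'zw
    by simp
  moreover have "\<exists>!t. t \<in> omap P a \<and> app p' a t = app p' a z \<and> app f' a t = app f' a z"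
    using el a app_in[OF p' a z] app_in[OF f' a z] sq[OF z] unfolding elementwise_pullback_def by blast
  ultimately show "z = w" using z w f'zw by metis
qed

text \<open>
  Elements \<open>x, y\<close> with equal image lift to pairs over the same element \<open>e\<close>, and these pairs are
  indistinguishable when \<open>x\<close> and \<open>y\<close> are.
\<close>

lemma separating_descends:
  assumes f: "f \<in> hom PSh S T" and p: "p \<in> hom PSh E T" "cw_surj A p"
    and f': "f' \<in> hom PSh P E" and p': "p' \<in> hom PSh P S"
    and el: "elementwise_pullback S E P f p f' p'" and sep: "f' \<in> separating"
  shows "f \<in> separating"
  unfolding separating_iff[OF f]
proof (intro ballI impI)
  fix a x y assume a: "a \<in> Ob A" and x: "x \<in> omap S a" and y: "y \<in> omap S a"
    and fxy: "app f a x = app f a y" and xy: "indist S a x y"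
  obtain e where e: "e \<in> omap E a" "app p a e = app f a x" using surj_preimage[OF p a app_in[OF f a x]] .
  have ex: "\<exists>!z. z \<in> omap P c \<and> app p' c z = s \<and> app f' c z = e"
    if "c \<in> Ob A" "s \<in> omap S c" "e \<in> omap E c" "app f c s = app p c e" for c s e
    using el that by (simp add: elementwise_pullback_def)
  obtain z where z: "z \<in> omap P a" "app p' a z = x" "app f' a z = e" using ex[OF a x e(1)] e(2) by auto
  obtain w where w: "w \<in> omap P a" "app p' a w = y" "app f' a w = e" using ex[OF a y e(1)] e(2) fxy by auto
  have zw: "indist P a z w"
    unfolding indist_def
  proof (intro ballI)
    fix b h assume b: "b \<in> Ob B" and h: "h \<in> hom A a (omap K b)"
    note Kb = functor_obj[OF K b] and P = morphism_obj(1)[OF f']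
    note hz = act_in[OF P h z(1)] and hw = act_in[OF P h w(1)]
    have eq: "app p' (omap K b) (act P h z) = app p' (omap K b) (act P h w)"
      "app f' (omap K b) (act P h z) = app f' (omap K b) (act P h w)"
      using app_nat[OF p' h z(1)] app_nat[OF p' h w(1)] app_nat[OF f' h z(1)] app_nat[OF f' h w(1)] z w xy b
        h
      by (simp_all add: indist_def)
    have "app f (omap K b) (app p' (omap K b) (act P h z)) =
      app p (omap K b) (app f' (omap K b) (act P h z))"
      using el Kb hz by (simp add: elementwise_pullback_def)
    from ex[OF Kb app_in[OF p' Kb hz] app_in[OF f' Kb hz] this] show "act P h z = act P h w"
      using hz hw eq by metis
  qed
  have "z = w"
    using sep[unfolded separating_iff[OF f'], rule_format, OF a z(1) w(1) _ zw] z(3) w(3) by simp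
  then show "x = y" using z(2) w(2) by simp
qed

end

section \<open>Identification of the reflection and its classes\<close>

locale kan_adjunction = kan_extension A U B K
  for A :: "('a, 'f) cat" and U :: "'u itself" and B :: "('b, 'g) cat" and K +
  fixes R \<theta> \<epsilon>
  assumes ran: "pointwise_ran_adjunction A B (SetCat :: ('u set, 'u smap) cat) K R \<theta> \<epsilon>"
begin

lemma theta_hom: "S \<in> Ob PSh \<Longrightarrow> \<theta> S \<in> hom PSh S (omap R (omap SK S))"
  using ran nat_trans_hom[OF adjunctionD(3), of PSh B.PSh SK R \<theta> \<epsilon> S]
  by (simp add: pointwise_ran_adjunction_def)

text \<open>
  The projection of \<open>\<theta> x\<close> at \<open>h : a \<rightarrow> K b\<close> is \<open>S h x\<close>, by naturality of \<open>\<theta>\<close> and a triangle identity.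
\<close>

lemma theta_kernel:
  assumes S: "S \<in> Ob PSh" and a: "a \<in> Ob A" and x: "x \<in> omap S a" and y: "y \<in> omap S a"
  shows "app (\<theta> S) a x = app (\<theta> S) a y \<longleftrightarrow> indist S a x y"
proof -
  let ?T = "omap SK S"
  have adj: "adjunction PSh B.PSh SK R \<theta> \<epsilon>" using ran by (simp add: pointwise_ran_adjunction_def)
  note R = adjunctionD(2)[OF adj] and T = functor_obj[OF SK_functor S]
  have lim: "is_limit (comma B A a K) SetCat (?T \<circ>\<^sub>F comma_proj) (omap (omap R ?T) a)
      (\<lambda>(b, h). datum (\<epsilon> ?T) b \<odot>\<^bsub>SetCat\<^esub> amap (omap R ?T) h)"
    using ran T a unfolding pointwise_ran_adjunction_def by blast
  have \<epsilon>: "\<epsilon> ?T \<in> hom B.PSh (omap SK (omap R ?T)) ?T"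
    using nat_trans_hom[OF adjunctionD(4)[OF adj] T] by simp
  note RT = functor_obj[OF R T] and \<theta> = theta_hom[OF S]
  note SK\<theta> = functor_hom[OF SK_functor \<theta>]
  have tri: "app (\<epsilon> ?T) b (app (\<theta> S) (omap K b) w) = w" if b: "b \<in> Ob B" and w: "w \<in> omap S (omap K b)"
    for b w
  proof -
    have w': "w \<in> omap ?T b" using b w by (simp add: omap_SK)
    have "app (\<epsilon> ?T \<odot>\<^bsub>B.PSh\<^esub> amap SK (\<theta> S)) b w = w"
      using adjunctionD(5)[OF adj S] B.app_id[OF T b w'] by simp
    then show ?thesis using B.app_comp[OF SK\<theta> \<epsilon> b w'] app_SK[OF \<theta> b] by simp
  qed
  have proj: "datum (datum (\<epsilon> ?T) b \<odot>\<^bsub>SetCat\<^esub> amap (omap R ?T) h) (app (\<theta> S) a v) = act S h v"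
    if b: "b \<in> Ob B" and h: "h \<in> hom A a (omap K b)" and v: "v \<in> omap S a" for b h v
  proof -
    have 1: "amap (omap R ?T) h \<in> hom SetCat (omap (omap R ?T) a) (omap (omap R ?T) (omap K b))"
      using functor_hom[OF set_functor[OF RT] h] .
    have "datum (\<epsilon> ?T) b \<in> hom SetCat (omap (omap SK (omap R ?T)) b) (omap ?T b)"
      using nat_trans_hom[of B SetCat "omap SK (omap R ?T)" ?T "datum (\<epsilon> ?T)" b] B.morphism_eq[OF \<epsilon>] b
        by auto
    then have 2: "datum (\<epsilon> ?T) b \<in> hom SetCat (omap (omap R ?T) (omap K b)) (omap ?T b)" using b
      by (simp add: omap_SK)
    have "datum (datum (\<epsilon> ?T) b \<odot>\<^bsub>SetCat\<^esub> amap (omap R ?T) h) (app (\<theta> S) a v) =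
        app (\<epsilon> ?T) b (act (omap R ?T) h (app (\<theta> S) a v))"
      using SetCat_comp_apply[OF 1 2 app_in[OF \<theta> a v]] by (simp add: app_def act_def)
    then show ?thesis using app_nat[OF \<theta> h v] tri[OF b act_in[OF S h v]] by simp
  qed
  show ?thesis
  proof
    assume eq: "app (\<theta> S) a x = app (\<theta> S) a y"
    show "indist S a x y"
      unfolding indist_def using proj[OF _ _ x] proj[OF _ _ y] eq by metis
  next
    assume xy: "indist S a x y"
    show "app (\<theta> S) a x = app (\<theta> S) a y"
    proof (rule limit_elements_eqI[OF univ lim app_in[OF \<theta> a x] app_in[OF \<theta> a y]])
      fix j assume "j \<in> Ob (comma B A a K)"
      then obtain b h where j: "j = (b, h)" and b: "b \<in> Ob B" and h: "h \<in> hom A a (omap K b)"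
        by (cases j) (auto simp: comma_Ob)
      show "datum ((\<lambda>(b, h). datum (\<epsilon> ?T) b \<odot>\<^bsub>SetCat\<^esub> amap (omap R ?T) h) j) (app (\<theta> S) a x) =
          datum ((\<lambda>(b, h). datum (\<epsilon> ?T) b \<odot>\<^bsub>SetCat\<^esub> amap (omap R ?T) h) j) (app (\<theta> S) a y)"
        unfolding j prod.case proj[OF b h x] proj[OF b h y] using xy b h by (simp add: indist_def)
    qed
  qed
qed

lemma in_Mono_iff: "S \<in> Ob PSh \<Longrightarrow> in_Mono A \<theta> S \<longleftrightarrow> separated S"
  unfolding in_Mono_def separated_def cw_inj_iff[OF theta_hom] inj_on_def using theta_kernel by blast

lemma unit_factorization_exists: "\<exists>\<eta> \<mu>. unit_factorization A \<theta> \<eta> \<mu>"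
proof -
  have "\<forall>S\<in>Ob PSh. \<exists>q i. q \<in> Mor PSh \<and> i \<in> Mor PSh \<and> Src PSh q = S \<and> Tgt PSh q = Src PSh i \<and>
      \<theta> S = i \<odot>\<^bsub>PSh\<^esub> q \<and> cw_surj A q \<and> cw_inj A i"
  proof
    fix S assume S: "S \<in> Ob PSh"
    obtain M q i where q: "q \<in> hom PSh S M" and i: "i \<in> hom PSh M (omap R (omap SK S))"
      and *: "cw_surj A q" "cw_inj A i" "i \<odot>\<^bsub>PSh\<^esub> q = \<theta> S"
      by (rule image_factorization[OF theta_hom[OF S]])
    show "\<exists>q i. q \<in> Mor PSh \<and> i \<in> Mor PSh \<and> Src PSh q = S \<and> Tgt PSh q = Src PSh i \<and>
        \<theta> S = i \<odot>\<^bsub>PSh\<^esub> q \<and> cw_surj A q \<and> cw_inj A i"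
      by (rule exI[of _ q], rule exI[of _ i]) (use homD[OF q] homD[OF i] * in simp)
  qed
  then show ?thesis unfolding unit_factorization_def by metis
qed

end

locale unit_factorized = kan_adjunction A U B K R \<theta> \<epsilon>
  for A :: "('a, 'f) cat" and U :: "'u itself" and B :: "('b, 'g) cat" and K R \<theta> \<epsilon> +
  fixes \<eta> \<mu>
  assumes uf: "unit_factorization A \<theta> \<eta> \<mu>"
begin

lemma eta:
  assumes S: "S \<in> Ob PSh"
  shows "\<eta> S \<in> hom PSh S (Tgt PSh (\<eta> S))" "cw_surj A (\<eta> S)"
    "\<And>a x y. a \<in> Ob A \<Longrightarrow> x \<in> omap S a \<Longrightarrow> y \<in> omap S a \<Longrightarrow> app (\<eta> S) a x = app (\<eta> S) a y \<longleftrightarrow> indist S a x y"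
proof -
  have u: "\<eta> S \<in> Mor PSh" "\<mu> S \<in> Mor PSh" "Src PSh (\<eta> S) = S" "Tgt PSh (\<eta> S) = Src PSh (\<mu> S)"
    "\<theta> S = \<mu> S \<odot>\<^bsub>PSh\<^esub> \<eta> S" "cw_surj A (\<eta> S)" "cw_inj A (\<mu> S)"
    using uf S unfolding unit_factorization_def by blast+
  show \<eta>: "\<eta> S \<in> hom PSh S (Tgt PSh (\<eta> S))" using u by (intro homI) auto
  have \<mu>: "\<mu> S \<in> hom PSh (Tgt PSh (\<eta> S)) (Tgt PSh (\<mu> S))" using u by (intro homI) auto
  show "cw_surj A (\<eta> S)" using u by simp
  fix a x y assume a: "a \<in> Ob A" and x: "x \<in> omap S a" and y: "y \<in> omap S a"
  have "inj_on (app (\<mu> S) a) (omap (Tgt PSh (\<eta> S)) a)" using u(7) cw_inj_iff[OF \<mu>] a by blast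
  then have "app (\<eta> S) a x = app (\<eta> S) a y \<longleftrightarrow> app (\<mu> S) a (app (\<eta> S) a x) = app (\<mu> S) a (app (\<eta> S) a y)"
    using app_in[OF \<eta> a x] app_in[OF \<eta> a y] by (simp add: inj_on_eq_iff)
  then show "app (\<eta> S) a x = app (\<eta> S) a y \<longleftrightarrow> indist S a x y"
    using app_comp[OF \<eta> \<mu> a x] app_comp[OF \<eta> \<mu> a y] u(5) theta_kernel[OF S a x y] by simp
qed

lemma eta_K_inj:
  assumes S: "S \<in> Ob PSh" and b: "b \<in> Ob B"
  shows "inj_on (app (\<eta> S) (omap K b)) (omap S (omap K b))"
  by (rule inj_onI) (use eta(3)[OF S functor_obj[OF K b]] indist_K[OF S b] in blast)

lemma eta_collapsing: "S \<in> Ob PSh \<Longrightarrow> \<eta> S \<in> collapsing"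
  using collapsing_iff[OF eta(1)] eta(2) eta_K_inj by blast

lemma reflection_separated:
  assumes S: "S \<in> Ob PSh"
  shows "separated (Tgt PSh (\<eta> S))"
  unfolding separated_def
proof (intro ballI impI)
  fix a v w assume a: "a \<in> Ob A" and v: "v \<in> omap (Tgt PSh (\<eta> S)) a" and w: "w \<in> omap (Tgt PSh (\<eta> S)) a"
    and vw: "indist (Tgt PSh (\<eta> S)) a v w"
  note \<eta> = eta[OF S]
  obtain x where x: "x \<in> omap S a" "app (\<eta> S) a x = v" using surj_preimage[OF \<eta>(1,2) a v] .
  obtain y where y: "y \<in> omap S a" "app (\<eta> S) a y = w" using surj_preimage[OF \<eta>(1,2) a w] .
  have "indist S a x y" using indist_reflect[OF \<eta>(1) eta_K_inj[OF S] x(1) y(1)] vw x(2) y(2) by simp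
  then show "v = w" using \<eta>(3)[OF a x(1) y(1)] x(2) y(2) by simp
qed

text \<open>
  A morphism into a separated functor identifies indistinguishable elements, hence factors through \<open>\<eta>\<close>.
\<close>

lemma reflection_exists: "\<exists>I \<delta>. full_reflection PSh (in_Mono A \<theta>) I \<eta> \<delta>"
proof -
  have "\<exists>I \<delta>. adjunction PSh (full_subcat PSh (in_Mono A \<theta>)) I id_func \<eta> \<delta>"
  proof (rule left_adjoint_of_universal_arrows[where r = "\<lambda>S. Tgt PSh (\<eta> S)"])
    show "is_functor (full_subcat PSh (in_Mono A \<theta>)) PSh id_func"
      by (rule full_subcat_inclusion[OF cat_PSh])
    fix S assume S: "S \<in> Ob PSh"
    note Q = morphism_obj(2)[OF eta(1)[OF S]]
    show QM: "Tgt PSh (\<eta> S) \<in> Ob (full_subcat PSh (in_Mono A \<theta>))"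
      using Q in_Mono_iff[OF Q] reflection_separated[OF S] by simp
    show "\<eta> S \<in> hom PSh S (omap id_func (Tgt PSh (\<eta> S)))" using eta(1)[OF S] by simp
    fix M k assume M: "M \<in> Ob (full_subcat PSh (in_Mono A \<theta>))" and k: "k \<in> hom PSh S (omap id_func M)"
    have kh: "k \<in> hom PSh S M" using k by simp
    have sep: "separated M" using M in_Mono_iff by auto
    have "app k a x = app k a y"
      if a: "a \<in> Ob A" and x: "x \<in> omap S a" and y: "y \<in> omap S a" and xy: "app (\<eta> S) a x = app (\<eta> S) a y"
        for a x y
    proof -
      have "indist S a x y" using eta(3)[OF S a x y] xy by simp
      then show ?thesis
        using sep a app_in[OF kh a x] app_in[OF kh a y] indist_app[OF kh x y] by (simp add: separated_def)
    qed
    from factor_through_surj[OF eta(1,2)[OF S] kh this]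
    obtain u where u: "u \<in> hom PSh (Tgt PSh (\<eta> S)) M" "u \<odot>\<^bsub>PSh\<^esub> \<eta> S = k" by blast
    have "u' = u" if u': "u' \<in> hom PSh (Tgt PSh (\<eta> S)) M" "u' \<odot>\<^bsub>PSh\<^esub> \<eta> S = k" for u'
      by (rule surj_epi[OF eta(1,2)[OF S] u'(1) u(1)])
        (use app_comp[OF eta(1)[OF S] u'(1)] app_comp[OF eta(1)[OF S] u(1)] u(2) u'(2) in simp)
    moreover have "u' \<in> hom (full_subcat PSh (in_Mono A \<theta>)) (Tgt PSh (\<eta> S)) M \<longleftrightarrow>
        u' \<in> hom PSh (Tgt PSh (\<eta> S)) M" for u'
      using QM M unfolding full_subcat_hom by simp
    ultimately show "\<exists>!u. u \<in> hom (full_subcat PSh (in_Mono A \<theta>)) (Tgt PSh (\<eta> S)) M \<and>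
        amap id_func u \<odot>\<^bsub>PSh\<^esub> \<eta> S = k"
      using u unfolding amap_id_func by blast
  qed (rule cat_PSh)
  then show ?thesis unfolding full_reflection_def using cat_PSh PSh_pullbacks by blast
qed

context
  fixes I \<delta>
  assumes refl: "full_reflection PSh (in_Mono A \<theta>) I \<eta> \<delta>"
begin

abbreviation E_I where "E_I \<equiv> E_cls PSh (in_Mono A \<theta>) I"

text \<open>
  By naturality \<open>I e\<close> sends the class of \<open>x\<close> to the class of \<open>e x\<close>, and on the image of \<open>K\<close> the classes are
  singletons. If \<open>e\<close> is injective there, then \<open>I e\<close> is injective everywhere by \<open>indist_reflect\<close>.
\<close>

lemma E_cls_iff_dense:
  assumes e: "e \<in> hom PSh S T"
  shows "e \<in> E_I \<longleftrightarrow> dense_iso S T e"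
proof -
  have adj: "adjunction PSh (full_subcat PSh (in_Mono A \<theta>)) I id_func \<eta> \<delta>"
    using refl by (simp add: full_reflection_def)
  note S = morphism_obj(1)[OF e] and T = morphism_obj(2)[OF e]
  have obj: "Tgt PSh (\<eta> V) = omap I V" if "V \<in> Ob PSh" for V
    using homD(3)[OF nat_trans_hom[OF adjunctionD(3)[OF adj] that]] by simp
  note \<eta>S = eta[OF S, unfolded obj[OF S]] and \<eta>T = eta[OF T, unfolded obj[OF T]]
  note If = functor_hom[OF adjunctionD(1)[OF adj] e]
  have Ie: "amap I e \<in> hom PSh (omap I S) (omap I T)" using If unfolding full_subcat_hom by simp
  have nat: "app (amap I e) a (app (\<eta> S) a x) = app (\<eta> T) a (app e a x)" if "a \<in> Ob A" "x \<in> omap S a"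
    for a x
    using nat_trans_eq[OF adjunctionD(3)[OF adj] e] app_comp[OF \<eta>S(1) Ie that] app_comp[OF e \<eta>T(1) that]
      by simp
  have "e \<in> E_I \<longleftrightarrow> is_iso PSh (amap I e)"
    using full_subcat_iso[OF If] homD(1)[OF e] by (simp add: E_cls_def)
  also have "\<dots> \<longleftrightarrow> (\<forall>a\<in>Ob A. bij_betw (app (amap I e) a) (omap (omap I S) a) (omap (omap I T) a))"
    by (rule iso_iff_bij[OF Ie])
  also have "\<dots> \<longleftrightarrow> dense_iso S T e"
  proof
    assume bij: "\<forall>a\<in>Ob A. bij_betw (app (amap I e) a) (omap (omap I S) a) (omap (omap I T) a)"
    have onto: "\<exists>x\<in>omap S a. indist T a (app e a x) y" if a: "a \<in> Ob A" and y: "y \<in> omap T a" for a y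
    proof -
      have "app (\<eta> T) a y \<in> app (amap I e) a ` omap (omap I S) a"
        using bij a app_in[OF \<eta>T(1) a y] by (simp add: bij_betw_def)
      then obtain v where v: "v \<in> omap (omap I S) a" "app (amap I e) a v = app (\<eta> T) a y" by auto
      obtain x where x: "x \<in> omap S a" "app (\<eta> S) a x = v" using surj_preimage[OF \<eta>S(1,2) a v(1)] .
      then show ?thesis using nat[OF a x(1)] v(2) \<eta>T(3)[OF a app_in[OF e a x(1)] y] by auto
    qed
    have "bij_betw (app e (omap K b)) (omap S (omap K b)) (omap T (omap K b))" if b: "b \<in> Ob B" for b
      unfolding bij_betw_def
    proof
      note Kb = functor_obj[OF K b]
      show "inj_on (app e (omap K b)) (omap S (omap K b))"
      proof (rule inj_onI)
        fix x y assume x: "x \<in> omap S (omap K b)" and y: "y \<in> omap S (omap K b)"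
          and xy: "app e (omap K b) x = app e (omap K b) y"
        have "inj_on (app (amap I e) (omap K b)) (omap (omap I S) (omap K b))" using bij Kb
          by (simp add: bij_betw_def)
        then have "app (\<eta> S) (omap K b) x = app (\<eta> S) (omap K b) y"
          by (rule inj_onD) (use nat[OF Kb] x y xy app_in[OF \<eta>S(1) Kb] in auto)
        then show "x = y" using inj_onD[OF eta_K_inj[OF S b]] x y by blast
      qed
      show "app e (omap K b) ` omap S (omap K b) = omap T (omap K b)"
      proof
        show "app e (omap K b) ` omap S (omap K b) \<subseteq> omap T (omap K b)" using app_in[OF e Kb] by blast
        show "omap T (omap K b) \<subseteq> app e (omap K b) ` omap S (omap K b)"
        proof
          fix y assume y: "y \<in> omap T (omap K b)"
          obtain x where x: "x \<in> omap S (omap K b)" "indist T (omap K b) (app e (omap K b) x) y"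
            using onto[OF Kb y] by blast
          then have "app e (omap K b) x = y" using indist_K[OF T b app_in[OF e Kb x(1)] y] by blast
          then show "y \<in> app e (omap K b) ` omap S (omap K b)" using x(1) by blast
        qed
      qed
    qed
    then show "dense_iso S T e" using onto by (simp add: dense_iso_def)
  next
    assume de: "dense_iso S T e"
    have inj: "\<And>b. b \<in> Ob B \<Longrightarrow> inj_on (app e (omap K b)) (omap S (omap K b))"
      by (rule dense_iso_inj[OF de])
    show "\<forall>a\<in>Ob A. bij_betw (app (amap I e) a) (omap (omap I S) a) (omap (omap I T) a)"
      unfolding bij_betw_def
    proof (intro ballI conjI)
      fix a assume a: "a \<in> Ob A"
      show "inj_on (app (amap I e) a) (omap (omap I S) a)"
      proof (rule inj_onI)
        fix v w assume v: "v \<in> omap (omap I S) a" and w: "w \<in> omap (omap I S) a"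
          and vw: "app (amap I e) a v = app (amap I e) a w"
        obtain x where x: "x \<in> omap S a" "app (\<eta> S) a x = v" using surj_preimage[OF \<eta>S(1,2) a v] .
        obtain y where y: "y \<in> omap S a" "app (\<eta> S) a y = w" using surj_preimage[OF \<eta>S(1,2) a w] .
        have "indist T a (app e a x) (app e a y)"
          using nat[OF a x(1)] nat[OF a y(1)] x(2) y(2) vw \<eta>T(3)[OF a app_in[OF e a x(1)] app_in[OF e a
            y(1)]] by simp
        then have "indist S a x y" using indist_reflect[OF e inj x(1) y(1)] by blast
        then show "v = w" using \<eta>S(3)[OF a x(1) y(1)] x(2) y(2) by simp
      qed
      show "app (amap I e) a ` omap (omap I S) a = omap (omap I T) a"
      proof
        show "app (amap I e) a ` omap (omap I S) a \<subseteq> omap (omap I T) a" using app_in[OF Ie a] by blast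
        show "omap (omap I T) a \<subseteq> app (amap I e) a ` omap (omap I S) a"
        proof
          fix v assume v: "v \<in> omap (omap I T) a"
          obtain y where y: "y \<in> omap T a" "app (\<eta> T) a y = v" using surj_preimage[OF \<eta>T(1,2) a v] .
          obtain x where x: "x \<in> omap S a" "indist T a (app e a x) y" using dense_iso_dense[OF de a y(1)] .
          have "app (amap I e) a (app (\<eta> S) a x) = v"
            using nat[OF a x(1)] \<eta>T(3)[OF a app_in[OF e a x(1)] y(1)] x(2) y(2) by simp
          then show "v \<in> app (amap I e) a ` omap (omap I S) a" using app_in[OF \<eta>S(1) a x(1)] by blast
        qed
      qed
    qed
  qed
  finally show ?thesis .
qed

lemma collapsing_in_E_cls: "e \<in> collapsing \<Longrightarrow> e \<in> E_I"
proof -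
  assume e: "e \<in> collapsing"
  then have "e \<in> hom PSh (Src PSh e) (Tgt PSh e)" by (simp add: collapsing_def hom_def)
  then show ?thesis using E_cls_iff_dense collapsing_dense e by blast
qed

lemma collapsing_in_E'_cls: "e \<in> collapsing \<Longrightarrow> e \<in> E'_cls PSh (in_Mono A \<theta>) I"
proof -
  assume e: "e \<in> collapsing"
  then have "e \<in> Mor PSh" by (simp add: collapsing_def)
  then show ?thesis using collapsing_in_E_cls[OF collapsing_pullback[OF e]] unfolding E'_cls_def by blast
qed

lemma reflection_stable_units: "stable_units PSh (in_Mono A \<theta>) I \<eta>"
  unfolding stable_units_def using eta_collapsing collapsing_in_E'_cls by blast

lemma E'_cls_eq_collapsing:
  assumes cog: "cogenerating A (omap K ` Ob B)"
  shows "E'_cls PSh (in_Mono A \<theta>) I = collapsing"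
proof
  show "E'_cls PSh (in_Mono A \<theta>) I \<subseteq> collapsing"
  proof
    fix f assume f: "f \<in> E'_cls PSh (in_Mono A \<theta>) I"
    let ?S = "Src PSh f" and ?T = "Tgt PSh f"
    have fh: "f \<in> hom PSh ?S ?T" using f by (simp add: E'_cls_def hom_def)
    note S = morphism_obj(1)[OF fh] and T = morphism_obj(2)[OF fh]
    have st: "dense_iso (Src PSh f') (Src PSh p) f'" if "is_pullback PSh f p f' p'" for p f' p'
      using f that E_cls_iff_dense[OF is_pullbackD(3)[OF that]] unfolding E'_cls_def by blast
    have surj: "cw_surj A f" by (rule surj_of_stably_dense[OF fh cog st])
    have "elementwise_pullback ?S ?T ?S f (Idn PSh ?T) f (Idn PSh ?S)"
      using app_in[OF fh] by (auto simp: elementwise_pullback_def app_id[OF S] app_id[OF T])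
    from st[OF pullback_of_elementwise[OF fh cat_id[OF cat_PSh T] fh cat_id[OF cat_PSh S] this]]
    show "f \<in> collapsing" using surj collapsing_iff[OF fh] by (simp add: dense_iso_def bij_betw_def)
  qed
qed (use collapsing_in_E'_cls in blast)

text \<open>
  Lifting the identity along the collapsing part of \<open>m\<close> gives a retraction of that part, which is
  therefore injective.
\<close>

lemma M_cls_separating:
  assumes m: "m \<in> M_cls PSh (in_Mono A \<theta>) I"
  shows "m \<in> separating"
proof -
  let ?S = "Src PSh m" and ?T = "Tgt PSh m"
  have mM: "m \<in> Mor PSh" using m by (simp add: M_cls_def)
  have mh: "m \<in> hom PSh ?S ?T" using hom_Src_Tgt[OF mM] .
  obtain e n where e: "e \<in> collapsing" and n: "n \<in> separating"
    and en: "Tgt PSh e = Src PSh n" "m = n \<odot>\<^bsub>PSh\<^esub> e"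
    using collapsing_separating_factorization[OF mM] by blast
  let ?Q = "Src PSh n"
  have eM: "e \<in> Mor PSh" and nM: "n \<in> Mor PSh" using e n by (auto simp: collapsing_def separating_def)
  have eh: "e \<in> hom PSh ?S ?Q" and nh: "n \<in> hom PSh ?Q ?T"
    using eM nM en cat_comp_Mor[OF cat_PSh eM nM en(1)] by (auto intro: homI)
  note S = morphism_obj(1)[OF mh]
  have "orthogonal PSh e m" using m collapsing_in_E_cls[OF e] by (simp add: M_cls_def)
  then have "\<exists>!w. w \<in> hom PSh ?Q ?S \<and> w \<odot>\<^bsub>PSh\<^esub> e = Idn PSh ?S \<and> m \<odot>\<^bsub>PSh\<^esub> w = n"
    using cat_id[OF cat_PSh S] nh en(2) cat_idr[OF cat_PSh mh] unfolding orthogonal_def homD(2,3)[OF eh]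
      by metis
  then obtain w where w: "w \<in> hom PSh ?Q ?S" "w \<odot>\<^bsub>PSh\<^esub> e = Idn PSh ?S" by blast
  show ?thesis
    unfolding separating_iff[OF mh]
  proof (intro ballI impI)
    fix a x y assume a: "a \<in> Ob A" and x: "x \<in> omap ?S a" and y: "y \<in> omap ?S a"
      and mxy: "app m a x = app m a y" and xy: "indist ?S a x y"
    have "app n a (app e a x) = app n a (app e a y)"
      using mxy app_comp[OF eh nh a x] app_comp[OF eh nh a y] en(2) by simp
    then have "app e a x = app e a y"
      using n separating_iff[OF nh] a app_in[OF eh a x] app_in[OF eh a y] indist_app[OF eh x y xy] by blast
    then show "x = y"
      using app_comp[OF eh w(1) a x] app_comp[OF eh w(1) a y] w(2) app_id[OF S a x] app_id[OF S a y] by simp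
  qed
qed

lemma Mstar_cls_eq_separating:
  assumes cog: "cogenerating A (omap K ` Ob B)"
    and ess: "essentially_small TYPE('u) A" and into: "all_map_into A (omap K ` Ob B)"
  shows "Mstar_cls PSh (in_Mono A \<theta>) I = separating"
proof
  show "Mstar_cls PSh (in_Mono A \<theta>) I \<subseteq> separating"
  proof
    fix f assume "f \<in> Mstar_cls PSh (in_Mono A \<theta>) I"
    then obtain p f' p' where ed: "effective_descent PSh p" and pb: "is_pullback PSh f p f' p'"
      and f': "f' \<in> M_cls PSh (in_Mono A \<theta>) I"
      unfolding Mstar_cls_def by blast
    note fh = is_pullbackD(1)[OF pb] and ph = is_pullbackD(2)[OF pb]
    note el = elementwise_of_pullback[OF pb fh ph]
    show "f \<in> separating"
      by (rule separating_descends[OF fh ph effective_descent_surj[OF ph ed] el M_cls_separating[OF f']])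
  qed
  show "separating \<subseteq> Mstar_cls PSh (in_Mono A \<theta>) I"
  proof
    fix f assume f: "f \<in> separating"
    have fM: "f \<in> Mor PSh" using f by (simp add: separating_def)
    note fh = hom_Src_Tgt[OF fM]
    obtain E p where p: "p \<in> hom PSh E (Tgt PSh f)" "cw_surj A p" and E: "separated E"
      using separated_cover_exists[OF morphism_obj(2)[OF fh] cog ess into] by blast
    obtain P f' p' where f': "f' \<in> hom PSh P E" and p': "p' \<in> hom PSh P (Src PSh f)"
      and el: "elementwise_pullback (Src PSh f) E P f p f' p'"
      using elementwise_pullback_exists[OF fh p(1)] by blast
    have P: "separated P" by (rule pullback_of_separating_separated[OF fh p(1) f' p' el f E])
    have "orthogonal PSh e f'" if e: "e \<in> E_I" for e
    proof -
      have "e \<in> Mor PSh" using e by (simp add: E_cls_def)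
      note eh = hom_Src_Tgt[OF this]
      show ?thesis
        using dense_orthogonal_separated[OF eh _ f' P E] E_cls_iff_dense[OF eh] e by blast
    qed
    then have "f' \<in> M_cls PSh (in_Mono A \<theta>) I" using homD(1)[OF f'] by (simp add: M_cls_def)
    then show "f \<in> Mstar_cls PSh (in_Mono A \<theta>) I"
      unfolding Mstar_cls_def
      using fM surj_effective_descent[OF p] pullback_of_elementwise[OF fh p(1) f' p' el] by blast
  qed
qed

lemma reflection_monotone_light:
  assumes "cogenerating A (omap K ` Ob B)" "essentially_small TYPE('u) A" "all_map_into A (omap K ` Ob B)"
  shows "monotone_light PSh (in_Mono A \<theta>) I"
  unfolding monotone_light_def E'_cls_eq_collapsing[OF assms(1)] Mstar_cls_eq_separating[OF assms]
  by (rule collapsing_separating_factorization_system)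

end

end

theorem theorem4p1:
  fixes A :: "('a, 'f) cat" and B :: "('b, 'g) cat" and K :: "('b, 'g, 'a, 'f) func"
  assumes "universe TYPE('u)"
    and "small_category TYPE('u) B"
    and "small_homs TYPE('u) A"
    and "is_functor B A K"
  defines "SetA \<equiv> Fun A (SetCat :: ('u set, 'u smap) cat)"
  shows
    "(\<exists>R \<theta> \<epsilon>. pointwise_ran_adjunction A B (SetCat :: ('u set, 'u smap) cat) K R \<theta> \<epsilon>) \<and>
     (\<forall>R \<theta> \<epsilon>. pointwise_ran_adjunction A B (SetCat :: ('u set, 'u smap) cat) K R \<theta> \<epsilon> \<longrightarrow>
        (\<exists>\<eta> \<mu>. unit_factorization A \<theta> \<eta> \<mu>) \<and>
        (\<forall>\<eta> \<mu>. unit_factorization A \<theta> \<eta> \<mu> \<longrightarrow>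
           (\<exists>I \<delta>. full_reflection SetA (in_Mono A \<theta>) I \<eta> \<delta>) \<and>
           (\<forall>I \<delta>. full_reflection SetA (in_Mono A \<theta>) I \<eta> \<delta> \<longrightarrow>
              stable_units SetA (in_Mono A \<theta>) I \<eta> \<and>
              (cogenerating A (omap K ` Ob B) \<and>
               essentially_small TYPE('u) A \<and>
               all_map_into A (omap K ` Ob B) \<longrightarrow>
               monotone_light SetA (in_Mono A \<theta>) I))))"
proof -
  interpret kan_extension A "TYPE('u)" B K
    by unfold_locales (use assms in \<open>auto simp: small_homs_def\<close>)
  show ?thesis
    unfolding SetA_def
  proof (intro conjI allI impI)
    show "\<exists>R \<theta> \<epsilon>. pointwise_ran_adjunction A B (SetCat :: ('u set, 'u smap) cat) K R \<theta> \<epsilon>"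
      by (rule pointwise_ran_exists)
  next
    fix R \<theta> \<epsilon> assume "pointwise_ran_adjunction A B (SetCat :: ('u set, 'u smap) cat) K R \<theta> \<epsilon>"
    then interpret kan_adjunction A "TYPE('u)" B K R \<theta> \<epsilon>
      by unfold_locales
    show "\<exists>\<eta> \<mu>. unit_factorization A \<theta> \<eta> \<mu>" by (rule unit_factorization_exists)
    fix \<eta> \<mu> assume "unit_factorization A \<theta> \<eta> \<mu>"
    then interpret unit_factorized A "TYPE('u)" B K R \<theta> \<epsilon> \<eta> \<mu>
      by unfold_locales
    show "\<exists>I \<delta>. full_reflection PSh (in_Mono A \<theta>) I \<eta> \<delta>" by (rule reflection_exists)
    fix I \<delta> assume refl: "full_reflection PSh (in_Mono A \<theta>) I \<eta> \<delta>"
    show "stable_units PSh (in_Mono A \<theta>) I \<eta>" by (rule reflection_stable_units[OF refl])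
    assume "cogenerating A (omap K ` Ob B) \<and> essentially_small TYPE('u) A \<and> all_map_into A (omap K ` Ob B)"
    then show "monotone_light PSh (in_Mono A \<theta>) I" using reflection_monotone_light[OF refl] by blast
  qed
qed

end
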